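(* Let $c>0$, $\gamma<0$, $a\le 0$ and $p>2$. Then $F$ does not have critical points on $S(c)$.
   Context: All functions are real-valued on $\mathbb{R}^2$. $X=\{u\in H^1(\mathbb{R}^2): \int_{\mathbb{R}^2}\log(1+|x|)u^2(x)\,dx<\infty\}$ is the Hilbert space with norm $\|u\|_X^2=\int_{\mathbb{R}^2}(|\nabla u|^2+u^2)\,dx+\int_{\mathbb{R}^2}\log(1+|x|)u^2(x)\,dx$. For $c>0$, $S(c)=\{u\in X:\int_{\mathbb{R}^2}u^2\,dx=c\}$. The functional $F:X\to\mathbb{R}$ (of class $C^1$) is $$F(u)=\tfrac12\int_{\mathbb{R}^2}|\nabla u|^2dx+\tfrac{\gamma}{4}\iint_{\mathbb{R}^2\times\mathbb{R}^2}|u(x)|^2|u(y)|^2\log(|x-y|)\,dx\,dy-\tfrac{a}{p}\int_{\mathbb{R}^2}|u|^p\,dx.$$ A critical point of $F$ on $S(c)$ means a critical point of the restriction of $F$ to $S(c)$: $u\in S(c)$ with $dF(u)[\psi]=0$ for all $\psi\in X$ such that $\int_{\mathbb{R}^2}u\psi\,dx=0$. *)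

theory Defs
  imports "HOL-Analysis.Analysis"
begin

type_synonym plane = "real^2"

definition partial :: "2 \<Rightarrow> (plane \<Rightarrow> real) \<Rightarrow> plane \<Rightarrow> real" where
  "partial i f x = frechet_derivative f (at x) (axis i 1)"

primrec C_times :: "nat \<Rightarrow> (plane \<Rightarrow> real) \<Rightarrow> bool" where
  "C_times 0 f \<longleftrightarrow> continuous_on UNIV f"
| "C_times (Suc k) f \<longleftrightarrow> (\<forall>x. f differentiable (at x)) \<and> (\<forall>i. C_times k (partial i f))"

definition test_function :: "(plane \<Rightarrow> real) \<Rightarrow> bool" where
  "test_function \<phi> \<longleftrightarrow> (\<forall>k. C_times k \<phi>) \<and> compact (closure {x. \<phi> x \<noteq> 0})"

text \<open>
  Elements of Lebesgue and Sobolev spaces are represented by Borel functions on the plane;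
  every equivalence class modulo null sets has a Borel representative, and all the notions
  below depend only on the class.
\<close>

definition L2 :: "(plane \<Rightarrow> 'b::real_normed_vector) set" where
  "L2 = {f \<in> borel_measurable lborel. integrable lborel (\<lambda>x. (norm (f x))\<^sup>2)}"

definition weak_gradient :: "(plane \<Rightarrow> real) \<Rightarrow> (plane \<Rightarrow> plane) \<Rightarrow> bool" where
  "weak_gradient u g \<longleftrightarrow> g \<in> L2 \<and>
     (\<forall>\<phi> i. test_function \<phi> \<longrightarrow>
        (LINT x|lborel. u x * partial i \<phi> x) = - (LINT x|lborel. g x $ i * \<phi> x))"

definition H1 :: "(plane \<Rightarrow> real) set" where
  "H1 = {u \<in> L2. \<exists>g. weak_gradient u g}"

text \<open>For \<open>u\<close> in \<open>H1\<close> the weak gradient is unique up to null sets.\<close>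

definition grad :: "(plane \<Rightarrow> real) \<Rightarrow> plane \<Rightarrow> plane" where
  "grad u = (SOME g. weak_gradient u g)"

definition X :: "(plane \<Rightarrow> real) set" where
  "X = {u \<in> H1. integrable lborel (\<lambda>x. ln (1 + norm x) * (u x)\<^sup>2)}"

definition S :: "real \<Rightarrow> (plane \<Rightarrow> real) set" where
  "S c = {u \<in> X. (LINT x|lborel. (u x)\<^sup>2) = c}"

text \<open>
  On the null set \<open>x = y\<close> the logarithm takes the library value \<open>ln 0 = 0\<close>.
  For \<open>u\<close> in \<open>X\<close> and \<open>p > 2\<close> all three integrands are integrable.
\<close>

definition F :: "real \<Rightarrow> real \<Rightarrow> real \<Rightarrow> (plane \<Rightarrow> real) \<Rightarrow> real" where
  "F \<gamma> a p u =
     1 / 2 * (LINT x|lborel. (norm (grad u x))\<^sup>2)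
     + \<gamma> / 4 * (LINT (x, y)|(lborel \<Otimes>\<^sub>M lborel). \<bar>u x\<bar>\<^sup>2 * \<bar>u y\<bar>\<^sup>2 * ln (norm (x - y)))
     - a / p * (LINT x|lborel. \<bar>u x\<bar> powr p)"

text \<open>
  \<open>has_differential_along G u \<psi> d\<close> says \<open>dG(u)[\<psi>] = d\<close>, as a directional derivative.
  As \<open>F\<close> is of class \<open>C\<^sup>1\<close> on \<open>X\<close>, this is the value of its Frechet differential at \<open>\<psi>\<close>.
\<close>

definition has_differential_along ::
    "((plane \<Rightarrow> real) \<Rightarrow> real) \<Rightarrow> (plane \<Rightarrow> real) \<Rightarrow> (plane \<Rightarrow> real) \<Rightarrow> real \<Rightarrow> bool" where
  "has_differential_along G u \<psi> d \<longleftrightarrow>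
     ((\<lambda>t. G (\<lambda>x. u x + t * \<psi> x)) has_real_derivative d) (at 0)"

definition critical_point_on_S ::
    "((plane \<Rightarrow> real) \<Rightarrow> real) \<Rightarrow> real \<Rightarrow> (plane \<Rightarrow> real) \<Rightarrow> bool" where
  "critical_point_on_S G c u \<longleftrightarrow> u \<in> S c \<and>
     (\<forall>\<psi>\<in>X. (LINT x|lborel. u x * \<psi> x) = 0 \<longrightarrow> has_differential_along G u \<psi> 0)"

end

theory Submission imports Defs "HOL-Real_Asymp.Real_Asymp" begin

text \<open>
  Let \<open>u\<close> be a critical point with mass \<open>c\<close>. Formally, pairing the equation of \<open>u\<close> with
  \<open>x\<^sub>1 \<partial>\<^sub>1u + u/2\<close>, the generator of the mass-preserving dilations of the first coordinate, gives
  \<open>- \<integral>(\<partial>\<^sub>1u)\<^sup>2 + a (1/2 - 1/p) \<integral>|u|\<^sup>p + \<gamma>/4 \<integral>\<integral> u(x)\<^sup>2 u(y)\<^sup>2 (x\<^sub>1 - y\<^sub>1)\<^sup>2 / |x - y|\<^sup>2 = 0\<close>.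
  For \<open>a \<le> 0\<close>, \<open>p > 2\<close> and \<open>\<gamma> < 0\<close> no term is positive and the last one is negative, which is
  absurd. The function \<open>x\<^sub>1 \<partial>\<^sub>1u\<close> need not be an admissible direction, however, and making it one
  would take elliptic regularity and decay estimates. The proof below avoids both.

  Instead of differentiating along the dilations, compare \<open>u\<close> with a genuine competitor: the
  transport \<open>V = u \<circ> \<Phi>\<^sup>-\<^sup>1\<close> of \<open>u\<close> along \<open>\<Phi>(x) = x + t \<xi>(x) e\<^sub>1\<close>, \<open>\<xi>(x) = x\<^sub>1 / (1 + \<epsilon>|x|\<^sup>2)\<close>, rescaled so
  that \<open>\<mu>V - u\<close> is orthogonal to \<open>u\<close>. As \<open>a \<le> 0\<close>, the kinetic and the power term are convex along
  the segment from \<open>u\<close> to \<open>\<mu>V\<close>, so criticality yields an inequality in which they occur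
  only through their values at the two end points (\<open>critical_point_convexity\<close>). The first
  variation of the interaction in the direction \<open>V\<close> is a combination of the interactions of \<open>u\<close>
  and \<open>V\<close> up to an error bounded by \<open>\<integral> (1 + ln (1 + |x|)) (V - u)\<^sup>2\<close>
  (\<open>interaction_variation_expansion\<close>), and this error is at most a constant times
  \<open>t\<^sup>2 / \<epsilon>\<^sup>2\<close> because \<open>\<xi>\<close> decays at infinity (\<open>deformed_diff_bound\<close>). Everything that is left is
  an explicit integral after the change of variables \<open>\<Phi>\<close>. Taking \<open>t = \<epsilon>\<^sup>3/4\<close>, dividing by \<open>t\<close> and
  letting \<open>\<epsilon>\<close> tend to \<open>0\<close> by dominated convergence turns the inequality into the statement that
  the left-hand side of the formal identity is nonnegative.

  Three facts about weak gradients support this. Test functions are dense in the square integrable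
  functions, so norms can be computed by duality (\<open>weighted_duality\<close>) and weak gradients are unique.
  Square integrable functions with a weak gradient lie in every \<open>L\<^sup>q\<close> with \<open>q \<ge> 2\<close>
  (\<open>Sobolev_embedding\<close>), which makes the power term and the logarithmic interaction finite. Weak
  gradients transform under \<open>\<Phi>\<close> by the chain rule (\<open>deformed_weak_gradient\<close>).
\<close>

section \<open>Smooth functions and test functions on the plane\<close>

definition smooth :: "(plane \<Rightarrow> real) \<Rightarrow> bool" where
  "smooth f \<longleftrightarrow> (\<forall>k. C_times k f)"

lemma partial_eqI: "(f has_derivative D) (at x) \<Longrightarrow> partial i f x = D (axis i 1)"
  unfolding partial_def by (metis frechet_derivative_at)

lemma C_times_SucI:
  assumes "\<And>x. (f has_derivative D x) (at x)" "\<And>i. C_times k (\<lambda>x. D x (axis i 1))"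
  shows "C_times (Suc k) f"
proof -
  have "partial i f = (\<lambda>x. D x (axis i 1))" for i
    using partial_eqI[OF assms(1)] by blast
  then show ?thesis using assms by (auto simp: differentiable_def)
qed

lemma C_times_Suc_imp: "C_times (Suc k) f \<Longrightarrow> C_times k f"
proof (induction k arbitrary: f)
  case 0
  then show ?case
    by (auto intro!: continuous_at_imp_continuous_on differentiable_imp_continuous_within)
next
  case (Suc k)
  then show ?case by (metis C_times.simps(2))
qed

lemma C_times_const: "C_times k (\<lambda>x. c)"
proof (induction k arbitrary: c)
  case (Suc k)
  then show ?case by (intro C_times_SucI[where D="\<lambda>x h. 0"]) auto
qed auto

lemma C_times_has_derivative:
  "C_times (Suc k) f \<Longrightarrow> (f has_derivative frechet_derivative f (at x)) (at x)"
  by (simp add: frechet_derivative_works)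

lemma C_times_partial: "C_times (Suc k) f \<Longrightarrow> C_times k (\<lambda>x. frechet_derivative f (at x) (axis i 1))"
  unfolding partial_def[abs_def] by (simp add: partial_def[abs_def])

lemma C_times_add: "C_times k f \<Longrightarrow> C_times k g \<Longrightarrow> C_times k (\<lambda>x. f x + g x)"
proof (induction k arbitrary: f g)
  case (Suc k)
  show ?case
    by (rule C_times_SucI[OF has_derivative_add[OF C_times_has_derivative[OF Suc.prems(1)]
            C_times_has_derivative[OF Suc.prems(2)]]])
       (intro Suc.IH C_times_partial Suc.prems)
qed (auto intro!: continuous_intros)

lemma C_times_mult: "C_times k f \<Longrightarrow> C_times k g \<Longrightarrow> C_times k (\<lambda>x. f x * g x)"
proof (induction k arbitrary: f g)
  case (Suc k)
  show ?case
    by (rule C_times_SucI[OF has_derivative_mult[OF C_times_has_derivative[OF Suc.prems(1)]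
            C_times_has_derivative[OF Suc.prems(2)]]])
       (intro C_times_add Suc.IH C_times_partial Suc.prems C_times_Suc_imp)
qed (auto intro!: continuous_intros)

lemma C_times_inverse:
  assumes "C_times k f" "\<And>x. f x > 0"
  shows "C_times k (\<lambda>x. inverse (f x))"
  using assms
proof (induction k arbitrary: f)
  case 0
  then have "f x \<noteq> 0" for x by (metis less_irrefl)
  with 0 show ?case by (auto intro!: continuous_on_inverse)
next
  case (Suc k)
  have nz: "f x \<noteq> 0" for x using Suc.prems(2)[of x] by simp
  have "((\<lambda>x. inverse (f x)) has_derivative
      (\<lambda>h. (-1) * (frechet_derivative f (at x) h * (inverse (f x) * inverse (f x))))) (at x)" for x
    by (rule has_derivative_eq_rhs[OF Deriv.has_derivative_inverse[OF nz C_times_has_derivative[OF Suc.prems(1)]]])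
       (auto simp: fun_eq_iff algebra_simps)
  then show ?case
    by (rule C_times_SucI)
       (intro C_times_mult C_times_const Suc.IH C_times_partial Suc.prems C_times_Suc_imp)
qed

lemma C_times_coord: "C_times k (\<lambda>x. x $ i)"
proof (cases k)
  case (Suc k')
  have "((\<lambda>x::plane. x $ i) has_derivative (\<lambda>h. h $ i)) (at x)" for x
    by (intro bounded_linear_imp_has_derivative bounded_linear_vec_nth)
  then show ?thesis unfolding Suc
    by (rule C_times_SucI) (intro C_times_const)
qed (auto intro!: continuous_intros)

lemma smooth_intros:
  "smooth (\<lambda>x. c)" "smooth (\<lambda>x. x $ i)"
  "smooth f \<Longrightarrow> smooth g \<Longrightarrow> smooth (\<lambda>x. f x + g x)"
  "smooth f \<Longrightarrow> smooth g \<Longrightarrow> smooth (\<lambda>x. f x * g x)"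
  "smooth f \<Longrightarrow> (\<And>x. f x > 0) \<Longrightarrow> smooth (\<lambda>x. inverse (f x))"
  by (auto simp: smooth_def C_times_const C_times_coord C_times_add C_times_mult C_times_inverse)

lemma smooth_uminus: "smooth f \<Longrightarrow> smooth (\<lambda>x. - f x)"
  using smooth_intros(4)[of "\<lambda>x. -1" f] smooth_intros(1) by simp

lemma smooth_diff: "smooth f \<Longrightarrow> smooth g \<Longrightarrow> smooth (\<lambda>x. f x - g x)"
  using smooth_intros(3)[OF _ smooth_uminus, of f g] by simp

lemma smooth_divide: "smooth f \<Longrightarrow> smooth g \<Longrightarrow> (\<And>x. g x > 0) \<Longrightarrow> smooth (\<lambda>x. f x / g x)"
  unfolding divide_inverse by (intro smooth_intros)

lemma smooth_power: "smooth f \<Longrightarrow> smooth (\<lambda>x. f x ^ n)"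
  by (induction n) (auto intro!: smooth_intros)

lemma smooth_partial: "smooth f \<Longrightarrow> smooth (partial i f)"
  unfolding smooth_def by (metis C_times.simps(2))

lemma smooth_has_derivative: "smooth f \<Longrightarrow> (f has_derivative frechet_derivative f (at x)) (at x)"
  unfolding smooth_def by (metis C_times_has_derivative)

lemma smooth_continuous_on: "smooth f \<Longrightarrow> continuous_on A f"
  unfolding smooth_def by (metis C_times.simps(1) continuous_on_subset top_greatest)

lemma plane_eq: "(h::plane) = h $ 1 *\<^sub>R axis 1 1 + h $ 2 *\<^sub>R axis 2 1"
  by (simp add: vec_eq_iff forall_2 axis_def)

lemma frechet_derivative_plane:
  assumes "(f has_derivative frechet_derivative f (at x)) (at x)"
  shows "frechet_derivative f (at x) h = h $ 1 * partial 1 f x + h $ 2 * partial 2 f x"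
proof -
  interpret linear "frechet_derivative f (at x)"
    using assms has_derivative_linear by blast
  have "frechet_derivative f (at x) h = frechet_derivative f (at x) (h $ 1 *\<^sub>R axis 1 1 + h $ 2 *\<^sub>R axis 2 1)"
    using plane_eq[of h] by simp
  then show ?thesis unfolding add scale partial_def by simp
qed

lemma smooth_has_derivative':
  assumes "smooth f"
  shows "(f has_derivative (\<lambda>h. h $ 1 * partial 1 f x + h $ 2 * partial 2 f x)) (at x)"
  by (rule has_derivative_eq_rhs[OF smooth_has_derivative[OF assms]])
     (simp add: fun_eq_iff frechet_derivative_plane[OF smooth_has_derivative[OF assms]])

text \<open>By the chain rule the partial derivatives of \<open>f \<circ> \<Phi>\<close> are sums of products of smooth functions with
  functions \<open>(\<partial>\<^sub>l f) \<circ> \<Phi>\<close>, to which the induction hypothesis applies.\<close>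

lemma C_times_compose_map:
  fixes \<Phi> :: "plane \<Rightarrow> plane"
  assumes "\<And>i. smooth (\<lambda>x. \<Phi> x $ i)" "C_times k f"
  shows "C_times k (\<lambda>x. f (\<Phi> x))"
  using assms(2)
proof (induction k arbitrary: f)
  case 0
  have "continuous_on UNIV \<Phi>"
    using continuous_on_vec_lambda[of UNIV "\<lambda>i x. \<Phi> x $ i"] smooth_continuous_on[OF assms(1)] by simp
  with 0 show ?case using continuous_on_compose2[of UNIV f UNIV \<Phi>] by simp
next
  case (Suc k)
  have d: "(\<Phi> has_derivative (\<lambda>h. \<chi> i. frechet_derivative (\<lambda>x. \<Phi> x $ i) (at x) h)) (at x)" for x
    using smooth_has_derivative[OF assms(1)]
    by (subst has_derivative_componentwise_within) (auto simp: Basis_vec_def inner_axis)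
  note e = frechet_derivative_plane[OF C_times_has_derivative[OF Suc.prems]]
  have "((\<lambda>x. f (\<Phi> x)) has_derivative (\<lambda>h.
      frechet_derivative (\<lambda>x. \<Phi> x $ 1) (at x) h * partial 1 f (\<Phi> x)
      + frechet_derivative (\<lambda>x. \<Phi> x $ 2) (at x) h * partial 2 f (\<Phi> x))) (at x)" for x
    by (rule has_derivative_eq_rhs[OF has_derivative_compose[OF d C_times_has_derivative[OF Suc.prems]]])
       (auto simp: fun_eq_iff e)
  then show ?case
  proof (rule C_times_SucI)
    fix i
    have "C_times k (\<lambda>x. frechet_derivative (\<lambda>x. \<Phi> x $ l) (at x) (axis i 1))" for l
      using assms(1)[of l] by (intro C_times_partial) (auto simp: smooth_def)
    moreover have "C_times k (\<lambda>x. partial l f (\<Phi> x))" for l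
      using Suc.IH Suc.prems by auto
    ultimately show "C_times k (\<lambda>x. frechet_derivative (\<lambda>x. \<Phi> x $ 1) (at x) (axis i 1) * partial 1 f (\<Phi> x)
      + frechet_derivative (\<lambda>x. \<Phi> x $ 2) (at x) (axis i 1) * partial 2 f (\<Phi> x))"
      by (intro C_times_add C_times_mult)
  qed
qed

lemma smooth_compose_map:
  fixes \<Phi> :: "plane \<Rightarrow> plane"
  assumes "\<And>i. smooth (\<lambda>x. \<Phi> x $ i)" "smooth f"
  shows "smooth (\<lambda>x. f (\<Phi> x))"
  using C_times_compose_map assms unfolding smooth_def by blast

lemma test_function_iff: "test_function \<phi> \<longleftrightarrow> smooth \<phi> \<and> bounded {x. \<phi> x \<noteq> 0}"
  by (simp add: test_function_def smooth_def)

lemma test_function_smooth: "test_function \<phi> \<Longrightarrow> smooth \<phi>"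
  by (simp add: test_function_iff)

lemma test_function_zero: "test_function (\<lambda>x. 0)"
  by (auto simp: test_function_iff intro: smooth_intros)

lemma test_function_add: "test_function f \<Longrightarrow> test_function g \<Longrightarrow> test_function (\<lambda>x. f x + g x)"
  by (auto simp: test_function_iff intro!: smooth_intros
      intro: bounded_subset[OF bounded_Un[THEN iffD2, of "{x. f x \<noteq> 0}" "{x. g x \<noteq> 0}"]])

lemma test_function_mult: "smooth f \<Longrightarrow> test_function g \<Longrightarrow> test_function (\<lambda>x. f x * g x)"
  by (auto simp: test_function_iff intro!: smooth_intros intro: bounded_subset)

lemma test_function_outside:
  assumes "test_function \<phi>"
  obtains R where "R > 0" "\<And>x. norm x \<ge> R \<Longrightarrow> \<phi> x = 0"
proof -
  obtain R where "\<forall>x\<in>{x. \<phi> x \<noteq> 0}. norm x < R"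
    using assms unfolding test_function_iff bounded_pos_less by auto
  then have "\<And>x. norm x \<ge> max R 1 \<Longrightarrow> \<phi> x = 0" by fastforce
  then show thesis using that[of "max R 1"] by simp
qed

lemma test_function_partial:
  assumes "test_function \<phi>" shows "test_function (partial i \<phi>)"
proof -
  obtain R where R: "R > 0" "\<And>x. norm x \<ge> R \<Longrightarrow> \<phi> x = 0"
    using test_function_outside[OF assms] by blast
  have "partial i \<phi> x = 0" if "norm x > R" for x
  proof -
    have "open {x::plane. norm x > R}" by (intro open_Collect_less continuous_intros)
    then have "(\<phi> has_derivative (\<lambda>h. 0)) (at x)"
      using that R by (intro has_derivative_transform_within_open[of "\<lambda>x. 0" "\<lambda>h. 0" x UNIV "{x. norm x > R}" \<phi>])
        (auto simp: less_imp_le)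
    then show ?thesis using partial_eqI by blast
  qed
  then have "bounded {x. partial i \<phi> x \<noteq> 0}"
    by (intro bounded_subset[OF bounded_cball[of 0 R]]) (force simp: not_le[symmetric])
  then show ?thesis using assms smooth_partial by (auto simp: test_function_iff)
qed

lemma continuous_vanishing_bounded:
  fixes f :: "plane \<Rightarrow> real"
  assumes "continuous_on UNIV f" "\<And>x. norm x \<ge> R \<Longrightarrow> f x = 0"
  obtains C where "C > 0" "\<And>x. \<bar>f x\<bar> \<le> C"
proof -
  have "compact (f ` cball 0 R)"
    using assms by (intro compact_continuous_image) (auto intro: continuous_on_subset)
  then obtain C where C: "\<forall>y\<in>f ` cball 0 R. norm y \<le> C"
    using compact_imp_bounded bounded_iff by metis
  have "\<bar>f x\<bar> \<le> max C 1" for x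
    using C assms(2)[of x] by (cases "norm x \<le> R") (auto simp: le_max_iff_disj)
  then show thesis using that[of "max C 1"] by simp
qed

lemma test_function_bounded:
  assumes "test_function \<phi>"
  obtains C where "C > 0" "\<And>x. \<bar>\<phi> x\<bar> \<le> C"
proof -
  obtain R where "R > 0" "\<And>x. norm x \<ge> R \<Longrightarrow> \<phi> x = 0"
    using test_function_outside[OF assms] by blast
  then show thesis using continuous_vanishing_bounded[of \<phi> R] that
      smooth_continuous_on[OF test_function_smooth[OF assms]] by metis
qed

lemma smooth_measurable: "smooth \<phi> \<Longrightarrow> \<phi> \<in> borel_measurable borel"
  using smooth_continuous_on borel_measurable_continuous_onI by blast

text \<open>The profile whose derivatives at \<open>0\<close> all vanish; the powers of \<open>1 / s\<close> make the
  family closed under differentiation.\<close>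

definition flat_exp :: "nat \<Rightarrow> real \<Rightarrow> real" where
  "flat_exp m s = (if s > 0 then (1 / s) ^ m * exp (- (1 / s)) else 0)"

lemma flat_exp_tendsto_0: "(flat_exp m \<longlongrightarrow> 0) (at 0)"
proof -
  have "((\<lambda>s. s ^ m / exp s) \<longlongrightarrow> (0::real)) at_top"
    by (rule tendsto_power_div_exp_0)
  then have "((\<lambda>s. (inverse s) ^ m / exp (inverse s)) \<longlongrightarrow> (0::real)) (at_right 0)"
    using filterlim_inverse_at_top_right by (rule filterlim_compose)
  then have r: "(flat_exp m \<longlongrightarrow> 0) (at_right 0)"
    by (rule Lim_transform_eventually)
       (auto simp: flat_exp_def eventually_at_filter exp_minus field_simps)
  have l: "(flat_exp m \<longlongrightarrow> 0) (at_left 0)"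
    by (rule Lim_transform_eventually[of "\<lambda>_. 0"]) (auto simp: flat_exp_def eventually_at_filter)
  show ?thesis using r l by (simp add: filterlim_split_at)
qed

lemma flat_exp_deriv:
  "(flat_exp m has_real_derivative (- real m * flat_exp (m + 1) s + flat_exp (m + 2) s)) (at s)"
proof (cases s "0::real" rule: linorder_cases)
  case less
  have "((\<lambda>_. 0) has_real_derivative 0) (at s)" by simp
  then have "(flat_exp m has_real_derivative 0) (at s)"
    by (rule has_field_derivative_transform_within_open[where S="{..<0}"])
       (use less in \<open>auto simp: flat_exp_def\<close>)
  then show ?thesis using less by (simp add: flat_exp_def)
next
  case equal
  have "((\<lambda>h. flat_exp m h / h) \<longlongrightarrow> 0) (at 0)"
    by (rule Lim_transform_eventually[OF flat_exp_tendsto_0[of "m + 1"]])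
       (auto simp: flat_exp_def eventually_at_filter)
  then show ?thesis unfolding equal by (simp add: has_field_derivative_iff flat_exp_def)
next
  case greater
  have "((\<lambda>s. (1 / s) ^ m * exp (- (1 / s))) has_real_derivative
      (- real m * flat_exp (m + 1) s + flat_exp (m + 2) s)) (at s)"
  proof -
    have i: "((\<lambda>s. 1 / s) has_real_derivative - ((1 / s) * (1 / s))) (at s)"
      using greater by (auto intro!: derivative_eq_intros)
    have "((\<lambda>s. (1 / s) ^ m) has_real_derivative - real m * (1 / s) ^ (m + 1)) (at s)"
    proof (cases m)
      case (Suc n)
      show ?thesis unfolding Suc using DERIV_power_Suc[OF i, of n]
        by (simp add: algebra_simps add_divide_distrib diff_divide_distrib)
    qed simp
    from DERIV_mult[OF this DERIV_fun_exp[OF DERIV_minus[OF i]]] greater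
    show ?thesis by (simp add: flat_exp_def algebra_simps)
  qed
  then show ?thesis
    by (rule has_field_derivative_transform_within_open[where S="{0<..}"])
       (use greater in \<open>auto simp: flat_exp_def\<close>)
qed

lemma C_times_flat_exp: "C_times k (\<lambda>x. flat_exp m (c * (x $ i) + d))"
proof (induction k arbitrary: m)
  case 0
  have "continuous_on UNIV (flat_exp m)"
    using flat_exp_deriv by (intro continuous_at_imp_continuous_on) (blast intro: DERIV_isCont)
  from continuous_on_compose2[OF this, of UNIV "\<lambda>x::plane. c * (x $ i) + d"]
  show ?case by (simp add: continuous_intros)
next
  case (Suc k)
  have "((\<lambda>x. flat_exp m (c * (x $ i) + d)) has_derivative (\<lambda>h. (c * h $ i) *
    (- real m * flat_exp (m + 1) (c * (x $ i) + d) + flat_exp (m + 2) (c * (x $ i) + d)))) (at x)" for x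
  proof -
    have "((\<lambda>x::plane. c * (x $ i) + d) has_derivative (\<lambda>h. c * h $ i)) (at x)"
      by (auto intro!: derivative_eq_intros bounded_linear_imp_has_derivative bounded_linear_vec_nth)
    from has_derivative_compose[OF this flat_exp_deriv[of m "c * (x $ i) + d", unfolded has_field_derivative_def]]
    show ?thesis by (rule has_derivative_eq_rhs) (auto simp: fun_eq_iff)
  qed
  then show ?case
    by (rule C_times_SucI) (intro C_times_add C_times_mult C_times_const Suc)
qed

lemma flat_exp_bounds: "0 \<le> flat_exp 0 s" "flat_exp 0 s \<le> 1"
  by (auto simp: flat_exp_def)

text \<open>Take the product of the flat profiles of the four signed distances to the sides of the box,
  steepened by the factor \<open>n + 1\<close>.\<close>

lemma box_indicator_limit:
  fixes l r :: plane
  obtains \<phi> :: "nat \<Rightarrow> plane \<Rightarrow> real" where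
    "\<And>n. test_function (\<phi> n)" "\<And>n x. \<bar>\<phi> n x\<bar> \<le> indicator (box l r) x"
    "\<And>x. (\<lambda>n. \<phi> n x) \<longlonglongrightarrow> indicator (box l r) x"
proof -
  define e where "e n s = flat_exp 0 (real (Suc n) * s)" for n s
  define \<phi> where "\<phi> n x = (e n (x $ 1 - l $ 1) * e n (r $ 1 - x $ 1)) * (e n (x $ 2 - l $ 2) * e n (r $ 2 - x $ 2))"
    for n and x :: plane
  have box: "x \<in> box l r \<longleftrightarrow> l $ 1 < x $ 1 \<and> x $ 1 < r $ 1 \<and> l $ 2 < x $ 2 \<and> x $ 2 < r $ 2" for x
    by (auto simp: mem_box_cart forall_2)
  have e01: "0 \<le> e n s" "e n s \<le> 1" for n s by (auto simp: e_def flat_exp_bounds)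
  have e0: "s \<le> 0 \<Longrightarrow> e n s = 0" for n s
    by (auto simp: e_def flat_exp_def mult_nonneg_nonpos not_less zero_less_mult_iff)
  have lim: "(\<lambda>n. e n s) \<longlonglongrightarrow> (if s > 0 then 1 else 0)" for s
  proof (cases "s > 0")
    case True
    have "(\<lambda>n. exp (- (inverse (real (Suc n)) * inverse s))) \<longlonglongrightarrow> exp (- (0 * inverse s))"
      by (intro tendsto_intros LIMSEQ_inverse_real_of_nat)
    moreover have "e n s = exp (- (inverse (real (Suc n)) * inverse s))" for n
      using True by (simp add: e_def flat_exp_def field_simps add_pos_nonneg)
    ultimately show ?thesis using True by simp
  qed (simp add: e0)
  have sm: "smooth (\<lambda>x. e n (c * x $ i + d))" for n c d i
  proof -
    have "(\<lambda>x. e n (c * x $ i + d)) = (\<lambda>x. flat_exp 0 ((real (Suc n) * c) * x $ i + real (Suc n) * d))"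
      by (simp add: e_def algebra_simps)
    then show ?thesis using C_times_flat_exp unfolding smooth_def by metis
  qed
  have sm1: "smooth (\<lambda>x. e n (x $ i - d))" "smooth (\<lambda>x. e n (d - x $ i))" for n d i
    using sm[of n 1 i "-d"] sm[of n "-1" i d] by simp_all
  have le: "\<bar>\<phi> n x\<bar> \<le> indicator (box l r) x" for n x
  proof (cases "x \<in> box l r")
    case True
    then show ?thesis
      by (auto simp: \<phi>_def e01 abs_mult intro!: mult_le_one mult_nonneg_nonneg)
  next
    case False
    then show ?thesis using e0 by (auto simp: \<phi>_def box not_less)
  qed
  show thesis
  proof
    show "\<bar>\<phi> n x\<bar> \<le> indicator (box l r) x" for n x by (rule le)
    have "bounded {x. \<phi> n x \<noteq> 0}" for n
    proof (rule bounded_subset[OF bounded_box])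
      show "{x. \<phi> n x \<noteq> 0} \<subseteq> box l r"
      proof
        fix x assume "x \<in> {x. \<phi> n x \<noteq> 0}"
        then show "x \<in> box l r" using le[of n x] by (cases "x \<in> box l r") auto
      qed
    qed
    moreover have "smooth (\<phi> n)" for n
      unfolding \<phi>_def[abs_def] by (intro smooth_intros sm1)
    ultimately show "test_function (\<phi> n)" for n
      by (simp add: test_function_iff)
    show "(\<lambda>n. \<phi> n x) \<longlonglongrightarrow> indicator (box l r) x" for x
    proof -
      have "(\<lambda>n. \<phi> n x) \<longlonglongrightarrow> ((if x $ 1 - l $ 1 > 0 then 1 else 0) * (if r $ 1 - x $ 1 > 0 then 1 else 0))
          * ((if x $ 2 - l $ 2 > 0 then 1 else 0) * (if r $ 2 - x $ 2 > 0 then 1 else 0))"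
        unfolding \<phi>_def by (intro tendsto_mult lim)
      then show ?thesis by (auto simp: indicator_def box split: if_splits)
    qed
  qed
qed

section \<open>Square integrable functions\<close>

lemma L2_real: "f \<in> L2 \<longleftrightarrow> f \<in> borel_measurable lborel \<and> integrable lborel (\<lambda>x. (f x)\<^sup>2)"
  for f :: "plane \<Rightarrow> real"
  by (simp add: L2_def)

lemma L2_measurable_borel: "f \<in> L2 \<Longrightarrow> f \<in> borel_measurable borel"
  by (simp add: L2_def)

lemma L2_square_integrable: "f \<in> L2 \<Longrightarrow> integrable lborel (\<lambda>x. (f x)\<^sup>2)" for f :: "plane \<Rightarrow> real"
  by (simp add: L2_real)

lemma L2_dominated:
  fixes f :: "plane \<Rightarrow> real" and g :: "plane \<Rightarrow> 'b::real_normed_vector"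
  assumes "f \<in> borel_measurable borel" "g \<in> L2" "\<And>x. \<bar>f x\<bar> \<le> C * norm (g x)"
  shows "f \<in> L2"
  unfolding L2_real
proof
  note [measurable] = assms(1)
  have g: "integrable lborel (\<lambda>x. (norm (g x))\<^sup>2)" using assms(2) by (simp add: L2_def)
  show "integrable lborel (\<lambda>x. (f x)\<^sup>2)"
  proof (rule Bochner_Integration.integrable_bound[OF integrable_mult_right[OF g, of "C\<^sup>2"]])
    have "(f x)\<^sup>2 \<le> C\<^sup>2 * (norm (g x))\<^sup>2" for x
      using power_mono[OF assms(3) abs_ge_zero, of x 2] by (simp add: power_mult_distrib)
    then show "AE x in lborel. norm ((f x)\<^sup>2) \<le> norm (C\<^sup>2 * (norm (g x))\<^sup>2)" by simp
  qed measurable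
qed (simp add: assms(1))

lemma L2_integrable_mult:
  fixes f g :: "plane \<Rightarrow> real"
  assumes "f \<in> L2" "g \<in> L2"
  shows "integrable lborel (\<lambda>x. f x * g x)"
proof (rule Bochner_Integration.integrable_bound)
  note [measurable] = L2_measurable_borel[OF assms(1)] L2_measurable_borel[OF assms(2)]
  show "integrable lborel (\<lambda>x. (f x)\<^sup>2 + (g x)\<^sup>2)" using assms by (simp add: L2_real)
  show "AE x in lborel. norm (f x * g x) \<le> norm ((f x)\<^sup>2 + (g x)\<^sup>2)"
  proof (rule AE_I2)
    fix x
    have "2 * \<bar>f x\<bar> * \<bar>g x\<bar> \<le> (f x)\<^sup>2 + (g x)\<^sup>2"
      using sum_squares_bound[of "\<bar>f x\<bar>" "\<bar>g x\<bar>"] by simp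
    then show "norm (f x * g x) \<le> norm ((f x)\<^sup>2 + (g x)\<^sup>2)"
      using mult_nonneg_nonneg[OF abs_ge_zero abs_ge_zero, of "f x" "g x"]
      unfolding real_norm_def abs_mult mult.assoc by linarith
  qed
  show "(\<lambda>x. f x * g x) \<in> borel_measurable lborel" by measurable
qed

lemma L2_zero: "(\<lambda>x. 0) \<in> (L2 :: (plane \<Rightarrow> real) set)" by (simp add: L2_real)

lemma L2_scale: "f \<in> L2 \<Longrightarrow> (\<lambda>x. c * f x) \<in> L2" for f :: "plane \<Rightarrow> real"
  by (auto simp: L2_real power_mult_distrib)

lemma L2_add: "f \<in> L2 \<Longrightarrow> g \<in> L2 \<Longrightarrow> (\<lambda>x. f x + g x) \<in> L2" for f g :: "plane \<Rightarrow> real"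
  using L2_integrable_mult[of f g] by (auto simp: L2_real power2_sum mult.assoc)

lemma L2_diff: "f \<in> L2 \<Longrightarrow> g \<in> L2 \<Longrightarrow> (\<lambda>x. f x - g x) \<in> L2" for f g :: "plane \<Rightarrow> real"
  using L2_integrable_mult[of f g] by (auto simp: L2_real power2_diff mult.assoc)

lemma L2_component: "g \<in> L2 \<Longrightarrow> (\<lambda>x. g x $ i) \<in> L2" for g :: "plane \<Rightarrow> plane"
proof (rule L2_dominated[of _ g 1])
  assume g: "g \<in> L2"
  note [measurable] = L2_measurable_borel[OF g]
  show "(\<lambda>x. g x $ i) \<in> borel_measurable borel" unfolding cart_eq_inner_axis by measurable
qed (auto simp: component_le_norm_cart)

lemma test_function_L2: assumes "test_function \<phi>" shows "\<phi> \<in> L2"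
proof -
  obtain R where R: "R > 0" "\<And>x. norm x \<ge> R \<Longrightarrow> \<phi> x = 0"
    using test_function_outside[OF assms] by blast
  obtain C where C: "C > 0" "\<And>x. \<bar>\<phi> x\<bar> \<le> C" using test_function_bounded[OF assms] by blast
  have "(indicator (cball 0 R) :: plane \<Rightarrow> real) \<in> L2"
  proof -
    have "integrable lborel (indicator (cball 0 R) :: plane \<Rightarrow> real)"
      using emeasure_lborel_cball_finite by (auto simp: integrable_indicator_iff)
    moreover have "(indicator (cball 0 R) x :: real)\<^sup>2 = indicator (cball 0 R) x" for x :: plane
      by (auto simp: indicator_def)
    ultimately show ?thesis by (simp add: L2_real)
  qed
  moreover have "\<bar>\<phi> x\<bar> \<le> C * norm (indicator (cball 0 R) x :: real)" for x
    using C(2)[of x] R(2)[of x] by (cases "norm x \<le> R") (auto simp: indicator_def)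
  ultimately show ?thesis
    using smooth_measurable[OF test_function_smooth[OF assms]] by (rule_tac L2_dominated) 
qed

text \<open>The quadratic form \<open>(s, r) \<mapsto> \<integral> (s f + r g)\<^sup>2\<close> is nonnegative.\<close>

lemma square_integral_Cauchy_Schwarz:
  fixes f g :: "'a \<Rightarrow> real"
  assumes "integrable M (\<lambda>x. (f x)\<^sup>2)" "integrable M (\<lambda>x. (g x)\<^sup>2)" "integrable M (\<lambda>x. f x * g x)"
  shows "\<bar>LINT x|M. f x * g x\<bar> \<le> sqrt (LINT x|M. (f x)\<^sup>2) * sqrt (LINT x|M. (g x)\<^sup>2)"
proof -
  define A where "A = (LINT x|M. (f x)\<^sup>2)"
  define B where "B = (LINT x|M. (g x)\<^sup>2)"
  define D where "D = (LINT x|M. f x * g x)"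
  have nn: "0 \<le> A" "0 \<le> B" by (auto simp: A_def B_def)
  have q: "0 \<le> s\<^sup>2 * A + 2 * s * r * D + r\<^sup>2 * B" for s r
  proof -
    have "0 \<le> (LINT x|M. (s * f x + r * g x)\<^sup>2)" by simp
    also have "(\<lambda>x. (s * f x + r * g x)\<^sup>2) = (\<lambda>x. s\<^sup>2 * (f x)\<^sup>2 + 2 * s * r * (f x * g x) + r\<^sup>2 * (g x)\<^sup>2)"
      by (auto simp: power2_eq_square algebra_simps)
    also have "(LINT x|M. \<dots> x) = s\<^sup>2 * A + 2 * s * r * D + r\<^sup>2 * B"
      using assms by (simp add: A_def B_def D_def)
    finally show ?thesis .
  qed
  have "D\<^sup>2 \<le> A * B"
  proof (cases "B = 0")
    case True
    have "D = 0"
    proof (rule ccontr)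
      assume "D \<noteq> 0"
      with q[of 1 "- (A + 1) / (2 * D)"] True nn show False by (simp add: field_simps)
    qed
    then show ?thesis using nn by simp
  next
    case False
    then have "B > 0" using nn by simp
    moreover have "0 \<le> B * (A * B - D\<^sup>2)" using q[of B "- D"] by (simp add: power2_eq_square algebra_simps)
    ultimately show ?thesis by (simp add: zero_le_mult_iff)
  qed
  then have "sqrt (D\<^sup>2) \<le> sqrt (A * B)" by (rule real_sqrt_le_mono)
  then show ?thesis by (simp add: A_def B_def D_def real_sqrt_mult)
qed

lemma L2_Cauchy_Schwarz:
  fixes f g :: "plane \<Rightarrow> real"
  assumes "f \<in> L2" "g \<in> L2"
  shows "\<bar>LINT x|lborel. f x * g x\<bar> \<le> sqrt (LINT x|lborel. (f x)\<^sup>2) * sqrt (LINT x|lborel. (g x)\<^sup>2)"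
  using assms L2_integrable_mult[OF assms] by (intro square_integral_Cauchy_Schwarz) (auto simp: L2_real)

lemma L2_norm_triangle:
  fixes f g :: "plane \<Rightarrow> real"
  assumes "f \<in> L2" "g \<in> L2"
  shows "sqrt (LINT x|lborel. (f x + g x)\<^sup>2) \<le> sqrt (LINT x|lborel. (f x)\<^sup>2) + sqrt (LINT x|lborel. (g x)\<^sup>2)"
proof (rule real_le_lsqrt)
  let ?A = "LINT x|lborel. (f x)\<^sup>2" and ?B = "LINT x|lborel. (g x)\<^sup>2" and ?D = "LINT x|lborel. f x * g x"
  have "(LINT x|lborel. (f x + g x)\<^sup>2) = ?A + ?B + 2 * ?D"
    using assms L2_integrable_mult[OF assms] by (simp add: power2_sum L2_square_integrable mult.assoc)
  also have "\<dots> \<le> ?A + ?B + 2 * (sqrt ?A * sqrt ?B)"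
    using L2_Cauchy_Schwarz[OF assms] by linarith
  also have "\<dots> = (sqrt ?A + sqrt ?B)\<^sup>2" by (simp add: power2_sum)
  finally show "(LINT x|lborel. (f x + g x)\<^sup>2) \<le> (sqrt ?A + sqrt ?B)\<^sup>2" .
qed simp

section \<open>Test functions are dense in the square integrable functions\<close>

definition test_approximable :: "(plane \<Rightarrow> real) \<Rightarrow> bool" where
  "test_approximable f \<longleftrightarrow> f \<in> L2 \<and> (\<forall>e>0. \<exists>\<phi>. test_function \<phi> \<and> (LINT x|lborel. (f x - \<phi> x)\<^sup>2) < e)"

lemma L2_dist_triangle:
  fixes f g h :: "plane \<Rightarrow> real"
  assumes "f \<in> L2" "g \<in> L2" "h \<in> L2"
  shows "(LINT x|lborel. (f x - h x)\<^sup>2) \<le> 2 * (LINT x|lborel. (f x - g x)\<^sup>2) + 2 * (LINT x|lborel. (g x - h x)\<^sup>2)"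
proof -
  have i: "integrable lborel (\<lambda>x. (f x - h x)\<^sup>2)" "integrable lborel (\<lambda>x. (f x - g x)\<^sup>2)"
    "integrable lborel (\<lambda>x. (g x - h x)\<^sup>2)"
    using assms L2_diff by (auto simp: L2_square_integrable)
  have "(LINT x|lborel. (f x - h x)\<^sup>2) \<le> (LINT x|lborel. 2 * (f x - g x)\<^sup>2 + 2 * (g x - h x)\<^sup>2)"
  proof (intro integral_mono i Bochner_Integration.integrable_add integrable_mult_right)
    fix x
    have "0 \<le> ((f x - g x) - (g x - h x))\<^sup>2" by simp
    then show "(f x - h x)\<^sup>2 \<le> 2 * (f x - g x)\<^sup>2 + 2 * (g x - h x)\<^sup>2"
      by (simp add: power2_eq_square algebra_simps)
  qed
  then show ?thesis using i by simp
qed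

lemma test_approximable_limit:
  assumes "f \<in> L2" "\<And>n. test_approximable (h n)" "(\<lambda>n. LINT x|lborel. (f x - h n x)\<^sup>2) \<longlonglongrightarrow> 0"
  shows "test_approximable f"
  unfolding test_approximable_def
proof (intro conjI allI impI)
  fix e :: real assume "e > 0"
  then have "\<forall>\<^sub>F n in sequentially. (LINT x|lborel. (f x - h n x)\<^sup>2) < e / 4"
    using assms(3) by (intro order_tendstoD) auto
  then obtain n where n: "(LINT x|lborel. (f x - h n x)\<^sup>2) < e / 4"
    by (auto simp: eventually_sequentially)
  obtain \<phi> where \<phi>: "test_function \<phi>" "(LINT x|lborel. (h n x - \<phi> x)\<^sup>2) < e / 4"
    using assms(2)[of n] \<open>e > 0\<close> unfolding test_approximable_def by (metis zero_less_divide_iff zero_less_numeral)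
  have "(LINT x|lborel. (f x - \<phi> x)\<^sup>2) < e"
    using L2_dist_triangle[OF assms(1) _ test_function_L2[OF \<phi>(1)], of "h n"] assms(2)[of n] n \<phi>(2)
    by (auto simp: test_approximable_def)
  then show "\<exists>\<phi>. test_function \<phi> \<and> (LINT x|lborel. (f x - \<phi> x)\<^sup>2) < e" using \<phi> by blast
qed (rule assms)

text \<open>This closure property carries approximability from test functions to boxes, from boxes to Borel
  sets and from sets to functions.\<close>

lemma test_approximable_dominated:
  fixes G :: "plane \<Rightarrow> real"
  assumes "\<And>n. test_approximable (h n)" "G \<in> L2" "\<And>n x. \<bar>h n x\<bar> \<le> G x" "\<And>x. (\<lambda>n. h n x) \<longlonglongrightarrow> f x"
  shows "test_approximable f"
proof -
  have hL2: "h n \<in> L2" for n using assms(1) by (simp add: test_approximable_def)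
  note [measurable] = L2_measurable_borel[OF hL2] L2_measurable_borel[OF assms(2)]
  have f[measurable]: "f \<in> borel_measurable borel"
    by (rule borel_measurable_LIMSEQ_real[where u=h]) (use assms(4) in auto)
  have le: "\<bar>f x\<bar> \<le> G x" for x
    using assms(3,4) by (intro LIMSEQ_le_const2[OF tendsto_rabs[OF assms(4)]]) auto
  have fL2: "f \<in> L2" using le assms(2)
    by (intro L2_dominated[of f G 1]) (auto intro: order_trans[OF _ abs_ge_self])
  show ?thesis
  proof (rule test_approximable_limit[OF fL2 assms(1)])
    have "(\<lambda>n. LINT x|lborel. (f x - h n x)\<^sup>2) \<longlonglongrightarrow> (LINT x|(lborel::plane measure). 0)"
    proof (rule integral_dominated_convergence[where w="\<lambda>x. 4 * (G x)\<^sup>2"])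
      show "integrable lborel (\<lambda>x. 4 * (G x)\<^sup>2)" using assms(2) by (simp add: L2_real)
      show "AE x in lborel. (\<lambda>n. (f x - h n x)\<^sup>2) \<longlonglongrightarrow> 0"
      proof (rule AE_I2)
        fix x
        have "(\<lambda>n. (f x - h n x)\<^sup>2) \<longlonglongrightarrow> (f x - f x)\<^sup>2" by (intro tendsto_intros assms(4))
        then show "(\<lambda>n. (f x - h n x)\<^sup>2) \<longlonglongrightarrow> 0" by simp
      qed
      show "AE x in lborel. norm ((f x - h n x)\<^sup>2) \<le> 4 * (G x)\<^sup>2" for n
      proof (rule AE_I2)
        fix x
        have "\<bar>f x - h n x\<bar> \<le> 2 * G x" using le[of x] assms(3)[of n x] by linarith
        from power_mono[OF this, of 2] show "norm ((f x - h n x)\<^sup>2) \<le> 4 * (G x)\<^sup>2" by (simp add: power_mult_distrib)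
      qed
    qed measurable
    then show "(\<lambda>n. LINT x|lborel. (f x - h n x)\<^sup>2) \<longlonglongrightarrow> 0" by simp
  qed
qed

lemma test_approximable_test: "test_function \<phi> \<Longrightarrow> test_approximable \<phi>"
  by (auto simp: test_approximable_def test_function_L2 intro!: exI[of _ \<phi>])

lemma test_approximable_add:
  assumes "test_approximable f" "test_approximable g"
  shows "test_approximable (\<lambda>x. f x + g x)"
  unfolding test_approximable_def
proof (intro conjI allI impI)
  show L: "(\<lambda>x. f x + g x) \<in> L2" using assms by (simp add: test_approximable_def L2_add)
  fix e :: real assume "e > 0"
  then have e4: "e / 4 > 0" by simp
  obtain \<phi> where \<phi>: "test_function \<phi>" "(LINT x|lborel. (f x - \<phi> x)\<^sup>2) < e / 4"
    using assms(1) e4 unfolding test_approximable_def by blast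
  obtain \<psi> where \<psi>: "test_function \<psi>" "(LINT x|lborel. (g x - \<psi> x)\<^sup>2) < e / 4"
    using assms(2) e4 unfolding test_approximable_def by blast
  have "(LINT x|lborel. (f x + g x - (\<phi> x + \<psi> x))\<^sup>2) \<le> 2 * (LINT x|lborel. (f x + g x - (\<phi> x + g x))\<^sup>2)
      + 2 * (LINT x|lborel. (\<phi> x + g x - (\<phi> x + \<psi> x))\<^sup>2)"
    using assms test_function_L2[OF \<phi>(1)] test_function_L2[OF \<psi>(1)]
    by (intro L2_dist_triangle L2_add) (simp_all add: test_approximable_def)
  also have "\<dots> < e" using \<phi> \<psi> by (simp add: algebra_simps)
  finally show "\<exists>\<phi>. test_function \<phi> \<and> (LINT x|lborel. (f x + g x - \<phi> x)\<^sup>2) < e"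
    using test_function_add[OF \<phi>(1) \<psi>(1)] by (intro exI[of _ "\<lambda>x. \<phi> x + \<psi> x"]) simp
qed

lemma test_approximable_scale:
  assumes "test_approximable f"
  shows "test_approximable (\<lambda>x. c * f x)"
  unfolding test_approximable_def
proof (intro conjI allI impI)
  show "(\<lambda>x. c * f x) \<in> L2" using assms by (simp add: test_approximable_def L2_scale)
  fix e :: real assume "e > 0"
  then have "e / (c\<^sup>2 + 1) > 0" by (simp add: add_nonneg_pos)
  then obtain \<phi> where \<phi>: "test_function \<phi>" "(LINT x|lborel. (f x - \<phi> x)\<^sup>2) < e / (c\<^sup>2 + 1)"
    using assms(1) unfolding test_approximable_def by blast
  have "(\<lambda>x. (c * f x - c * \<phi> x)\<^sup>2) = (\<lambda>x. c\<^sup>2 * (f x - \<phi> x)\<^sup>2)"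
    by (auto simp: power_mult_distrib[symmetric] algebra_simps)
  then have "(LINT x|lborel. (c * f x - c * \<phi> x)\<^sup>2) = c\<^sup>2 * (LINT x|lborel. (f x - \<phi> x)\<^sup>2)" by simp
  also have "\<dots> \<le> (c\<^sup>2 + 1) * (LINT x|lborel. (f x - \<phi> x)\<^sup>2)" by (intro mult_right_mono) auto
  also have "\<dots> < e" using \<phi>(2) by (simp add: pos_less_divide_eq add_nonneg_pos mult.commute)
  finally show "\<exists>\<phi>. test_function \<phi> \<and> (LINT x|lborel. (c * f x - \<phi> x)\<^sup>2) < e"
    using test_function_mult[OF smooth_intros(1) \<phi>(1)] by (intro exI[of _ "\<lambda>x. c * \<phi> x"]) simp
qed

lemma indicator_L2:
  fixes A :: "plane set"
  assumes "A \<in> sets borel" "emeasure lborel A < \<infinity>" shows "(indicator A :: plane \<Rightarrow> real) \<in> L2"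
proof -
  have "(\<lambda>x. (indicator A x :: real)\<^sup>2) = indicator A" by (auto simp: indicator_def)
  then show ?thesis using assms by (simp add: L2_real integrable_indicator_iff)
qed

lemma test_approximable_box: "test_approximable (indicator (box l r))"
proof -
  obtain \<phi> :: "nat \<Rightarrow> plane \<Rightarrow> real" where \<phi>: "\<And>n. test_function (\<phi> n)"
    "\<And>n x. \<bar>\<phi> n x\<bar> \<le> indicator (box l r) x" "\<And>x. (\<lambda>n. \<phi> n x) \<longlonglongrightarrow> indicator (box l r) x"
    using box_indicator_limit by blast
  have "(indicator (box l r) :: plane \<Rightarrow> real) \<in> L2"
    using emeasure_lborel_box_finite by (intro indicator_L2) auto
  from test_approximable_dominated[OF test_approximable_test[OF \<phi>(1)] this \<phi>(2,3)]
  show ?thesis .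
qed

text \<open>Boxes are stable under intersection and generate the Borel sets, and the approximable
  sets are closed under complements and disjoint unions. The intersection with a fixed box keeps
  all indicators square integrable.\<close>

lemma test_approximable_bounded_set:
  fixes A :: "plane set"
  assumes "A \<in> sets borel"
  shows "test_approximable (indicator (A \<inter> box l r))"
proof -
  have gen: "sets borel = sigma_sets UNIV (range (\<lambda>(a, b). box a b :: plane set))"
    unfolding borel_eq_box by simp
  let ?G = "range (\<lambda>(a, b). box a b :: plane set)"
  have bL2: "(indicator (box l r) :: plane \<Rightarrow> real) \<in> L2"
    using emeasure_lborel_box_finite by (intro indicator_L2) auto
  have "Int_stable ?G"
  proof (rule Int_stableI)
    fix A B assume "A \<in> ?G" "B \<in> ?G"
    then obtain p q where pq: "A = box (fst p) (snd p)" "B = box (fst q) (snd q)"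
      by (auto simp: case_prod_unfold simp del: mem_box)
    have "A \<inter> B = (\<lambda>(a, b). box a b) (\<Sum>i\<in>Basis. max (fst p \<bullet> i) (fst q \<bullet> i) *\<^sub>R i,
        \<Sum>i\<in>Basis. min (snd p \<bullet> i) (snd q \<bullet> i) *\<^sub>R i)"
      unfolding pq box_Int_box by simp
    then show "A \<inter> B \<in> ?G" by (rule range_eqI)
  qed
  moreover have "?G \<subseteq> Pow UNIV" by simp
  moreover have "A \<in> sigma_sets UNIV ?G" using assms gen by simp
  ultimately show ?thesis
  proof (induction rule: sigma_sets_induct_disjoint)
    case (basic A)
    then obtain a b where "A = box a b" by auto
    have "\<exists>a' b'. A \<inter> box l r = box a' b'" unfolding \<open>A = box a b\<close> box_Int_box by blast
    then obtain a' b' where "A \<inter> box l r = box a' b'" by blast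
    then show ?case using test_approximable_box by simp
  next
    case empty
    show ?case using test_approximable_test[OF test_function_zero] by simp
  next
    case (compl A)
    have "(\<lambda>x. indicator (box l r) x + (- 1) * indicator (A \<inter> box l r) x) = (indicator ((UNIV - A) \<inter> box l r) :: plane \<Rightarrow> real)"
      by (auto simp: indicator_def)
    then show ?case using test_approximable_add[OF test_approximable_box test_approximable_scale[OF compl(2)]]
      by metis
  next
    case (union A)
    have fin: "test_approximable (\<lambda>x. \<Sum>i<n. indicator (A i \<inter> box l r) x)" for n
      by (induction n) (use test_approximable_test[OF test_function_zero] test_approximable_add union in auto)
    have d: "disjoint_family (\<lambda>i. A i \<inter> box l r)"
      using union(1) unfolding disjoint_family_on_def by blast
    show ?case
    proof (rule test_approximable_dominated[OF fin bL2])
      fix x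
      have "(\<lambda>i. indicator (A i \<inter> box l r) x :: real) sums indicator (\<Union>i. A i \<inter> box l r) x"
        using d by (intro indicator_sums) (auto simp: disjoint_family_on_def)
      then show lim: "(\<lambda>n. \<Sum>i<n. indicator (A i \<inter> box l r) x) \<longlonglongrightarrow> (indicator (\<Union> (range A) \<inter> box l r) x :: real)"
        by (simp add: sums_def)
      fix n
      have "(\<Sum>i<n. indicator (A i \<inter> box l r) x) = (indicator (\<Union>i<n. A i \<inter> box l r) x :: real)"
        using d by (subst indicator_UN_disjoint) (auto simp: disjoint_family_on_def)
      then show "\<bar>\<Sum>i<n. indicator (A i \<inter> box l r) x\<bar> \<le> (indicator (box l r) x :: real)"
        by (auto simp: indicator_def)
    qed
  qed
qed

lemma test_approximable_set:
  fixes A :: "plane set"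
  assumes "A \<in> sets borel" "(indicator A :: plane \<Rightarrow> real) \<in> L2"
  shows "test_approximable (indicator A)"
proof (rule test_approximable_dominated[OF test_approximable_bounded_set[OF assms(1)] assms(2)])
  show "\<bar>indicator (A \<inter> box (- (real n *\<^sub>R One)) (real n *\<^sub>R One)) x\<bar> \<le> (indicator A x::real)" for x :: plane and n
    by (auto simp: indicator_def)
  show "(\<lambda>n. indicator (A \<inter> box (- (real n *\<^sub>R One)) (real n *\<^sub>R One)) x :: real) \<longlonglongrightarrow> indicator A x" for x :: plane
  proof -
    obtain N where N: "x \<in> box (- (real N *\<^sub>R One)) (real N *\<^sub>R One)"
      using UN_box_eq_UNIV[where 'a=plane] by blast
    have "x \<in> box (- (real n *\<^sub>R One)) (real n *\<^sub>R One)" if "n \<ge> N" for n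
      using N that by (force simp: mem_box inner_Basis)
    then have "\<forall>\<^sub>F n in sequentially. indicator (A \<inter> box (- (real n *\<^sub>R One)) (real n *\<^sub>R One)) x = (indicator A x :: real)"
      by (auto simp: eventually_sequentially indicator_def intro!: exI[of _ N])
    then show ?thesis by (rule tendsto_eventually)
  qed
qed

lemma test_approximable_nonneg:
  assumes "f \<in> borel_measurable lborel" "\<And>x. 0 \<le> f x" "f \<in> L2"
  shows "test_approximable f"
proof -
  have "f \<in> L2 \<longrightarrow> test_approximable f"
    using assms(1,2)
  proof (induction f rule: borel_measurable_induct_real)
    case (set A)
    then show ?case using test_approximable_set by simp
  next
    case (mult u c)
    show ?case
    proof (cases "c = 0")
      case True
      then show ?thesis using test_approximable_test[OF test_function_zero] by simp
    next
      case False
      show ?thesis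
      proof
        assume "(\<lambda>x. c * u x) \<in> L2"
        from L2_scale[OF this, of "inverse c"] False have "u \<in> L2" by (simp add: mult.assoc[symmetric])
        then show "test_approximable (\<lambda>x. c * u x)" using mult test_approximable_scale by blast
      qed
    qed
  next
    case (add u v)
    show ?case
    proof
      assume *: "(\<lambda>x. v x + u x) \<in> L2"
      have "u \<in> L2" "v \<in> L2"
        using add by (auto intro!: L2_dominated[OF _ *, of _ 1])
      then show "test_approximable (\<lambda>x. v x + u x)" using add test_approximable_add by blast
    qed
  next
    case (seq U)
    show ?case
    proof
      assume *: "f \<in> L2"
      have "incseq (\<lambda>i. U i x)" for x using seq.hyps(3) by (simp add: incseq_def le_fun_def)
      then have le: "\<bar>U i x\<bar> \<le> f x" for i x
        using seq.hyps(2)[of i x] incseq_le[of "\<lambda>i. U i x" "f x" i] seq.hyps(4)[of x] by simp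
      have "U i \<in> L2" for i
        using seq.hyps(1) le by (intro L2_dominated[OF _ *, of _ 1]) (simp_all add: order_trans[OF _ abs_ge_self])
      then have ap: "test_approximable (U i)" for i using seq.IH by blast
      have "(\<lambda>i. U i x) \<longlonglongrightarrow> f x" for x using seq.hyps(4)[of x] by simp
      from test_approximable_dominated[OF ap * le this] show "test_approximable f" .
    qed
  qed
  then show ?thesis using assms by blast
qed

theorem test_functions_dense_L2:
  assumes "f \<in> L2" shows "test_approximable f"
proof -
  note [measurable] = L2_measurable_borel[OF assms]
  have "test_approximable (\<lambda>x. max (f x) 0)" "test_approximable (\<lambda>x. max (- f x) 0)"
    by (rule test_approximable_nonneg, simp_all, rule L2_dominated[OF _ assms, of _ 1], simp_all)+
  from test_approximable_add[OF this(1) test_approximable_scale[OF this(2), of "-1"]]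
  have "test_approximable (\<lambda>x. max (f x) 0 + - 1 * max (- f x) 0)" .
  moreover have "(\<lambda>x. max (f x) 0 + - 1 * max (- f x) 0) = f" by auto
  ultimately show ?thesis by simp
qed

lemma L2_approximating_sequence:
  assumes "f \<in> L2"
  obtains \<phi> :: "nat \<Rightarrow> plane \<Rightarrow> real" where "\<And>n. test_function (\<phi> n)" "(\<lambda>n. LINT x|lborel. (f x - \<phi> n x)\<^sup>2) \<longlonglongrightarrow> 0"
proof -
  have "\<forall>n. \<exists>\<phi>. test_function \<phi> \<and> (LINT x|lborel. (f x - \<phi> x)\<^sup>2) < inverse (real (Suc n))"
    using test_functions_dense_L2[OF assms] unfolding test_approximable_def by simp
  then obtain \<phi> where \<phi>: "\<And>n. test_function (\<phi> n)"
      "\<And>n. (LINT x|lborel. (f x - \<phi> n x)\<^sup>2) < inverse (real (Suc n))" by metis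
  have "(\<lambda>n. LINT x|lborel. (f x - \<phi> n x)\<^sup>2) \<longlonglongrightarrow> 0"
    by (rule tendsto_sandwich[OF _ _ tendsto_const LIMSEQ_inverse_real_of_nat])
       (use \<phi>(2) in \<open>auto intro!: always_eventually less_imp_le\<close>)
  with \<phi>(1) that show thesis by blast
qed

text \<open>By density the bound extends from test functions to all square integrable functions,
  and then \<open>\<psi> = w v\<close>, cut off where \<open>w\<close> is large, gives \<open>\<integral> w v\<^sup>2 \<le> M (\<integral> w v\<^sup>2)\<^sup>1\<^sup>/\<^sup>2\<close>.\<close>

lemma weighted_duality:
  fixes v w :: "plane \<Rightarrow> real"
  assumes v: "v \<in> L2" and w: "w \<in> borel_measurable borel" "\<And>x. w x \<ge> 1" and M: "M \<ge> 0"
    and bound: "\<And>\<psi>. test_function \<psi> \<Longrightarrow> \<bar>LINT x|lborel. v x * \<psi> x\<bar> \<le> M * sqrt (LINT x|lborel. (\<psi> x)\<^sup>2 / w x)"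
  shows "integrable lborel (\<lambda>x. w x * (v x)\<^sup>2)" "(LINT x|lborel. w x * (v x)\<^sup>2) \<le> M\<^sup>2"
proof -
  note [measurable] = L2_measurable_borel[OF v] w(1)
  have w0: "w x > 0" "w x \<noteq> 0" for x using w(2)[of x] by auto
  have general: "\<bar>LINT x|lborel. v x * f x\<bar> \<le> M * sqrt (LINT x|lborel. (f x)\<^sup>2 / w x)" if f: "f \<in> L2" for f
  proof -
    obtain \<phi> :: "nat \<Rightarrow> plane \<Rightarrow> real" where \<phi>: "\<And>n. test_function (\<phi> n)"
        and lim: "(\<lambda>n. LINT x|lborel. (f x - \<phi> n x)\<^sup>2) \<longlonglongrightarrow> 0"
      using L2_approximating_sequence[OF f] by blast
    have \<phi>L: "\<phi> n \<in> L2" for n using \<phi> test_function_L2 by blast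
    note [measurable] = L2_measurable_borel[OF f] L2_measurable_borel[OF \<phi>L]
    (* Multiplication by q turns the weighted norm into an unweighted one. *)
    define q where "q x = sqrt (1 / w x)" for x
    have q: "q x ^ 2 = 1 / w x" "0 \<le> q x" "q x \<le> 1" for x using w0[of x] w(2)[of x] by (auto simp: q_def)
    have [measurable]: "q \<in> borel_measurable borel" unfolding q_def[abs_def] by measurable
    have qL: "(\<lambda>x. q x * h x) \<in> L2" if "h \<in> L2" for h
    proof (rule L2_dominated[OF _ that, of _ 1])
      note [measurable] = L2_measurable_borel[OF that]
      show "(\<lambda>x. q x * h x) \<in> borel_measurable borel" by measurable
      show "\<bar>q x * h x\<bar> \<le> 1 * norm (h x)" for x
        using mult_right_mono[OF q(3)[of x] abs_ge_zero[of "h x"]] q(2)[of x] by (simp only: abs_mult real_norm_def abs_of_nonneg)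
    qed
    have qsq: "(q x * h)\<^sup>2 = h\<^sup>2 / w x" for x h using q(1)[of x] by (simp add: power_mult_distrib)
    have "(\<lambda>n. LINT x|lborel. v x * (f x - \<phi> n x)) \<longlonglongrightarrow> 0"
    proof (rule Lim_null_comparison)
      show "\<forall>\<^sub>F n in sequentially. norm (LINT x|lborel. v x * (f x - \<phi> n x)) \<le>
         sqrt (LINT x|lborel. (v x)\<^sup>2) * sqrt (LINT x|lborel. (f x - \<phi> n x)\<^sup>2)"
        using L2_Cauchy_Schwarz[OF v L2_diff[OF f \<phi>L]] by simp
      show "(\<lambda>n. sqrt (LINT x|lborel. (v x)\<^sup>2) * sqrt (LINT x|lborel. (f x - \<phi> n x)\<^sup>2)) \<longlonglongrightarrow> 0"
        using tendsto_mult_right_zero[OF tendsto_real_sqrt[OF lim, simplified]] by simp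
    qed
    then have a: "(\<lambda>n. \<bar>LINT x|lborel. v x * f x\<bar> - \<bar>LINT x|lborel. v x * (f x - \<phi> n x)\<bar>) \<longlonglongrightarrow> \<bar>LINT x|lborel. v x * f x\<bar> - \<bar>0\<bar>"
      by (intro tendsto_intros)
    have b: "(\<lambda>n. M * (sqrt (LINT x|lborel. (f x)\<^sup>2 / w x) + sqrt (LINT x|lborel. (f x - \<phi> n x)\<^sup>2))) \<longlonglongrightarrow>
       M * (sqrt (LINT x|lborel. (f x)\<^sup>2 / w x) + sqrt 0)"
      by (intro tendsto_intros lim)
    have c: "\<bar>LINT x|lborel. v x * f x\<bar> - \<bar>LINT x|lborel. v x * (f x - \<phi> n x)\<bar>
       \<le> M * (sqrt (LINT x|lborel. (f x)\<^sup>2 / w x) + sqrt (LINT x|lborel. (f x - \<phi> n x)\<^sup>2))" for n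
    proof -
      note dL = L2_diff[OF \<phi>L[of n] f]
      have "\<bar>LINT x|lborel. v x * f x\<bar> - \<bar>LINT x|lborel. v x * (f x - \<phi> n x)\<bar> \<le> \<bar>LINT x|lborel. v x * \<phi> n x\<bar>"
        using L2_integrable_mult[OF v f] L2_integrable_mult[OF v \<phi>L[of n]] by (simp add: right_diff_distrib)
      also have "\<dots> \<le> M * sqrt (LINT x|lborel. (\<phi> n x)\<^sup>2 / w x)" by (rule bound[OF \<phi>])
      also have "(LINT x|lborel. (\<phi> n x)\<^sup>2 / w x) = (LINT x|lborel. (q x * f x + q x * (\<phi> n x - f x))\<^sup>2)"
        unfolding distrib_left[symmetric] qsq by simp
      also have "sqrt \<dots> \<le> sqrt (LINT x|lborel. (q x * f x)\<^sup>2) + sqrt (LINT x|lborel. (q x * (\<phi> n x - f x))\<^sup>2)"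
        by (rule L2_norm_triangle[OF qL[OF f] qL[OF dL]])
      also have "(LINT x|lborel. (q x * (\<phi> n x - f x))\<^sup>2) \<le> (LINT x|lborel. (f x - \<phi> n x)\<^sup>2)"
      proof (rule integral_mono[OF L2_square_integrable[OF qL[OF dL]] L2_square_integrable[OF L2_diff[OF f \<phi>L]]])
        show "(q x * (\<phi> n x - f x))\<^sup>2 \<le> (f x - \<phi> n x)\<^sup>2" for x
          unfolding power_mult_distrib power2_commute[of "\<phi> n x"]
          by (intro mult_left_le_one_le zero_le_power2 power_le_one q)
      qed
      finally show ?thesis using M by (simp only: qsq mult_left_mono add_left_mono real_sqrt_le_mono)
    qed
    show ?thesis using LIMSEQ_le[OF a b] c by auto
  qed
  have trunc: "(LINT x|lborel. indicator {x. w x \<le> real n} x * (w x * (v x)\<^sup>2)) \<le> M\<^sup>2"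
    and itrunc: "integrable lborel (\<lambda>x. indicator {x. w x \<le> real n} x * (w x * (v x)\<^sup>2))" for n
  proof -
    let ?f = "\<lambda>x. indicator {x. w x \<le> real n} x * (w x * v x)"
    have fL: "?f \<in> L2"
    proof (rule L2_dominated[OF _ v, of _ "real n"])
      fix x
      show "\<bar>?f x\<bar> \<le> real n * norm (v x)"
        using w0[of x] by (auto simp: indicator_def abs_mult intro!: mult_right_mono)
    qed measurable
    let ?m = "LINT x|lborel. indicator {x. w x \<le> real n} x * (w x * (v x)\<^sup>2)"
    have e1: "v x * ?f x = indicator {x. w x \<le> real n} x * (w x * (v x)\<^sup>2)" for x
      by (simp add: power2_eq_square mult_ac)
    have e2: "(?f x)\<^sup>2 / w x = indicator {x. w x \<le> real n} x * (w x * (v x)\<^sup>2)" for x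
      using w0[of x] by (auto simp: indicator_def power2_eq_square)
    show "integrable lborel (\<lambda>x. indicator {x. w x \<le> real n} x * (w x * (v x)\<^sup>2))"
      using L2_integrable_mult[OF v fL] unfolding e1 .
    have m0: "?m \<ge> 0" using w0 by (intro integral_nonneg_AE) (auto simp: less_imp_le)
    have "?m \<le> M * sqrt ?m" using general[OF fL] unfolding e1 e2 by simp
    then have "sqrt ?m * sqrt ?m \<le> M * sqrt ?m" using m0 by simp
    then have "sqrt ?m \<le> M"
      using mult_right_le_imp_le[of "sqrt ?m" "sqrt ?m" M] real_sqrt_ge_zero[OF m0] M by linarith
    then show "?m \<le> M\<^sup>2" by (rule sqrt_le_D)
  qed
  have mono: "incseq (\<lambda>n. indicator {x. w x \<le> real n} x * (w x * (v x)\<^sup>2))" for x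
    using w0[of x] by (auto simp: incseq_def indicator_def)
  have lim: "(\<lambda>n. indicator {x. w x \<le> real n} x * (w x * (v x)\<^sup>2)) \<longlonglongrightarrow> w x * (v x)\<^sup>2" for x
  proof (rule tendsto_eventually)
    obtain N where "w x \<le> real N" using real_arch_simple by blast
    then have "w x \<le> real n" if "n \<ge> N" for n using that by (meson of_nat_le_iff order_trans)
    then have "\<forall>n\<ge>N. indicator {x. w x \<le> real n} x * (w x * (v x)\<^sup>2) = w x * (v x)\<^sup>2" by simp
    then show "\<forall>\<^sub>F n in sequentially. indicator {x. w x \<le> real n} x * (w x * (v x)\<^sup>2) = w x * (v x)\<^sup>2"
      unfolding eventually_sequentially by blast
  qed
  have incseq: "incseq (\<lambda>n. LINT x|lborel. indicator {x. w x \<le> real n} x * (w x * (v x)\<^sup>2))"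
    unfolding incseq_def
  proof (intro allI impI integral_mono itrunc)
    fix m n :: nat and x assume "m \<le> n"
    then show "indicator {x. w x \<le> real m} x * (w x * (v x)\<^sup>2) \<le> indicator {x. w x \<le> real n} x * (w x * (v x)\<^sup>2)"
      using mono[of x] by (rule_tac incseqD)
  qed
  have conv: "(\<lambda>n. LINT x|lborel. indicator {x. w x \<le> real n} x * (w x * (v x)\<^sup>2)) \<longlonglongrightarrow>
     (SUP n. LINT x|lborel. indicator {x. w x \<le> real n} x * (w x * (v x)\<^sup>2))"
    by (rule LIMSEQ_incseq_SUP[OF bdd_aboveI2[OF trunc] incseq])
  show "integrable lborel (\<lambda>x. w x * (v x)\<^sup>2)"
    by (rule integrable_monotone_convergence[OF itrunc AE_I2[OF mono] AE_I2[OF lim] conv]) measurable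
  have "(LINT x|lborel. w x * (v x)\<^sup>2) = (SUP n. LINT x|lborel. indicator {x. w x \<le> real n} x * (w x * (v x)\<^sup>2))"
    by (rule integral_monotone_convergence[OF itrunc AE_I2[OF mono] AE_I2[OF lim] conv]) measurable
  then show "(LINT x|lborel. w x * (v x)\<^sup>2) \<le> M\<^sup>2"
    using cSUP_least[of UNIV, OF _ trunc] by simp
qed

corollary L2_duality:
  fixes v :: "plane \<Rightarrow> real"
  assumes "v \<in> L2" "M \<ge> 0"
    and "\<And>\<psi>. test_function \<psi> \<Longrightarrow> \<bar>LINT x|lborel. v x * \<psi> x\<bar> \<le> M * sqrt (LINT x|lborel. (\<psi> x)\<^sup>2)"
  shows "(LINT x|lborel. (v x)\<^sup>2) \<le> M\<^sup>2"
  using weighted_duality(2)[of v "\<lambda>_. 1" M] assms by simp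

corollary fundamental_lemma:
  assumes "v \<in> L2" "\<And>\<psi>. test_function \<psi> \<Longrightarrow> (LINT x|lborel. v x * \<psi> x) = 0"
  shows "AE x in lborel. v x = 0"
proof -
  have "(LINT x|lborel. (v x)\<^sup>2) \<le> 0\<^sup>2" using assms by (intro L2_duality) auto
  then have "(LINT x|lborel. (v x)\<^sup>2) = 0" by (simp add: integral_nonneg_AE order_antisym)
  then show ?thesis using integral_nonneg_eq_0_iff_AE[OF L2_square_integrable[OF assms(1)]] by simp
qed

section \<open>Weak gradients\<close>

lemma L2_vector_integrable: "g \<in> L2 \<Longrightarrow> integrable lborel (\<lambda>x. (norm (g x))\<^sup>2)"
  by (simp add: L2_def)

lemma borel_measurable_component:
  fixes g :: "'a \<Rightarrow> plane"
  assumes "g \<in> borel_measurable M" shows "(\<lambda>x. g x $ i) \<in> borel_measurable M"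
proof -
  note [measurable] = assms
  show ?thesis unfolding cart_eq_inner_axis by measurable
qed

lemma borel_measurable_planeI:
  fixes g :: "'a \<Rightarrow> plane"
  assumes "\<And>i. (\<lambda>x. g x $ i) \<in> borel_measurable M" shows "g \<in> borel_measurable M"
  by (subst borel_measurable_euclidean_space) (auto simp: Basis_vec_def inner_axis assms)

lemma L2_vector_combination:
  fixes g h :: "plane \<Rightarrow> plane"
  assumes "g \<in> L2" "h \<in> L2" shows "(\<lambda>x. g x + s *\<^sub>R h x) \<in> L2"
  unfolding L2_def mem_Collect_eq
proof
  note [measurable] = L2_measurable_borel[OF assms(1)] L2_measurable_borel[OF assms(2)]
  show "(\<lambda>x. g x + s *\<^sub>R h x) \<in> borel_measurable lborel" by measurable
  show "integrable lborel (\<lambda>x. (norm (g x + s *\<^sub>R h x))\<^sup>2)"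
  proof (rule Bochner_Integration.integrable_bound)
    show "integrable lborel (\<lambda>x. 2 * (norm (g x))\<^sup>2 + 2 * s\<^sup>2 * (norm (h x))\<^sup>2)"
      using assms by (simp add: L2_def)
    show "AE x in lborel. norm ((norm (g x + s *\<^sub>R h x))\<^sup>2) \<le> norm (2 * (norm (g x))\<^sup>2 + 2 * s\<^sup>2 * (norm (h x))\<^sup>2)"
    proof (rule AE_I2)
      fix x
      have "norm (g x + s *\<^sub>R h x) \<le> norm (g x) + \<bar>s\<bar> * norm (h x)"
        using norm_triangle_ineq[of "g x" "s *\<^sub>R h x"] by simp
      from power_mono[OF this norm_ge_zero, of 2]
      have "(norm (g x + s *\<^sub>R h x))\<^sup>2 \<le> (norm (g x) + \<bar>s\<bar> * norm (h x))\<^sup>2" .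
      also have "\<dots> \<le> 2 * (norm (g x))\<^sup>2 + 2 * (\<bar>s\<bar> * norm (h x))\<^sup>2"
        using sum_squares_bound[of "norm (g x)" "\<bar>s\<bar> * norm (h x)"] by (simp add: power2_sum)
      finally show "norm ((norm (g x + s *\<^sub>R h x))\<^sup>2) \<le> norm (2 * (norm (g x))\<^sup>2 + 2 * s\<^sup>2 * (norm (h x))\<^sup>2)"
        by (simp add: power_mult_distrib)
    qed
  qed measurable
qed

lemma weak_gradient_L2: "weak_gradient u g \<Longrightarrow> g \<in> L2"
  by (simp add: weak_gradient_def)

lemma weak_gradient_eq:
  "weak_gradient u g \<Longrightarrow> test_function \<phi> \<Longrightarrow>
    (LINT x|lborel. u x * partial i \<phi> x) = - (LINT x|lborel. g x $ i * \<phi> x)"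
  by (simp add: weak_gradient_def)

lemma weak_gradient_combination:
  assumes u: "u \<in> L2" "weak_gradient u g" and v: "v \<in> L2" "weak_gradient v h"
  shows "weak_gradient (\<lambda>x. u x + s * v x) (\<lambda>x. g x + s *\<^sub>R h x)"
  unfolding weak_gradient_def
proof (intro conjI allI impI)
  show "(\<lambda>x. g x + s *\<^sub>R h x) \<in> L2" using L2_vector_combination weak_gradient_L2 u v by blast
  fix \<phi> :: "plane \<Rightarrow> real" and i assume \<phi>: "test_function \<phi>"
  have p: "partial i \<phi> \<in> L2" "\<phi> \<in> L2"
    using \<phi> test_function_partial test_function_L2 by auto
  note gi = L2_component[OF weak_gradient_L2[OF u(2)], of i] and hi = L2_component[OF weak_gradient_L2[OF v(2)], of i]
  have "(LINT x|lborel. (u x + s * v x) * partial i \<phi> x)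
    = (LINT x|lborel. u x * partial i \<phi> x + s * (v x * partial i \<phi> x))" by (simp add: algebra_simps)
  also have "\<dots> = (LINT x|lborel. u x * partial i \<phi> x) + s * (LINT x|lborel. v x * partial i \<phi> x)"
    using L2_integrable_mult[OF u(1) p(1)] L2_integrable_mult[OF v(1) p(1)] by simp
  also have "\<dots> = - ((LINT x|lborel. g x $ i * \<phi> x) + s * (LINT x|lborel. h x $ i * \<phi> x))"
    using weak_gradient_eq[OF u(2) \<phi>] weak_gradient_eq[OF v(2) \<phi>] by simp
  also have "\<dots> = - (LINT x|lborel. g x $ i * \<phi> x + s * (h x $ i * \<phi> x))"
    using L2_integrable_mult[OF gi p(2)] L2_integrable_mult[OF hi p(2)] by simp
  also have "\<dots> = - (LINT x|lborel. (g x + s *\<^sub>R h x) $ i * \<phi> x)" by (simp add: algebra_simps)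
  finally show "(LINT x|lborel. (u x + s * v x) * partial i \<phi> x) = - (LINT x|lborel. (g x + s *\<^sub>R h x) $ i * \<phi> x)" .
qed

lemma weak_gradient_unique:
  assumes "weak_gradient u g" "weak_gradient u h"
  shows "AE x in lborel. g x = h x"
proof -
  have "AE x in lborel. g x $ i - h x $ i = 0" for i
  proof (rule fundamental_lemma)
    note gi = L2_component[OF weak_gradient_L2[OF assms(1)], of i] and hi = L2_component[OF weak_gradient_L2[OF assms(2)], of i]
    show "(\<lambda>x. g x $ i - h x $ i) \<in> L2" using L2_diff gi hi by blast
    fix \<psi> :: "plane \<Rightarrow> real" assume \<psi>: "test_function \<psi>"
    then show "(LINT x|lborel. (g x $ i - h x $ i) * \<psi> x) = 0"
      using weak_gradient_eq[OF assms(1) \<psi>, of i] weak_gradient_eq[OF assms(2) \<psi>, of i]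
        L2_integrable_mult[OF gi test_function_L2[OF \<psi>]] L2_integrable_mult[OF hi test_function_L2[OF \<psi>]]
      by (simp add: left_diff_distrib)
  qed
  from this[of 1] this[of 2] show ?thesis
    by eventually_elim (simp add: vec_eq_iff forall_2)
qed

text \<open>The gradient chosen in the definition of \<open>grad\<close> may be replaced by any weak gradient.\<close>

lemma grad_energy:
  assumes "weak_gradient u g"
  shows "(LINT x|lborel. (norm (grad u x))\<^sup>2) = (LINT x|lborel. (norm (g x))\<^sup>2)"
proof -
  have gr: "weak_gradient u (grad u)"
    using someI[of "weak_gradient u", OF assms] unfolding grad_def .
  note [measurable] = L2_measurable_borel[OF weak_gradient_L2[OF assms]] L2_measurable_borel[OF weak_gradient_L2[OF gr]]
  show ?thesis
    by (rule integral_cong_AE) (use weak_gradient_unique[OF gr assms] in \<open>auto elim: eventually_mono\<close>)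
qed

section \<open>Integrating along a one-parameter family of functions\<close>

text \<open>Write the difference as \<open>\<integral>\<^sub>0\<^sup>t \<integral> u h\<^sub>\<tau> dy d\<tau>\<close> and exchange the integrals. Below, \<open>h\<^sub>\<tau>\<close> is a
  derivative of a test function, so that the inner integral is controlled by the weak gradient of \<open>u\<close>.\<close>

lemma integral_parameter_bound:
  fixes u :: "plane \<Rightarrow> real" and \<Theta> h :: "real \<Rightarrow> plane \<Rightarrow> real"
  assumes u: "u \<in> L2" and t: "0 \<le> t"
    and deriv: "\<And>\<tau> y. 0 \<le> \<tau> \<Longrightarrow> \<tau> \<le> t \<Longrightarrow> ((\<lambda>\<tau>. \<Theta> \<tau> y) has_real_derivative h \<tau> y) (at \<tau>)"
    and cont: "continuous_on UNIV (\<lambda>(\<tau>, y). h \<tau> y)"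
    and supp: "\<And>\<tau> y. 0 \<le> \<tau> \<Longrightarrow> \<tau> \<le> t \<Longrightarrow> norm y \<ge> R \<Longrightarrow> h \<tau> y = 0"
    and bound: "\<And>\<tau>. 0 \<le> \<tau> \<Longrightarrow> \<tau> \<le> t \<Longrightarrow> \<bar>LINT y|lborel. u y * h \<tau> y\<bar> \<le> M"
  shows "\<bar>LINT y|lborel. u y * (\<Theta> t y - \<Theta> 0 y)\<bar> \<le> M * t"
proof -
  define H where "H \<tau> y = indicator {0..t} \<tau> * (u y * h \<tau> y)" for \<tau> y
  have h: "(\<lambda>(\<tau>, y). h \<tau> y) \<in> borel_measurable (borel \<Otimes>\<^sub>M borel)"
    using borel_measurable_continuous_onI[OF cont] by (simp add: borel_prod)
  note [measurable] = L2_measurable_borel[OF u] h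
  have "compact ((\<lambda>(\<tau>, y). h \<tau> y) ` ({0..t} \<times> cball 0 R))"
    by (intro compact_continuous_image compact_Times continuous_on_subset[OF cont]) auto
  then obtain C where C: "\<forall>y\<in>(\<lambda>(\<tau>, y). h \<tau> y) ` ({0..t} \<times> cball 0 R). norm y \<le> C"
    using compact_imp_bounded bounded_iff by metis
  define K where "K = max C 0"
  have hK: "\<bar>h \<tau> y\<bar> \<le> K * indicator (cball 0 R) y" if "0 \<le> \<tau>" "\<tau> \<le> t" for \<tau> y
  proof (cases "norm y \<le> R")
    case True
    then have "h \<tau> y \<in> (\<lambda>(\<tau>, y). h \<tau> y) ` ({0..t} \<times> cball 0 R)" using that by force
    with C True show ?thesis by (auto simp: K_def le_max_iff_disj)
  next
    case False
    then show ?thesis using supp[OF that, of y] by (simp add: indicator_def)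
  qed
  have K0: "0 \<le> K" by (simp add: K_def)
  have iR: "(indicator (cball 0 R) :: plane \<Rightarrow> real) \<in> L2"
    using emeasure_lborel_cball_finite by (intro indicator_L2) auto
  have i1: "integrable lborel (\<lambda>y. indicator (cball 0 R) y * \<bar>u y\<bar>)"
    using L2_dominated[OF _ u, of "\<lambda>y. \<bar>u y\<bar>" 1] by (intro L2_integrable_mult[OF iR]) simp
  have iy: "integrable lborel (\<lambda>y. H \<tau> y)" and ny: "(LINT y|lborel. norm (H \<tau> y)) \<le> indicator {0..t} \<tau> * (K * (LINT y|lborel. indicator (cball 0 R) y * \<bar>u y\<bar>))" for \<tau>
  proof -
    have b: "norm (H \<tau> y) \<le> indicator {0..t} \<tau> * (K * (indicator (cball 0 R) y * \<bar>u y\<bar>))" for y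
      using mult_right_mono[OF hK abs_ge_zero, of \<tau> y "u y"] 
      by (auto simp: H_def abs_mult mult_ac split: split_indicator)
    have i2: "integrable lborel (\<lambda>y. indicator {0..t} \<tau> * (K * (indicator (cball 0 R) y * \<bar>u y\<bar>)))"
      using i1 by simp
    show i3: "integrable lborel (\<lambda>y. H \<tau> y)"
      by (rule Bochner_Integration.integrable_bound[OF i2]) 
        (use b order_trans[OF b abs_ge_self] in \<open>auto simp: H_def[abs_def]\<close>)
    have "(LINT y|lborel. norm (H \<tau> y)) \<le> (LINT y|lborel. indicator {0..t} \<tau> * (K * (indicator (cball 0 R) y * \<bar>u y\<bar>)))"
      using i3 i2 b by (intro integral_mono) auto
    then show "(LINT y|lborel. norm (H \<tau> y)) \<le> indicator {0..t} \<tau> * (K * (LINT y|lborel. indicator (cball 0 R) y * \<bar>u y\<bar>))"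
      by simp
  qed
  have Hm: "(\<lambda>(\<tau>, y). H \<tau> y) \<in> borel_measurable (lborel \<Otimes>\<^sub>M lborel)"
    unfolding H_def by measurable
  have it: "integrable lborel (indicator {0..t} :: real \<Rightarrow> real)"
    using t by (simp add: integrable_indicator_iff emeasure_lborel_Icc)
  have int: "integrable (lborel \<Otimes>\<^sub>M lborel) (\<lambda>(\<tau>, y). H \<tau> y)"
  proof (rule lborel_pair.Fubini_integrable[OF Hm])
    show "integrable lborel (\<lambda>\<tau>. LINT y|lborel. norm (case (\<tau>, y) of (\<tau>, y) \<Rightarrow> H \<tau> y))"
    proof (rule Bochner_Integration.integrable_bound)
      show "integrable lborel (\<lambda>\<tau>. indicator {0..t} \<tau> * (K * (LINT y|lborel. indicator (cball 0 R) y * \<bar>u y\<bar>)) :: real)"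
        using it by simp
      show "(\<lambda>\<tau>. LINT y|lborel. norm (case (\<tau>, y) of (\<tau>, y) \<Rightarrow> H \<tau> y)) \<in> borel_measurable lborel"
        unfolding H_def by measurable
      show "AE \<tau> in lborel. norm (LINT y|lborel. norm (case (\<tau>, y) of (\<tau>, y) \<Rightarrow> H \<tau> y))
        \<le> norm (indicator {0..t} \<tau> * (K * (LINT y|lborel. indicator (cball 0 R) y * \<bar>u y\<bar>)))"
        using ny by (auto intro: order_trans[OF _ abs_ge_self])
    qed
    show "AE \<tau> in lborel. integrable lborel (\<lambda>y. case (\<tau>, y) of (\<tau>, y) \<Rightarrow> H \<tau> y)"
      using iy by simp
  qed
  have inner: "(LINT \<tau>|lborel. H \<tau> y) = u y * (\<Theta> t y - \<Theta> 0 y)" for y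
  proof -
    have c: "continuous (at \<tau>) (\<lambda>\<tau>. h \<tau> y)" for \<tau>
    proof -
      have "continuous_on UNIV (\<lambda>\<tau>. (\<lambda>(\<tau>, y). h \<tau> y) (\<tau>, y))"
        by (rule continuous_on_compose2[OF cont]) (auto intro!: continuous_intros)
      then show ?thesis by (simp add: continuous_on_eq_continuous_at)
    qed
    have "(LINT \<tau>|lborel. h \<tau> y * indicator {0..t} \<tau>) = \<Theta> t y - \<Theta> 0 y"
      using integral_FTC_Icc_real[of 0 t "\<lambda>\<tau>. \<Theta> \<tau> y" "\<lambda>\<tau>. h \<tau> y", OF t deriv c] by blast
    then have "u y * (LINT \<tau>|lborel. h \<tau> y * indicator {0..t} \<tau>) = u y * (\<Theta> t y - \<Theta> 0 y)" by simp
    then show ?thesis unfolding H_def by (subst (asm) integral_mult_right_zero[symmetric]) (simp add: mult_ac)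
  qed
  have "(LINT y|lborel. u y * (\<Theta> t y - \<Theta> 0 y)) = (LINT y|lborel. LINT \<tau>|lborel. H \<tau> y)"
    by (simp add: inner)
  also have "\<dots> = (LINT \<tau>|lborel. LINT y|lborel. H \<tau> y)"
    by (rule lborel_pair.Fubini_integral[OF int])
  also have "\<bar>\<dots>\<bar> \<le> (LINT \<tau>|lborel. \<bar>LINT y|lborel. H \<tau> y\<bar>)"
    by (rule integral_abs_bound)
  also have "\<dots> \<le> (LINT \<tau>|lborel. indicator {0..t} \<tau> * M)"
  proof (rule integral_mono)
    show "integrable lborel (\<lambda>\<tau>. \<bar>LINT y|lborel. H \<tau> y\<bar>)"
      using lborel_pair.integrable_fst[OF int] by simp
    show "integrable lborel (\<lambda>\<tau>. indicator {0..t} \<tau> * M)" using it by simp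
    show "\<bar>LINT y|lborel. H \<tau> y\<bar> \<le> indicator {0..t} \<tau> * M" for \<tau>
      using bound[of \<tau>] by (auto simp: H_def split: split_indicator)
  qed
  also have "\<dots> = M * t" using t by simp
  finally show ?thesis .
qed

section \<open>Translates\<close>

lemma lborel_translate:
  fixes f :: "plane \<Rightarrow> real"
  assumes [measurable]: "f \<in> borel_measurable borel"
  shows "(LINT x|lborel. f (x + z)) = (LINT x|lborel. f x)"
    and "integrable lborel (\<lambda>x. f (x + z)) \<longleftrightarrow> integrable lborel f"
proof -
  have "(+) z = (\<lambda>x::plane. x + z)" by (simp add: fun_eq_iff add.commute)
  then have e: "lborel = distr lborel borel (\<lambda>x::plane. x + z)"
    using lborel_distr_plus[of z] by simp
  show "(LINT x|lborel. f (x + z)) = (LINT x|lborel. f x)"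
    by (subst (2) e, subst integral_distr) auto
  show "integrable lborel (\<lambda>x. f (x + z)) \<longleftrightarrow> integrable lborel f"
    by (subst (2) e, subst integrable_distr_eq) auto
qed

lemma L2_translate: "f \<in> L2 \<Longrightarrow> (\<lambda>x. f (x + z)) \<in> L2" for f :: "plane \<Rightarrow> real"
proof -
  assume f: "f \<in> L2"
  note [measurable] = L2_measurable_borel[OF f]
  have "integrable lborel (\<lambda>x. (f (x + z))\<^sup>2)"
    using lborel_translate(2)[of "\<lambda>x. (f x)\<^sup>2" z] L2_square_integrable[OF f] by simp
  then show "(\<lambda>x. f (x + z)) \<in> L2" unfolding L2_real by simp
qed

lemma partial_translate:
  assumes "smooth \<psi>" shows "partial i (\<lambda>y. \<psi> (y - a)) = (\<lambda>y. partial i \<psi> (y - a))"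
proof
  fix y
  have "((\<lambda>y. \<psi> (y - a)) has_derivative (\<lambda>h. h $ 1 * partial 1 \<psi> (y - a) + h $ 2 * partial 2 \<psi> (y - a))) (at y)"
    by (rule has_derivative_compose[of "\<lambda>y. y - a" "\<lambda>h. h", OF _ smooth_has_derivative'[OF assms]])
       (auto intro!: derivative_eq_intros)
  from partial_eqI[OF this, of i] show "partial i (\<lambda>y. \<psi> (y - a)) y = partial i \<psi> (y - a)"
    using exhaust_2[of i] by (auto simp: axis_def)
qed

lemma test_function_translate:
  assumes "test_function \<psi>" shows "test_function (\<lambda>y. \<psi> (y - a))"
proof -
  have "smooth (\<lambda>y. \<psi> (y - a))"
    by (rule smooth_compose_map[OF _ test_function_smooth[OF assms]])
       (auto intro!: smooth_diff smooth_intros)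
  moreover have "{y. \<psi> (y - a) \<noteq> 0} = (+) a ` {y. \<psi> y \<noteq> 0}"
    by (auto simp: image_iff intro!: exI[of _ "_ - a"])
  ultimately show ?thesis using assms bounded_translation[of "{y. \<psi> y \<noteq> 0}" a] by (simp add: test_function_iff)
qed

lemma weak_gradient_directional:
  assumes u: "u \<in> L2" "weak_gradient u g" and \<phi>: "test_function \<phi>"
  shows "(LINT x|lborel. u x * (z $ 1 * partial 1 \<phi> x + z $ 2 * partial 2 \<phi> x)) = - (LINT x|lborel. (z \<bullet> g x) * \<phi> x)"
proof -
  have p: "partial i \<phi> \<in> L2" "\<phi> \<in> L2" for i
    using \<phi> test_function_partial test_function_L2 by auto
  note gi = L2_component[OF weak_gradient_L2[OF u(2)]]
  have "(LINT x|lborel. u x * (z $ 1 * partial 1 \<phi> x + z $ 2 * partial 2 \<phi> x))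
    = (LINT x|lborel. z $ 1 * (u x * partial 1 \<phi> x) + z $ 2 * (u x * partial 2 \<phi> x))"
    by (simp add: algebra_simps)
  also have "\<dots> = - (LINT x|lborel. z $ 1 * (g x $ 1 * \<phi> x) + z $ 2 * (g x $ 2 * \<phi> x))"
    using L2_integrable_mult[OF u(1) p(1)] L2_integrable_mult[OF gi p(2)] weak_gradient_eq[OF u(2) \<phi>] by simp
  also have "\<dots> = - (LINT x|lborel. (z \<bullet> g x) * \<phi> x)"
    by (simp add: inner_vec_def UNIV_2 algebra_simps)
  finally show ?thesis .
qed

lemma L2_inner:
  fixes g :: "plane \<Rightarrow> plane"
  assumes "g \<in> L2"
  shows "(\<lambda>x. z \<bullet> g x) \<in> L2" "(LINT x|lborel. (z \<bullet> g x)\<^sup>2) \<le> (norm z)\<^sup>2 * (LINT x|lborel. (norm (g x))\<^sup>2)"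
proof -
  note [measurable] = L2_measurable_borel[OF assms]
  show L: "(\<lambda>x. z \<bullet> g x) \<in> L2"
    by (rule L2_dominated[OF _ assms, of _ "norm z"]) (measurable, rule Cauchy_Schwarz_ineq2)
  have "(z \<bullet> g x)\<^sup>2 \<le> (norm z)\<^sup>2 * (norm (g x))\<^sup>2" for x
    using power_mono[OF Cauchy_Schwarz_ineq2 abs_ge_zero, of z "g x" 2] by (simp add: power_mult_distrib)
  then have "(LINT x|lborel. (z \<bullet> g x)\<^sup>2) \<le> (LINT x|lborel. (norm z)\<^sup>2 * (norm (g x))\<^sup>2)"
    using L2_square_integrable[OF L] L2_vector_integrable[OF assms] by (intro integral_mono) auto
  then show "(LINT x|lborel. (z \<bullet> g x)\<^sup>2) \<le> (norm z)\<^sup>2 * (LINT x|lborel. (norm (g x))\<^sup>2)" by simp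
qed

text \<open>By duality the translation is moved to the test function, whose translates are
  differentiated along the segment from \<open>0\<close> to \<open>z\<close>.\<close>

lemma translation_estimate:
  assumes u: "u \<in> L2" "weak_gradient u g"
  shows "(LINT x|lborel. (u (x + z) - u x)\<^sup>2) \<le> (norm z)\<^sup>2 * (LINT x|lborel. (norm (g x))\<^sup>2)"
proof -
  define G where "G = (LINT x|lborel. (norm (g x))\<^sup>2)"
  have G0: "G \<ge> 0" by (simp add: G_def)
  have um: "u \<in> borel_measurable borel" by (rule L2_measurable_borel[OF u(1)])
  have "(LINT x|lborel. (u (x + z) - u x)\<^sup>2) \<le> (norm z * sqrt G)\<^sup>2"
  proof (rule L2_duality)
    show "(\<lambda>x. u (x + z) - u x) \<in> L2" by (intro L2_diff L2_translate u)
    fix \<psi> :: "plane \<Rightarrow> real" assume \<psi>: "test_function \<psi>"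
    note \<psi>L = test_function_L2[OF \<psi>] and \<psi>s = test_function_smooth[OF \<psi>]
    have \<psi>m: "\<psi> \<in> borel_measurable borel" by (rule smooth_measurable[OF \<psi>s])
    define \<Theta> where "\<Theta> \<tau> y = \<psi> (y - \<tau> *\<^sub>R z)" for \<tau> y
    define h where "h \<tau> y = (- z) $ 1 * partial 1 \<psi> (y - \<tau> *\<^sub>R z) + (- z) $ 2 * partial 2 \<psi> (y - \<tau> *\<^sub>R z)" for \<tau> y
    obtain R where R: "R > 0" "\<And>x. norm x \<ge> R \<Longrightarrow> partial 1 \<psi> x = 0 \<and> partial 2 \<psi> x = 0"
    proof -
      obtain R1 where R1: "R1 > 0" "\<And>x. norm x \<ge> R1 \<Longrightarrow> partial 1 \<psi> x = 0"
        using test_function_outside[OF test_function_partial[OF \<psi>]] by blast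
      obtain R2 where R2: "R2 > 0" "\<And>x. norm x \<ge> R2 \<Longrightarrow> partial 2 \<psi> x = 0"
        using test_function_outside[OF test_function_partial[OF \<psi>]] by blast
      show thesis using R1 R2 by (intro that[of "max R1 R2"]) auto
    qed
    have "\<bar>LINT y|lborel. u y * (\<Theta> 1 y - \<Theta> 0 y)\<bar> \<le> norm z * sqrt G * sqrt (LINT x|lborel. (\<psi> x)\<^sup>2) * 1"
    proof (rule integral_parameter_bound[where h = h and R = "R + norm z"])
      show "((\<lambda>\<tau>. \<Theta> \<tau> y) has_real_derivative h \<tau> y) (at \<tau>)" for \<tau> y
      proof -
        have "((\<lambda>\<tau>. y - \<tau> *\<^sub>R z) has_derivative (\<lambda>s. - (s *\<^sub>R z))) (at \<tau>)"
          by (auto intro!: derivative_eq_intros)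
        from has_derivative_compose[OF this smooth_has_derivative'[OF \<psi>s]]
        show ?thesis unfolding \<Theta>_def h_def has_field_derivative_def
          by (rule has_derivative_eq_rhs) (auto simp: algebra_simps)
      qed
      have c: "continuous_on UNIV (\<lambda>p. partial i \<psi> (snd p - fst p *\<^sub>R z))" for i
        by (rule continuous_on_compose2[OF smooth_continuous_on[OF smooth_partial[OF \<psi>s], of UNIV]])
           (auto intro!: continuous_intros)
      show "continuous_on UNIV (\<lambda>(\<tau>, y). h \<tau> y)"
        unfolding h_def case_prod_unfold by (intro continuous_intros c)
      show "h \<tau> y = 0" if "0 \<le> \<tau>" "\<tau> \<le> 1" "norm y \<ge> R + norm z" for \<tau> y
      proof -
        have "norm (\<tau> *\<^sub>R z) \<le> norm z" using that by (simp add: mult_left_le_one_le)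
        then have "norm (y - \<tau> *\<^sub>R z) \<ge> R" using norm_triangle_ineq2[of y "\<tau> *\<^sub>R z"] that by linarith
        then show ?thesis using R by (simp add: h_def)
      qed
      show "\<bar>LINT y|lborel. u y * h \<tau> y\<bar> \<le> norm z * sqrt G * sqrt (LINT x|lborel. (\<psi> x)\<^sup>2)" for \<tau>
      proof -
        let ?\<phi> = "\<lambda>y. \<psi> (y - \<tau> *\<^sub>R z)"
        have t: "test_function ?\<phi>" by (rule test_function_translate[OF \<psi>])
        have "(LINT y|lborel. u y * h \<tau> y) = - (LINT x|lborel. (- z \<bullet> g x) * ?\<phi> x)"
          using weak_gradient_directional[OF u t, of "- z"] by (simp add: h_def partial_translate[OF \<psi>s])
        also have "\<bar>\<dots>\<bar> \<le> sqrt (LINT x|lborel. (- z \<bullet> g x)\<^sup>2) * sqrt (LINT x|lborel. (?\<phi> x)\<^sup>2)"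
          unfolding abs_minus_cancel
          by (rule L2_Cauchy_Schwarz[OF L2_inner(1)[OF weak_gradient_L2[OF u(2)]] test_function_L2[OF t]])
        also have "(LINT x|lborel. (?\<phi> x)\<^sup>2) = (LINT x|lborel. (\<psi> x)\<^sup>2)"
          using lborel_translate(1)[of "\<lambda>x. (\<psi> x)\<^sup>2" "- (\<tau> *\<^sub>R z)"] \<psi>m by simp
        also have "sqrt (LINT x|lborel. (- z \<bullet> g x)\<^sup>2) \<le> sqrt ((norm z)\<^sup>2 * G)"
          using L2_inner(2)[OF weak_gradient_L2[OF u(2)], of "- z"] by (simp add: G_def)
        also have "\<dots> = norm z * sqrt G" by (simp add: real_sqrt_mult)
        finally show ?thesis by (simp add: mult_right_mono)
      qed
    qed (use u in auto)
    moreover have "(LINT x|lborel. (u (x + z) - u x) * \<psi> x) = (LINT y|lborel. u y * (\<Theta> 1 y - \<Theta> 0 y))"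
    proof -
      have tL: "(\<lambda>y. \<psi> (y - z)) \<in> L2" by (rule test_function_L2[OF test_function_translate[OF \<psi>]])
      note [measurable] = um \<psi>m
      have "(LINT x|lborel. (u (x + z) - u x) * \<psi> x) = (LINT x|lborel. u (x + z) * \<psi> ((x + z) - z)) - (LINT x|lborel. u x * \<psi> x)"
        using L2_integrable_mult[OF L2_translate[OF u(1), of z] \<psi>L] L2_integrable_mult[OF u(1) \<psi>L] by (simp add: left_diff_distrib)
      also have "(LINT x|lborel. u (x + z) * \<psi> ((x + z) - z)) = (LINT x|lborel. u x * \<psi> (x - z))"
        by (rule lborel_translate(1)[of "\<lambda>x. u x * \<psi> (x - z)" z]) measurable
      also have "(LINT x|lborel. u x * \<psi> (x - z)) - (LINT x|lborel. u x * \<psi> x) = (LINT y|lborel. u y * (\<Theta> 1 y - \<Theta> 0 y))"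
        using L2_integrable_mult[OF u(1) tL] L2_integrable_mult[OF u(1) \<psi>L] by (simp add: \<Theta>_def right_diff_distrib)
      finally show ?thesis .
    qed
    ultimately show "\<bar>LINT x|lborel. (u (x + z) - u x) * \<psi> x\<bar> \<le> norm z * sqrt G * sqrt (LINT x|lborel. (\<psi> x)\<^sup>2)"
      by simp
  qed (use G0 in simp)
  also have "\<dots> = (norm z)\<^sup>2 * G" using G0 by (simp add: power_mult_distrib)
  finally show ?thesis by (simp add: G_def)
qed

section \<open>Averages over small squares and the Sobolev embedding\<close>

abbreviation unit_square :: "plane set" where "unit_square \<equiv> cbox 0 1"

definition square_average :: "real \<Rightarrow> (plane \<Rightarrow> real) \<Rightarrow> plane \<Rightarrow> real" where
  "square_average r f x = (LINT z|lborel. indicator unit_square z * f (x + r *\<^sub>R z))"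

lemma emeasure_unit_square: "emeasure lborel unit_square = 1"
  by (subst emeasure_lborel_cbox) (auto simp: Basis_vec_def inner_axis intro!: prod.neutral)

lemma unit_square_L2: "(indicator unit_square :: plane \<Rightarrow> real) \<in> L2"
  by (rule indicator_L2) (auto simp: emeasure_unit_square)

lemma integral_unit_square: "(LINT z|lborel. indicator unit_square z :: real) = 1"
  by (simp add: measure_def emeasure_unit_square)

lemma norm_unit_square: "z \<in> unit_square \<Longrightarrow> norm z \<le> 2"
proof -
  assume "z \<in> unit_square"
  then have "\<bar>z $ 1\<bar> \<le> 1" "\<bar>z $ 2\<bar> \<le> 1" by (auto simp: mem_box_cart)
  then show ?thesis using norm_le_l1_cart[of z] by (simp add: UNIV_2)
qed

lemma lborel_rescale:
  fixes f :: "plane \<Rightarrow> real"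
  assumes [measurable]: "f \<in> borel_measurable borel" and r: "r > 0"
  shows "(LINT z|lborel. f (x + r *\<^sub>R z)) = (LINT z|lborel. f z) / r\<^sup>2"
    and "integrable lborel f \<Longrightarrow> integrable lborel (\<lambda>z. f (x + r *\<^sub>R z))"
proof -
  have e: "lborel = density (distr lborel borel (\<lambda>z::plane. x + r *\<^sub>R z)) (\<lambda>_. ennreal (r\<^sup>2))"
    using lborel_affine[of r x] r by simp
  have "(LINT z|lborel. f z) = r\<^sup>2 * (LINT z|lborel. f (x + r *\<^sub>R z))"
    by (subst e, subst integral_density) (auto simp: integral_distr)
  then show "(LINT z|lborel. f (x + r *\<^sub>R z)) = (LINT z|lborel. f z) / r\<^sup>2" using r by simp
  assume "integrable lborel f"
  then have "integrable (distr lborel borel (\<lambda>z::plane. x + r *\<^sub>R z)) (\<lambda>z. r\<^sup>2 *\<^sub>R f z)"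
    by (subst (asm) e, subst (asm) integrable_density) auto
  then have "integrable lborel (\<lambda>z. r\<^sup>2 *\<^sub>R f (x + r *\<^sub>R z))"
    by (subst (asm) integrable_distr_eq) auto
  then show "integrable lborel (\<lambda>z. f (x + r *\<^sub>R z))" using r by simp
qed

lemma L2_rescale:
  fixes f :: "plane \<Rightarrow> real"
  assumes "f \<in> L2" "r > 0"
  shows "(\<lambda>z. f (x + r *\<^sub>R z)) \<in> L2"
    and "(LINT z|lborel. (f (x + r *\<^sub>R z))\<^sup>2) = (LINT z|lborel. (f z)\<^sup>2) / r\<^sup>2"
proof -
  note [measurable] = L2_measurable_borel[OF assms(1)]
  have m: "(\<lambda>z. (f z)\<^sup>2) \<in> borel_measurable borel" by measurable
  show "(\<lambda>z. f (x + r *\<^sub>R z)) \<in> L2"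
    using lborel_rescale(2)[OF m assms(2) L2_square_integrable[OF assms(1)]] unfolding L2_real by simp
  show "(LINT z|lborel. (f (x + r *\<^sub>R z))\<^sup>2) = (LINT z|lborel. (f z)\<^sup>2) / r\<^sup>2"
    by (rule lborel_rescale(1)[OF m assms(2)])
qed

lemma square_mean_Jensen:
  fixes f :: "plane \<Rightarrow> real"
  assumes "f \<in> L2"
  shows "(LINT z|lborel. indicator unit_square z * f z)\<^sup>2 \<le> (LINT z|lborel. indicator unit_square z * (f z)\<^sup>2)"
    and "(LINT z|lborel. indicator unit_square z * (f z)\<^sup>2) \<le> (LINT z|lborel. (f z)\<^sup>2)"
    and "integrable lborel (\<lambda>z. indicator unit_square z * (f z)\<^sup>2)"
proof -
  note [measurable] = L2_measurable_borel[OF assms]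
  let ?f = "\<lambda>z. indicator unit_square z * f z"
  have fL: "?f \<in> L2" by (rule L2_dominated[OF _ assms, of _ 1]) (auto simp: indicator_def)
  have s: "(?f z)\<^sup>2 = indicator unit_square z * (f z)\<^sup>2" "indicator unit_square z * ?f z = ?f z"
     "(indicator unit_square z :: real)\<^sup>2 = indicator unit_square z" for z
    by (auto simp: indicator_def)
  have "\<bar>LINT z|lborel. ?f z\<bar> \<le> sqrt 1 * sqrt (LINT z|lborel. indicator unit_square z * (f z)\<^sup>2)"
    using L2_Cauchy_Schwarz[OF unit_square_L2 fL] unfolding s integral_unit_square .
  then show "(LINT z|lborel. ?f z)\<^sup>2 \<le> (LINT z|lborel. indicator unit_square z * (f z)\<^sup>2)"
    by (intro sqrt_ge_absD) simp
  show i: "integrable lborel (\<lambda>z. indicator unit_square z * (f z)\<^sup>2)"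
    using L2_square_integrable[OF fL] unfolding s .
  show "(LINT z|lborel. indicator unit_square z * (f z)\<^sup>2) \<le> (LINT z|lborel. (f z)\<^sup>2)"
    using i L2_square_integrable[OF assms] by (intro integral_mono) (auto simp: indicator_def)
qed

lemma square_average_bound:
  assumes "f \<in> L2" "r > 0"
  shows "\<bar>square_average r f x\<bar> \<le> sqrt (LINT z|lborel. (f z)\<^sup>2) / r"
proof -
  have "(square_average r f x)\<^sup>2 \<le> (LINT z|lborel. (f z)\<^sup>2) / r\<^sup>2"
    unfolding square_average_def
    using square_mean_Jensen(1,2)[OF L2_rescale(1)[OF assms, of x]] unfolding L2_rescale(2)[OF assms] by linarith
  then have "sqrt ((square_average r f x)\<^sup>2) \<le> sqrt ((LINT z|lborel. (f z)\<^sup>2) / r\<^sup>2)" by (rule real_sqrt_le_mono)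
  then show ?thesis using assms by (simp add: real_sqrt_divide)
qed

lemma square_average_measurable [measurable]:
  assumes [measurable]: "f \<in> borel_measurable borel"
  shows "square_average r f \<in> borel_measurable borel"
  unfolding square_average_def[abs_def] by measurable

lemma square_average_integrable:
  fixes f :: "plane \<Rightarrow> real"
  assumes "f \<in> L2" "r > 0" shows "integrable lborel (\<lambda>z. indicator unit_square z * f (x + r *\<^sub>R z))"
  by (rule L2_integrable_mult[OF unit_square_L2 L2_rescale(1)[OF assms]])

text \<open>The error is an average over \<open>z\<close> of the differences \<open>u(x + r z) - u(x)\<close>, where \<open>|r z| \<le> 2 r\<close>.\<close>

lemma square_average_error:
  assumes u: "u \<in> L2" "weak_gradient u g" and r: "r > 0"
  shows "(\<lambda>x. u x - square_average r u x) \<in> L2"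
    and "(LINT x|lborel. (u x - square_average r u x)\<^sup>2) \<le> 4 * r\<^sup>2 * (LINT x|lborel. (norm (g x))\<^sup>2)"
proof -
  note [measurable] = L2_measurable_borel[OF u(1)]
  define G where "G = (LINT x|lborel. (norm (g x))\<^sup>2)"
  have G0: "0 \<le> G" by (simp add: G_def)
  have pt: "ennreal ((u x - square_average r u x)\<^sup>2)
      \<le> (\<integral>\<^sup>+z. ennreal (indicator unit_square z * (u (x + r *\<^sub>R z) - u x)\<^sup>2) \<partial>lborel)" for x
  proof -
    let ?d = "\<lambda>z. indicator unit_square z * (u (x + r *\<^sub>R z) - u x)"
    have d: "?d z = indicator unit_square z * u (x + r *\<^sub>R z) + (- u x) * indicator unit_square z" for z
      by (simp add: algebra_simps)
    have dL: "?d \<in> L2" unfolding d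
    proof (intro L2_add L2_scale unit_square_L2)
      show "(\<lambda>z. indicator unit_square z * u (x + r *\<^sub>R z)) \<in> L2"
        by (rule L2_dominated[OF _ L2_rescale(1)[OF u(1) r, of x], of _ 1]) (auto simp: indicator_def)
    qed
    have ii: "indicator unit_square z * ?d z = ?d z" "indicator unit_square z * (?d z)\<^sup>2 = indicator unit_square z * (u (x + r *\<^sub>R z) - u x)\<^sup>2" for z
      by (auto simp: indicator_def)
    have "(LINT z|lborel. ?d z) = square_average r u x - u x"
      unfolding d square_average_def
      using square_average_integrable[OF u(1) r, of x] unit_square_L2 integrable_indicator_iff[of lborel unit_square]
      by (simp add: emeasure_unit_square measure_def)
    then have "(u x - square_average r u x)\<^sup>2 \<le> (LINT z|lborel. indicator unit_square z * (u (x + r *\<^sub>R z) - u x)\<^sup>2)"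
      using square_mean_Jensen(1)[OF dL] unfolding ii by (simp add: power2_commute)
    then show ?thesis
      using square_mean_Jensen(3)[OF dL] unfolding ii
      by (subst nn_integral_eq_integral) (auto intro!: ennreal_leI AE_I2)
  qed
  have "(\<integral>\<^sup>+x. ennreal ((u x - square_average r u x)\<^sup>2) \<partial>lborel)
      \<le> (\<integral>\<^sup>+x. \<integral>\<^sup>+z. ennreal (indicator unit_square z * (u (x + r *\<^sub>R z) - u x)\<^sup>2) \<partial>lborel \<partial>lborel)"
    by (intro nn_integral_mono pt)
  also have "\<dots> = (\<integral>\<^sup>+z. \<integral>\<^sup>+x. ennreal (indicator unit_square z * (u (x + r *\<^sub>R z) - u x)\<^sup>2) \<partial>lborel \<partial>lborel)"
    by (rule lborel_pair.Fubini'[symmetric]) measurable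
  also have "\<dots> \<le> (\<integral>\<^sup>+z. indicator unit_square z * ennreal (4 * r\<^sup>2 * G) \<partial>lborel)"
  proof (intro nn_integral_mono)
    fix z :: plane
    have "(\<integral>\<^sup>+x. ennreal ((u (x + r *\<^sub>R z) - u x)\<^sup>2) \<partial>lborel) \<le> ennreal (4 * r\<^sup>2 * G)" if "z \<in> unit_square"
    proof -
      have "(\<integral>\<^sup>+x. ennreal ((u (x + r *\<^sub>R z) - u x)\<^sup>2) \<partial>lborel) = ennreal (LINT x|lborel. (u (x + r *\<^sub>R z) - u x)\<^sup>2)"
        by (intro nn_integral_eq_integral L2_square_integrable[OF L2_diff[OF L2_translate[OF u(1)] u(1)]]) auto
      also have "\<dots> \<le> ennreal ((norm (r *\<^sub>R z))\<^sup>2 * G)"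
        using translation_estimate[OF u, of "r *\<^sub>R z"] by (intro ennreal_leI) (simp add: G_def)
      also have "\<dots> \<le> ennreal (4 * r\<^sup>2 * G)"
      proof (intro ennreal_leI mult_right_mono G0)
        have "norm (r *\<^sub>R z) \<le> 2 * r" using norm_unit_square[OF that] r by (simp add: mult.commute)
        from power_mono[OF this norm_ge_zero, of 2] show "(norm (r *\<^sub>R z))\<^sup>2 \<le> 4 * r\<^sup>2" by (simp add: power_mult_distrib)
      qed
      finally show ?thesis .
    qed
    then show "(\<integral>\<^sup>+x. ennreal (indicator unit_square z * (u (x + r *\<^sub>R z) - u x)\<^sup>2) \<partial>lborel)
       \<le> indicator unit_square z * ennreal (4 * r\<^sup>2 * G)"
      by (auto split: split_indicator)
  qed
  also have "\<dots> = ennreal (4 * r\<^sup>2 * G)"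
    by (subst nn_integral_multc) (auto simp: emeasure_unit_square)
  finally have *: "(\<integral>\<^sup>+x. ennreal ((u x - square_average r u x)\<^sup>2) \<partial>lborel) \<le> ennreal (4 * r\<^sup>2 * G)" .
  have i: "integrable lborel (\<lambda>x. (u x - square_average r u x)\<^sup>2)"
    by (rule integrableI_bounded) (use * in \<open>auto simp: le_less_trans[OF _ ennreal_less_top]\<close>)
  then show "(\<lambda>x. u x - square_average r u x) \<in> L2" unfolding L2_real by simp
  have "ennreal (LINT x|lborel. (u x - square_average r u x)\<^sup>2) \<le> ennreal (4 * r\<^sup>2 * G)"
    using * by (subst (asm) nn_integral_eq_integral[OF i]) auto
  then show "(LINT x|lborel. (u x - square_average r u x)\<^sup>2) \<le> 4 * r\<^sup>2 * (LINT x|lborel. (norm (g x))\<^sup>2)"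
    using G0 by (simp add: G_def ennreal_le_iff)
qed

lemma square_average_le:
  assumes "f \<in> borel_measurable borel" "\<And>x. \<bar>f x\<bar> \<le> C"
  shows "\<bar>square_average r f x\<bar> \<le> C"
proof -
  note [measurable] = assms(1)
  have C0: "0 \<le> C" using assms(2)[of 0] by linarith
  have iC: "integrable lborel (\<lambda>z. C * indicator unit_square z :: real)"
    using integrable_indicator_iff[of lborel unit_square] by (simp add: emeasure_unit_square)
  have "\<bar>square_average r f x\<bar> \<le> (LINT z|lborel. \<bar>indicator unit_square z * f (x + r *\<^sub>R z)\<bar>)"
    unfolding square_average_def by (rule integral_abs_bound)
  also have "\<dots> \<le> (LINT z|lborel. C * indicator unit_square z)"
  proof (rule integral_mono[OF _ iC])
    show le: "\<bar>indicator unit_square z * f (x + r *\<^sub>R z)\<bar> \<le> C * indicator unit_square z" for z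
      using assms(2) C0 by (auto simp: indicator_def)
    show "integrable lborel (\<lambda>z. \<bar>indicator unit_square z * f (x + r *\<^sub>R z)\<bar>)"
      by (rule Bochner_Integration.integrable_bound[OF iC])
         (use le in \<open>auto intro!: order_trans[OF _ abs_ge_self]\<close>)
  qed
  also have "\<dots> = C" by (simp add: measure_def emeasure_unit_square)
  finally show ?thesis .
qed

text \<open>Halving the radius costs only a constant: with \<open>A\<^sub>r\<close> the average at scale \<open>r\<close> and \<open>s = r/2\<close>,
  \<open>A\<^sub>s u = A\<^sub>s (u - A\<^sub>r u) + A\<^sub>s (A\<^sub>r u)\<close>. The first term is at most \<open>1/s\<close> times the norm of \<open>u - A\<^sub>r u\<close>,
  which is of order \<open>r\<close>, and averaging does not increase the supremum of the second.\<close>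

lemma dyadic_average_bound:
  assumes u: "u \<in> L2" "weak_gradient u g"
  shows "\<bar>square_average ((1 / 2) ^ k) u x\<bar>
    \<le> sqrt (LINT x|lborel. (u x)\<^sup>2) + 4 * real k * sqrt (LINT x|lborel. (norm (g x))\<^sup>2)"
proof (induction k arbitrary: x)
  case 0
  then show ?case using square_average_bound[OF u(1), of 1 x] by simp
next
  case (Suc k)
  let ?r = "(1 / 2 :: real) ^ k" and ?s = "(1 / 2 :: real) ^ Suc k"
  let ?G = "LINT x|lborel. (norm (g x))\<^sup>2"
  have r: "?r > 0" "?s > 0" by simp_all
  note err = square_average_error[OF u r(1)]
  have bd: "\<bar>square_average ?r u y\<bar> \<le> sqrt (LINT x|lborel. (u x)\<^sup>2) + 4 * real k * sqrt ?G" for y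
    by (rule Suc.IH)
  have eq: "square_average ?s u x = square_average ?s (\<lambda>x. u x - square_average ?r u x) x
      + square_average ?s (square_average ?r u) x"
  proof -
    have a: "integrable lborel (\<lambda>z. indicator unit_square z * u (x + ?s *\<^sub>R z))"
      by (rule square_average_integrable[OF u(1) r(2)])
    have b: "integrable lborel (\<lambda>z. indicator unit_square z * (u (x + ?s *\<^sub>R z) - square_average ?r u (x + ?s *\<^sub>R z)))"
      by (rule square_average_integrable[OF err(1) r(2)])
    have "square_average ?s (square_average ?r u) x = (LINT z|lborel. indicator unit_square z * u (x + ?s *\<^sub>R z)
       - indicator unit_square z * (u (x + ?s *\<^sub>R z) - square_average ?r u (x + ?s *\<^sub>R z)))"
      unfolding square_average_def[of ?s] by (rule Bochner_Integration.integral_cong) (auto simp: algebra_simps)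
    also have "\<dots> = square_average ?s u x - square_average ?s (\<lambda>x. u x - square_average ?r u x) x"
      unfolding square_average_def[of ?s] using a b by (rule Bochner_Integration.integral_diff)
    finally show ?thesis by simp
  qed
  have "\<bar>square_average ?s (\<lambda>x. u x - square_average ?r u x) x\<bar> \<le> sqrt (4 * ?r\<^sup>2 * ?G) / ?s"
    using square_average_bound[OF err(1) r(2), of x] err(2) r(2)
    by (meson divide_right_mono less_imp_le order_trans real_sqrt_le_mono)
  also have "\<dots> = 4 * sqrt ?G"
    using r by (simp add: real_sqrt_mult)
  finally have "\<bar>square_average ?s (\<lambda>x. u x - square_average ?r u x) x\<bar> \<le> 4 * sqrt ?G" .
  moreover have "\<bar>square_average ?s (square_average ?r u) x\<bar> \<le> sqrt (LINT x|lborel. (u x)\<^sup>2) + 4 * real k * sqrt ?G"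
    using L2_measurable_borel[OF u(1)] by (intro square_average_le bd square_average_measurable)
  ultimately have "\<bar>square_average ?s u x\<bar> \<le> 4 * sqrt ?G + (sqrt (LINT x|lborel. (u x)\<^sup>2) + 4 * real k * sqrt ?G)"
    unfolding eq using abs_triangle_ineq by (meson add_mono order_trans)
  then show ?case by (simp add: algebra_simps)
qed

text \<open>Where \<open>|y|\<close> lies between \<open>2B(k + 1)\<close> and \<open>2B(k + 2)\<close>, the average \<open>A\<^sub>k\<close> accounts for at most half
  of \<open>|y|\<close>, so that \<open>|y - A\<^sub>k| \<ge> B\<close>.\<close>

lemma layered_power_bound:
  fixes B q y :: real
  assumes B: "B > 0" and q: "q \<ge> 2" and avg: "\<And>k. \<bar>A k\<bar> \<le> B * (real k + 1)"
  shows "\<bar>y\<bar> powr q \<le> (2 * B) powr (q - 2) * y\<^sup>2 \<or> (\<exists>k. \<bar>y\<bar> powr q \<le> (2 * B * (real k + 2)) powr q / B\<^sup>2 * (y - A k)\<^sup>2)"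
proof (cases "\<bar>y\<bar> \<le> 2 * B")
  case True
  have "\<bar>y\<bar> powr q = \<bar>y\<bar> powr (q - 2) * y\<^sup>2"
  proof (cases "y = 0")
    case False
    then show ?thesis using powr_add[of "\<bar>y\<bar>" "q - 2" 2] by (simp add: powr_numeral)
  qed simp
  also have "\<dots> \<le> (2 * B) powr (q - 2) * y\<^sup>2"
    using True q by (intro mult_right_mono powr_mono2) auto
  finally show ?thesis by blast
next
  case False
  define m where "m = nat \<lfloor>\<bar>y\<bar> / (2 * B)\<rfloor>"
  have y1: "1 < \<bar>y\<bar> / (2 * B)" using False B by simp
  then have m: "real m \<le> \<bar>y\<bar> / (2 * B)" "\<bar>y\<bar> / (2 * B) < real m + 1" "m \<ge> 1"
    unfolding m_def by linarith+
  define k where "k = m - 1"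
  have mk: "real m = real k + 1" using m(3) by (simp add: k_def)
  have lo: "2 * B * (real k + 1) \<le> \<bar>y\<bar>" and hi: "\<bar>y\<bar> \<le> 2 * B * (real k + 2)"
    using m(1,2) B unfolding mk by (simp_all add: field_simps)
  have "B * 1 \<le> B * (real k + 1)" using B by (intro mult_left_mono) auto
  then have "B \<le> \<bar>y - A k\<bar>" using lo avg[of k] abs_triangle_ineq2[of y "A k"] by linarith
  from power_mono[OF this, of 2] have "B\<^sup>2 \<le> (y - A k)\<^sup>2" using B by simp
  then have "1 \<le> (y - A k)\<^sup>2 / B\<^sup>2" using B by simp
  moreover have "\<bar>y\<bar> powr q \<le> (2 * B * (real k + 2)) powr q" using hi q by (intro powr_mono2) auto
  ultimately have "\<bar>y\<bar> powr q * 1 \<le> (2 * B * (real k + 2)) powr q * ((y - A k)\<^sup>2 / B\<^sup>2)"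
    by (intro mult_mono) auto
  then have "\<bar>y\<bar> powr q \<le> (2 * B * (real k + 2)) powr q / B\<^sup>2 * (y - A k)\<^sup>2" by simp
  then show ?thesis by blast
qed

text \<open>The averages at scale \<open>2\<^sup>-\<^sup>k\<close> are bounded by a multiple of \<open>k + 1\<close>, while their distance from \<open>u\<close>
  is of order \<open>2\<^sup>-\<^sup>k\<close> in the mean square. Hence the layer on which \<open>|u|\<close> is comparable to \<open>k\<close> has measure of
  order \<open>4\<^sup>-\<^sup>k\<close>, and the sum of \<open>k\<^sup>q 4\<^sup>-\<^sup>k\<close> converges for every \<open>q\<close>.\<close>

theorem Sobolev_embedding:
  assumes u: "u \<in> L2" "weak_gradient u g" and q: "q \<ge> 2"
  shows "integrable lborel (\<lambda>x. \<bar>u x\<bar> powr q)"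
proof -
  note um [measurable] = L2_measurable_borel[OF u(1)]
  define G where "G = (LINT x|lborel. (norm (g x))\<^sup>2)"
  define U where "U = (LINT x|lborel. (u x)\<^sup>2)"
  (* The summand 1 keeps B positive when u vanishes. *)
  define B where "B = sqrt U + 4 * sqrt G + 1"
  define A where "A k = square_average ((1 / 2) ^ k) u" for k :: nat
  define c where "c k = (2 * B * (real k + 2)) powr q / B\<^sup>2" for k :: nat
  have nn: "0 \<le> G" "0 \<le> U" by (auto simp: G_def U_def)
  then have B: "B > 0" by (simp add: B_def add_nonneg_pos)
  have c0: "0 \<le> c k" for k by (simp add: c_def)
  have Am [measurable]: "A k \<in> borel_measurable borel" for k unfolding A_def by measurable
  have avg: "\<bar>A k x\<bar> \<le> B * (real k + 1)" for k x
  proof -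
    have "\<bar>A k x\<bar> \<le> sqrt U + 4 * real k * sqrt G"
      using dyadic_average_bound[OF u, of k x] by (simp add: A_def U_def G_def)
    also have "\<dots> \<le> B * (real k + 1)" using nn by (simp add: B_def algebra_simps)
    finally show ?thesis .
  qed
  have pt: "ennreal (\<bar>u x\<bar> powr q) \<le> ennreal ((2 * B) powr (q - 2) * (u x)\<^sup>2) + (\<Sum>k. ennreal (c k * (u x - A k x)\<^sup>2))" for x
  proof -
    from layered_power_bound[where A="\<lambda>k. A k x" and y="u x", OF B q avg] show ?thesis
    proof
      assume "\<bar>u x\<bar> powr q \<le> (2 * B) powr (q - 2) * (u x)\<^sup>2"
      then have "ennreal (\<bar>u x\<bar> powr q) \<le> ennreal ((2 * B) powr (q - 2) * (u x)\<^sup>2)" by (rule ennreal_leI)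
      then show ?thesis by (rule add_increasing2[OF zero_le])
    next
      assume "\<exists>k. \<bar>u x\<bar> powr q \<le> (2 * B * (real k + 2)) powr q / B\<^sup>2 * (u x - A k x)\<^sup>2"
      then obtain k where "\<bar>u x\<bar> powr q \<le> c k * (u x - A k x)\<^sup>2" by (auto simp: c_def)
      then have "ennreal (\<bar>u x\<bar> powr q) \<le> ennreal (c k * (u x - A k x)\<^sup>2)" by (rule ennreal_leI)
      also have "\<dots> \<le> (\<Sum>k. ennreal (c k * (u x - A k x)\<^sup>2))"
        using sum_le_suminf[of "\<lambda>k. ennreal (c k * (u x - A k x)\<^sup>2)" "{k}"] by simp
      finally show ?thesis by (rule add_increasing[OF zero_le])
    qed
  qed
  have int: "(\<integral>\<^sup>+x. ennreal (c k * (u x - A k x)\<^sup>2) \<partial>lborel) \<le> ennreal (c k * (4 * ((1 / 2) ^ k)\<^sup>2 * G))" for k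
  proof -
    have r: "(1 / 2 :: real) ^ k > 0" by simp
    note e = square_average_error[OF u r]
    have "(\<integral>\<^sup>+x. ennreal (c k * (u x - A k x)\<^sup>2) \<partial>lborel) = ennreal (LINT x|lborel. c k * (u x - A k x)\<^sup>2)"
      using L2_square_integrable[OF e(1)] c0[of k] by (intro nn_integral_eq_integral) (auto simp: A_def)
    also have "\<dots> \<le> ennreal (c k * (4 * ((1 / 2) ^ k)\<^sup>2 * G))"
      using mult_left_mono[OF e(2) c0[of k]] by (intro ennreal_leI) (simp add: A_def G_def)
    finally show ?thesis .
  qed
  have summ: "summable (\<lambda>k. c k * (4 * ((1 / 2) ^ k)\<^sup>2 * G))"
  proof -
    have "(\<lambda>k. (2 * B * (real k + 2)) powr q * (1 / 2) ^ k) \<longlonglongrightarrow> 0"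
      using B q by real_asymp
    then have "\<forall>\<^sub>F k in sequentially. (2 * B * (real k + 2)) powr q * (1 / 2) ^ k < 1"
      by (rule order_tendstoD) simp
    then have ev: "\<forall>\<^sub>F k in sequentially. norm (c k * (4 * ((1 / 2) ^ k)\<^sup>2 * G)) \<le> 4 * G / B\<^sup>2 * (1 / 2) ^ k"
    proof eventually_elim
      case (elim k)
      have "c k * (4 * ((1 / 2) ^ k)\<^sup>2 * G) = ((2 * B * (real k + 2)) powr q * (1 / 2) ^ k) * (4 * G / B\<^sup>2 * (1 / 2) ^ k)"
        by (simp add: c_def power2_eq_square)
      also have "\<dots> \<le> 1 * (4 * G / B\<^sup>2 * (1 / 2) ^ k)"
        using elim nn by (intro mult_right_mono) auto
      finally show ?case using c0[of k] nn by simp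
    qed
    show ?thesis by (rule summable_comparison_test_ev[OF ev]) (intro summable_mult summable_geometric, simp)
  qed
  have "(\<integral>\<^sup>+x. ennreal (\<bar>u x\<bar> powr q) \<partial>lborel)
      \<le> (\<integral>\<^sup>+x. ennreal ((2 * B) powr (q - 2) * (u x)\<^sup>2) + (\<Sum>k. ennreal (c k * (u x - A k x)\<^sup>2)) \<partial>lborel)"
    by (intro nn_integral_mono pt)
  also have "\<dots> = (\<integral>\<^sup>+x. ennreal ((2 * B) powr (q - 2) * (u x)\<^sup>2) \<partial>lborel) + (\<Sum>k. \<integral>\<^sup>+x. ennreal (c k * (u x - A k x)\<^sup>2) \<partial>lborel)"
    by (subst nn_integral_add) (auto simp: nn_integral_suminf)
  also have "\<dots> \<le> ennreal ((2 * B) powr (q - 2) * U) + (\<Sum>k. ennreal (c k * (4 * ((1 / 2) ^ k)\<^sup>2 * G)))"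
  proof (intro add_mono suminf_le int)
    have "(\<integral>\<^sup>+x. ennreal ((2 * B) powr (q - 2) * (u x)\<^sup>2) \<partial>lborel) = ennreal (LINT x|lborel. (2 * B) powr (q - 2) * (u x)\<^sup>2)"
      using L2_square_integrable[OF u(1)] by (intro nn_integral_eq_integral) auto
    then show "(\<integral>\<^sup>+x. ennreal ((2 * B) powr (q - 2) * (u x)\<^sup>2) \<partial>lborel) \<le> ennreal ((2 * B) powr (q - 2) * U)"
      by (simp add: U_def)
  qed auto
  also have "(\<Sum>k. ennreal (c k * (4 * ((1 / 2) ^ k)\<^sup>2 * G))) = ennreal (\<Sum>k. c k * (4 * ((1 / 2) ^ k)\<^sup>2 * G))"
    by (rule suminf_ennreal2[OF _ summ]) (intro mult_nonneg_nonneg c0 nn, simp_all)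
  also have "ennreal ((2 * B) powr (q - 2) * U) + \<dots> < \<infinity>" by simp
  finally have "(\<integral>\<^sup>+x. ennreal (\<bar>u x\<bar> powr q) \<partial>lborel) < \<infinity>" .
  then show ?thesis by (intro integrableI_bounded) auto
qed

corollary Sobolev_fourth_power:
  assumes "u \<in> L2" "weak_gradient u g"
  shows "integrable lborel (\<lambda>x. (u x) ^ 4)"
  using Sobolev_embedding[OF assms, of 4] by (simp add: powr_numeral)

section \<open>The logarithmic interaction\<close>

definition log_weight :: "plane \<Rightarrow> real" where
  "log_weight x = 1 + ln (1 + norm x)"

text \<open>The negative part of the logarithm, which carries the singularity of the kernel.\<close>

definition log_singularity :: "plane \<Rightarrow> real" where
  "log_singularity z = (if norm z < 1 then - ln (norm z) else 0)"

lemma log_weight_ge_1: "log_weight x \<ge> 1"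
  by (simp add: log_weight_def)

lemma log_weight_measurable [measurable]: "log_weight \<in> borel_measurable borel"
  unfolding log_weight_def[abs_def] by measurable

lemma log_singularity_measurable [measurable]: "log_singularity \<in> borel_measurable borel"
  unfolding log_singularity_def[abs_def] by measurable

text \<open>At distance at least one, \<open>|x - y| \<le> (1 + |x|) (1 + |y|)\<close> splits the logarithm into functions of
  \<open>x\<close> and \<open>y\<close> alone.\<close>

lemma abs_ln_norm_diff_le:
  "\<bar>ln (norm (x - y))\<bar> \<le> ln (1 + norm x) + ln (1 + norm y) + log_singularity (x - y)"
proof (cases "norm (x - y) < 1")
  case True
  have "0 \<le> ln (1 + norm x)" "0 \<le> ln (1 + norm y)" by simp_all
  moreover have "ln (norm (x - y)) \<le> 0"
    using True by (cases "x = y") (auto simp: ln_le_zero_iff)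
  ultimately show ?thesis using True by (simp add: log_singularity_def)
next
  case False
  have "norm (x - y) \<le> norm x + norm y" by (rule norm_triangle_ineq4)
  also have "\<dots> \<le> (1 + norm x) * (1 + norm y)" by (simp add: algebra_simps)
  finally have "ln (norm (x - y)) \<le> ln ((1 + norm x) * (1 + norm y))" using False by (intro ln_mono) auto
  also have "\<dots> = ln (1 + norm x) + ln (1 + norm y)" by (intro ln_mult_pos) (auto simp: add_pos_nonneg)
  finally show ?thesis using False by (simp add: log_singularity_def)
qed

lemma emeasure_cball_le: "r \<ge> 0 \<Longrightarrow> emeasure lborel (cball (0 :: plane) r) \<le> ennreal (4 * r\<^sup>2)"
proof -
  assume r: "r \<ge> 0"
  have "cball (0 :: plane) r \<subseteq> cbox (- (r *\<^sub>R 1)) (r *\<^sub>R 1)"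
  proof
    fix x :: plane assume "x \<in> cball 0 r"
    then have "\<bar>x $ i\<bar> \<le> r" for i using component_le_norm_cart[of x i] by simp
    then show "x \<in> cbox (- (r *\<^sub>R 1)) (r *\<^sub>R 1)" by (auto simp: mem_box_cart abs_le_iff minus_le_iff)
  qed
  then have "emeasure lborel (cball (0 :: plane) r) \<le> emeasure lborel (cbox (- (r *\<^sub>R 1) :: plane) (r *\<^sub>R 1))"
    by (intro emeasure_mono) auto
  also have "\<dots> = ennreal (\<Prod>b\<in>(Basis :: plane set). (r *\<^sub>R 1 - (- (r *\<^sub>R 1))) \<bullet> b)"
    using r by (intro emeasure_lborel_cbox) (auto simp: Basis_vec_def inner_axis)
  also have "(\<Prod>b\<in>(Basis :: plane set). (r *\<^sub>R 1 - (- (r *\<^sub>R 1))) \<bullet> b) = (\<Prod>b\<in>(Basis :: plane set). 2 * r)"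
    by (rule prod.cong) (auto simp: Basis_vec_def inner_axis)
  also have "\<dots> = 4 * r\<^sup>2" by (simp add: power_mult_distrib)
  finally show ?thesis .
qed

lemma sum_odd_eq_square: "(\<Sum>m<n. 2 * real m + 1) = (real n)\<^sup>2"
  by (induction n) (auto simp: power2_eq_square algebra_simps)

text \<open>On the annulus where \<open>-ln |z|\<close> lies between \<open>n\<close> and \<open>n + 1\<close> the square of the
  singularity is at most \<open>1 + 3 + \<dots> + (2n + 1)\<close>, which is a sum over the discs of radius
  \<open>e\<^sup>-\<^sup>m\<close> that contain \<open>z\<close>.\<close>

lemma log_singularity_square_integrable: "integrable lborel (\<lambda>z. (log_singularity z)\<^sup>2)"
proof -
  let ?t = "\<lambda>n z. ennreal (2 * real n + 1) * indicator (cball (0 :: plane) (exp (- real n))) z"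
  have pt: "ennreal ((log_singularity z)\<^sup>2) \<le> (\<Sum>n. ?t n z)" for z
  proof (cases "z = 0 \<or> norm z \<ge> 1")
    case True
    then have "log_singularity z = 0" by (auto simp: log_singularity_def)
    then show ?thesis by simp
  next
    case False
    define K where "K = - ln (norm z)"
    have K: "log_singularity z = K" "norm z = exp (- K)" "K > 0"
      using False by (auto simp: K_def log_singularity_def)
    define n where "n = nat \<lfloor>K\<rfloor>"
    have n: "real n \<le> K" "K < real n + 1" unfolding n_def using K(3) by linarith+
    have in_ball: "z \<in> cball 0 (exp (- real m))" if "m < Suc n" for m
    proof -
      have "real m \<le> K" using that n(1) by linarith
      then show ?thesis using K(2) by simp
    qed
    have "K\<^sup>2 \<le> (real (Suc n))\<^sup>2" using n K(3) by (intro power_mono) auto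
    also have "\<dots> = (\<Sum>m<Suc n. 2 * real m + 1)" by (simp only: sum_odd_eq_square)
    finally have "ennreal (K\<^sup>2) \<le> ennreal (\<Sum>m<Suc n. 2 * real m + 1)" by (rule ennreal_leI)
    also have "\<dots> = (\<Sum>m<Suc n. ennreal (2 * real m + 1))" by (rule sum_ennreal[symmetric]) simp
    also have "\<dots> = (\<Sum>m<Suc n. ?t m z)" using in_ball by (intro sum.cong) auto
    also have "\<dots> \<le> (\<Sum>m. ?t m z)" by (rule sum_le_suminf) auto
    finally show ?thesis by (simp add: K(1))
  qed
  have summ: "summable (\<lambda>n. (2 * real n + 1) * (4 * (exp (- real n))\<^sup>2))"
  proof -
    have "(\<lambda>n. (2 * real n + 1) * (4 * (exp (- real n))\<^sup>2) * 2 ^ n) \<longlonglongrightarrow> 0" by real_asymp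
    then have "\<forall>\<^sub>F n in sequentially. (2 * real n + 1) * (4 * (exp (- real n))\<^sup>2) * 2 ^ n < 1"
      by (rule order_tendstoD) simp
    then have ev: "\<forall>\<^sub>F n in sequentially. norm ((2 * real n + 1) * (4 * (exp (- real n))\<^sup>2)) \<le> (1 / 2) ^ n"
    proof eventually_elim
      case (elim n)
      have "norm ((2 * real n + 1) * (4 * (exp (- real n))\<^sup>2)) = (2 * real n + 1) * (4 * (exp (- real n))\<^sup>2)"
        by (simp add: abs_mult)
      also have "\<dots> \<le> 1 / 2 ^ n" using elim by (simp add: pos_le_divide_eq)
      finally show ?case by (simp add: power_one_over)
    qed
    show ?thesis by (rule summable_comparison_test_ev[OF ev]) simp
  qed
  have "(\<integral>\<^sup>+z. ennreal ((log_singularity z)\<^sup>2) \<partial>lborel) \<le> (\<integral>\<^sup>+z. (\<Sum>n. ?t n z) \<partial>lborel)"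
    by (intro nn_integral_mono pt)
  also have "\<dots> = (\<Sum>n. \<integral>\<^sup>+z. ?t n z \<partial>lborel)" 
    by (rule nn_integral_suminf, intro borel_measurable_times_ennreal borel_measurable_const borel_measurable_indicator) simp
  also have "\<dots> \<le> (\<Sum>n. ennreal ((2 * real n + 1) * (4 * (exp (- real n))\<^sup>2)))"
  proof (intro suminf_le)
    fix n
    have "(\<integral>\<^sup>+z. ?t n z \<partial>lborel) = ennreal (2 * real n + 1) * emeasure lborel (cball (0 :: plane) (exp (- real n)))"
      by (simp add: nn_integral_cmult_indicator)
    also have "\<dots> \<le> ennreal (2 * real n + 1) * ennreal (4 * (exp (- real n))\<^sup>2)"
      by (intro mult_left_mono emeasure_cball_le) auto
    also have "\<dots> = ennreal ((2 * real n + 1) * (4 * (exp (- real n))\<^sup>2))"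
      by (rule ennreal_mult[symmetric]) auto
    finally show "(\<integral>\<^sup>+z. ?t n z \<partial>lborel) \<le> ennreal ((2 * real n + 1) * (4 * (exp (- real n))\<^sup>2))" .
  qed auto
  also have "\<dots> = ennreal (\<Sum>n. (2 * real n + 1) * (4 * (exp (- real n))\<^sup>2))"
    by (rule suminf_ennreal2[OF _ summ]) simp
  also have "\<dots> < \<infinity>" by simp
  finally show ?thesis by (intro integrableI_bounded) auto
qed

text \<open>The integrability that makes all interaction integrals below converge; the fourth power
  is what the singularity of the kernel requires.\<close>

definition interacting :: "(plane \<Rightarrow> real) \<Rightarrow> bool" where
  "interacting f \<longleftrightarrow> f \<in> L2 \<and> integrable lborel (\<lambda>x. log_weight x * (f x)\<^sup>2) \<and> integrable lborel (\<lambda>x. (f x) ^ 4)"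

text \<open>The constant in the bound for the potential of the density \<open>f\<^sup>2\<close>.\<close>

definition interaction_const :: "(plane \<Rightarrow> real) \<Rightarrow> real" where
  "interaction_const f = (LINT x|lborel. log_weight x * (f x)\<^sup>2)
     + ((LINT z|lborel. (log_singularity z)\<^sup>2) + (LINT x|lborel. (f x) ^ 4)) / 2"

lemma interaction_const_nonneg: "0 \<le> interaction_const f"
  unfolding interaction_const_def
  using log_weight_ge_1 by (intro add_nonneg_nonneg divide_nonneg_nonneg integral_nonneg_AE AE_I2 mult_nonneg_nonneg)
    (auto intro: order_trans[OF zero_le_one])

lemma interacting_L2: "interacting f \<Longrightarrow> f \<in> L2" by (simp add: interacting_def)

lemma interacting_measurable: "interacting f \<Longrightarrow> f \<in> borel_measurable borel"
  by (simp add: interacting_def L2_measurable_borel)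

lemma interacting_weighted: "interacting f \<Longrightarrow> integrable lborel (\<lambda>x. log_weight x * (f x)\<^sup>2)"
  by (simp add: interacting_def)

lemma interacting_scale: "interacting f \<Longrightarrow> interacting (\<lambda>x. c * f x)"
  using integrable_mult_right[of "c\<^sup>2" lborel "\<lambda>x. log_weight x * (f x)\<^sup>2"]
  by (auto simp: interacting_def L2_scale power_mult_distrib mult.left_commute[of "log_weight _"])

lemma power4_add_le: "((a::real) + b) ^ 4 \<le> 8 * a ^ 4 + 8 * b ^ 4"
proof -
  have s: "(x + y)\<^sup>2 \<le> 2 * x\<^sup>2 + 2 * y\<^sup>2" for x y :: real
    using sum_squares_bound[of x y] by (simp add: power2_sum)
  have "(a + b) ^ 4 = ((a + b)\<^sup>2)\<^sup>2" by simp
  also have "\<dots> \<le> (2 * a\<^sup>2 + 2 * b\<^sup>2)\<^sup>2" by (intro power_mono s) auto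
  also have "\<dots> \<le> 2 * (2 * a\<^sup>2)\<^sup>2 + 2 * (2 * b\<^sup>2)\<^sup>2" by (rule s)
  finally show ?thesis by (simp add: power_mult_distrib)
qed

lemma interacting_add:
  assumes "interacting f" "interacting g" shows "interacting (\<lambda>x. f x + g x)"
  unfolding interacting_def
proof (intro conjI)
  note [measurable] = interacting_measurable[OF assms(1)] interacting_measurable[OF assms(2)]
  show "(\<lambda>x. f x + g x) \<in> L2" using assms L2_add interacting_L2 by blast
  show "integrable lborel (\<lambda>x. log_weight x * (f x + g x)\<^sup>2)"
  proof (rule Bochner_Integration.integrable_bound)
    show "integrable lborel (\<lambda>x. 2 * (log_weight x * (f x)\<^sup>2) + 2 * (log_weight x * (g x)\<^sup>2))"
      using assms by (simp add: interacting_def)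
    have "norm (log_weight x * (f x + g x)\<^sup>2) \<le> norm (2 * (log_weight x * (f x)\<^sup>2) + 2 * (log_weight x * (g x)\<^sup>2))" for x
    proof -
      have "(f x + g x)\<^sup>2 \<le> 2 * (f x)\<^sup>2 + 2 * (g x)\<^sup>2"
        using sum_squares_bound[of "f x" "g x"] by (simp add: power2_sum)
      then have "log_weight x * (f x + g x)\<^sup>2 \<le> log_weight x * (2 * (f x)\<^sup>2 + 2 * (g x)\<^sup>2)"
        using log_weight_ge_1[of x] by (intro mult_left_mono) auto
      then show ?thesis using log_weight_ge_1[of x] by (simp add: distrib_left mult.left_commute)
    qed
    then show "AE x in lborel. norm (log_weight x * (f x + g x)\<^sup>2) \<le> norm (2 * (log_weight x * (f x)\<^sup>2) + 2 * (log_weight x * (g x)\<^sup>2))"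
      by simp
  qed measurable
  show "integrable lborel (\<lambda>x. (f x + g x) ^ 4)"
  proof (rule Bochner_Integration.integrable_bound)
    show "integrable lborel (\<lambda>x. 8 * (f x) ^ 4 + 8 * (g x) ^ 4)" using assms by (simp add: interacting_def)
    show "AE x in lborel. norm ((f x + g x) ^ 4) \<le> norm (8 * (f x) ^ 4 + 8 * (g x) ^ 4)"
      using power4_add_le by simp
  qed measurable
qed

lemma interacting_combination:
  "interacting f \<Longrightarrow> interacting g \<Longrightarrow> interacting (\<lambda>x. f x + c * g x)"
  by (intro interacting_add interacting_scale)

text \<open>The regular part of the kernel is a sum of functions of \<open>x\<close> and of \<open>y\<close>; its singular part \<open>k\<close> is
  paired with \<open>f\<^sup>2\<close> through \<open>2kf\<^sup>2 \<le> k\<^sup>2 + f\<^sup>4\<close>.\<close>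

lemma log_potential_bound:
  assumes f: "interacting f"
  shows "(\<integral>\<^sup>+y. ennreal (\<bar>ln (norm (x - y))\<bar> * (f y)\<^sup>2) \<partial>lborel) \<le> ennreal (log_weight x * interaction_const f)"
proof -
  note [measurable] = interacting_measurable[OF f]
  let ?k = "\<lambda>y. (log_singularity (x - y))\<^sup>2"
  have kk: "integrable lborel ?k" "(LINT y|lborel. ?k y) = (LINT z|lborel. (log_singularity z)\<^sup>2)"
  proof -
    have sym: "log_singularity (x - y) = log_singularity (y + (- x))" for y
      by (simp add: log_singularity_def norm_minus_commute)
    have m: "(\<lambda>z. (log_singularity z)\<^sup>2) \<in> borel_measurable borel" by measurable
    show "integrable lborel ?k" "(LINT y|lborel. ?k y) = (LINT z|lborel. (log_singularity z)\<^sup>2)"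
      unfolding sym using lborel_translate[OF m, of "- x"] log_singularity_square_integrable by auto
  qed
  define D where "D y = ln (1 + norm x) * (f y)\<^sup>2 + (log_weight y - 1) * (f y)\<^sup>2 + (?k y + (f y) ^ 4) / 2" for y
  have i: "integrable lborel (\<lambda>y. (f y)\<^sup>2)" "integrable lborel (\<lambda>y. log_weight y * (f y)\<^sup>2)" "integrable lborel (\<lambda>y. (f y) ^ 4)"
    using f L2_square_integrable by (auto simp: interacting_def)
  have iD: "integrable lborel D" unfolding D_def[abs_def] left_diff_distrib using i kk by simp
  have pt: "\<bar>ln (norm (x - y))\<bar> * (f y)\<^sup>2 \<le> D y" for y
  proof -
    have "2 * log_singularity (x - y) * (f y)\<^sup>2 \<le> ?k y + ((f y)\<^sup>2)\<^sup>2" by (rule sum_squares_bound)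
    then have "log_singularity (x - y) * (f y)\<^sup>2 \<le> (?k y + (f y) ^ 4) / 2" by simp
    moreover have "\<bar>ln (norm (x - y))\<bar> * (f y)\<^sup>2 \<le> (ln (1 + norm x) + ln (1 + norm y) + log_singularity (x - y)) * (f y)\<^sup>2"
      by (intro mult_right_mono abs_ln_norm_diff_le) auto
    ultimately show ?thesis
      unfolding D_def log_weight_def distrib_right add_diff_cancel_left' by linarith
  qed
  have "(\<integral>\<^sup>+y. ennreal (\<bar>ln (norm (x - y))\<bar> * (f y)\<^sup>2) \<partial>lborel) \<le> (\<integral>\<^sup>+y. ennreal (D y) \<partial>lborel)"
    by (intro nn_integral_mono ennreal_leI pt)
  also have "\<dots> = ennreal (LINT y|lborel. D y)"
    using pt by (intro nn_integral_eq_integral iD AE_I2) (meson abs_ge_zero mult_nonneg_nonneg order_trans zero_le_power2)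
  also have "\<dots> \<le> ennreal (log_weight x * interaction_const f)"
  proof (rule ennreal_leI)
    let ?I = "LINT y|lborel. (f y)\<^sup>2" and ?W = "LINT y|lborel. log_weight y * (f y)\<^sup>2"
    define H where "H = ((LINT z|lborel. (log_singularity z)\<^sup>2) + (LINT y|lborel. (f y) ^ 4)) / 2"
    have H0: "0 \<le> H" by (simp add: H_def)
    have IW: "?I \<le> ?W"
    proof (rule integral_mono[OF i(1,2)])
      show "(f y)\<^sup>2 \<le> log_weight y * (f y)\<^sup>2" for y
        using mult_right_mono[OF log_weight_ge_1[of y], of "(f y)\<^sup>2"] by simp
    qed
    have "(LINT y|lborel. D y) = ln (1 + norm x) * ?I + (?W - ?I) + H"
      unfolding D_def left_diff_distrib H_def using i kk by simp
    also have "\<dots> \<le> ln (1 + norm x) * ?W + ?W + log_weight x * H"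
    proof -
      have "ln (1 + norm x) * ?I \<le> ln (1 + norm x) * ?W" using IW by (intro mult_left_mono) auto
      moreover have "1 * H \<le> log_weight x * H" using log_weight_ge_1 H0 by (intro mult_right_mono) auto
      moreover have "0 \<le> ?I" by simp
      ultimately show ?thesis by linarith
    qed
    also have "\<dots> = log_weight x * interaction_const f"
      by (simp add: interaction_const_def H_def log_weight_def algebra_simps)
    finally show "(LINT y|lborel. D y) \<le> log_weight x * interaction_const f" .
  qed
  finally show ?thesis .
qed

lemma interaction_pair:
  assumes v: "v \<in> borel_measurable borel" "integrable lborel (\<lambda>x. log_weight x * (v x)\<^sup>2)" and f: "interacting f"
  shows "integrable (lborel \<Otimes>\<^sub>M lborel) (\<lambda>(x, y). (v x)\<^sup>2 * (f y)\<^sup>2 * \<bar>ln (norm (x - y))\<bar>)"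
    and "(LINT (x, y)|(lborel \<Otimes>\<^sub>M lborel). (v x)\<^sup>2 * (f y)\<^sup>2 * \<bar>ln (norm (x - y))\<bar>)
       \<le> interaction_const f * (LINT x|lborel. log_weight x * (v x)\<^sup>2)"
proof -
  note [measurable] = interacting_measurable[OF f] v(1)
  let ?h = "\<lambda>(x, y). (v x)\<^sup>2 * (f y)\<^sup>2 * \<bar>ln (norm (x - y))\<bar>"
  let ?W = "LINT x|lborel. log_weight x * (v x)\<^sup>2"
  have w0: "0 \<le> log_weight x * (v x)\<^sup>2" for x using log_weight_ge_1[of x] by simp
  have m: "?h \<in> borel_measurable (lborel \<Otimes>\<^sub>M lborel)" by measurable
  have "(\<integral>\<^sup>+p. ennreal (?h p) \<partial>(lborel \<Otimes>\<^sub>M lborel)) = (\<integral>\<^sup>+x. \<integral>\<^sup>+y. ennreal (?h (x, y)) \<partial>lborel \<partial>lborel)"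
    by (subst lborel.nn_integral_fst[symmetric]) (use m in auto)
  also have "\<dots> \<le> (\<integral>\<^sup>+x. ennreal (interaction_const f * (log_weight x * (v x)\<^sup>2)) \<partial>lborel)"
  proof (intro nn_integral_mono)
    fix x
    have "(\<integral>\<^sup>+y. ennreal (?h (x, y)) \<partial>lborel) = (\<integral>\<^sup>+y. ennreal ((v x)\<^sup>2) * ennreal (\<bar>ln (norm (x - y))\<bar> * (f y)\<^sup>2) \<partial>lborel)"
      by (rule nn_integral_cong) (simp add: ennreal_mult[symmetric] mult_ac)
    also have "\<dots> = ennreal ((v x)\<^sup>2) * (\<integral>\<^sup>+y. ennreal (\<bar>ln (norm (x - y))\<bar> * (f y)\<^sup>2) \<partial>lborel)"
      by (rule nn_integral_cmult) measurable
    also have "\<dots> \<le> ennreal ((v x)\<^sup>2) * ennreal (log_weight x * interaction_const f)"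
      by (intro mult_left_mono log_potential_bound f) auto
    also have "\<dots> = ennreal (interaction_const f * (log_weight x * (v x)\<^sup>2))"
      using log_weight_ge_1[of x] interaction_const_nonneg[of f] by (simp add: ennreal_mult[symmetric] mult_ac)
    finally show "(\<integral>\<^sup>+y. ennreal (?h (x, y)) \<partial>lborel) \<le> ennreal (interaction_const f * (log_weight x * (v x)\<^sup>2))" .
  qed
  also have "\<dots> = ennreal (interaction_const f * ?W)"
  proof -
    have "integrable lborel (\<lambda>x. interaction_const f * (log_weight x * (v x)\<^sup>2))" using v(2) by simp
    then show ?thesis using w0 interaction_const_nonneg[of f] by (subst nn_integral_eq_integral) auto
  qed
  finally have *: "(\<integral>\<^sup>+p. ennreal (?h p) \<partial>(lborel \<Otimes>\<^sub>M lborel)) \<le> ennreal (interaction_const f * ?W)" .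
  have h0: "0 \<le> ?h p" for p by (simp add: case_prod_unfold)
  show i: "integrable (lborel \<Otimes>\<^sub>M lborel) ?h"
  proof (rule integrableI_bounded[OF m])
    have "(\<integral>\<^sup>+p. ennreal (norm (?h p)) \<partial>(lborel \<Otimes>\<^sub>M lborel)) = (\<integral>\<^sup>+p. ennreal (?h p) \<partial>(lborel \<Otimes>\<^sub>M lborel))"
      using h0 by (intro nn_integral_cong) (simp del: split_paired_All)
    then show "(\<integral>\<^sup>+p. ennreal (norm (?h p)) \<partial>(lborel \<Otimes>\<^sub>M lborel)) < \<infinity>"
      using * by (simp add: le_less_trans[OF _ ennreal_less_top])
  qed
  have "ennreal (LINT p|(lborel \<Otimes>\<^sub>M lborel). ?h p) \<le> ennreal (interaction_const f * ?W)"
    using * nn_integral_eq_integral[OF i AE_I2[OF h0]] by simp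
  moreover have "0 \<le> interaction_const f * ?W"
    using w0 interaction_const_nonneg[of f] by (intro mult_nonneg_nonneg integral_nonneg_AE) auto
  ultimately show "(LINT (x, y)|(lborel \<Otimes>\<^sub>M lborel). (v x)\<^sup>2 * (f y)\<^sup>2 * \<bar>ln (norm (x - y))\<bar>) \<le> interaction_const f * ?W"
    by (simp add: ennreal_le_iff)
qed

lemma interaction_pair_swapped:
  assumes v: "v \<in> borel_measurable borel" "integrable lborel (\<lambda>x. log_weight x * (v x)\<^sup>2)" and f: "interacting f"
  shows "integrable (lborel \<Otimes>\<^sub>M lborel) (\<lambda>(x, y). (f x)\<^sup>2 * (v y)\<^sup>2 * \<bar>ln (norm (x - y))\<bar>)"
    and "(LINT (x, y)|(lborel \<Otimes>\<^sub>M lborel). (f x)\<^sup>2 * (v y)\<^sup>2 * \<bar>ln (norm (x - y))\<bar>)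
       \<le> interaction_const f * (LINT x|lborel. log_weight x * (v x)\<^sup>2)"
proof -
  note [measurable] = interacting_measurable[OF f] v(1)
  let ?h = "\<lambda>(x, y). (v x)\<^sup>2 * (f y)\<^sup>2 * \<bar>ln (norm (x - y))\<bar>"
  have e: "(\<lambda>(x, y). (f x)\<^sup>2 * (v y)\<^sup>2 * \<bar>ln (norm (x - y))\<bar>) = (\<lambda>(x, y). ?h (y, x))"
    by (auto simp: norm_minus_commute mult_ac)
  show "integrable (lborel \<Otimes>\<^sub>M lborel) (\<lambda>(x, y). (f x)\<^sup>2 * (v y)\<^sup>2 * \<bar>ln (norm (x - y))\<bar>)"
    unfolding e by (rule lborel_pair.integrable_product_swap[OF interaction_pair(1)[OF assms]])
  have m: "?h \<in> borel_measurable (lborel \<Otimes>\<^sub>M lborel)" by measurable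
  show "(LINT (x, y)|(lborel \<Otimes>\<^sub>M lborel). (f x)\<^sup>2 * (v y)\<^sup>2 * \<bar>ln (norm (x - y))\<bar>)
       \<le> interaction_const f * (LINT x|lborel. log_weight x * (v x)\<^sup>2)"
    unfolding e using lborel_pair.integral_product_swap[OF m] interaction_pair(2)[OF assms] by simp
qed

text \<open>Both products are dominated by sums of squares.\<close>

lemma interaction_integrable:
  assumes "interacting f1" "interacting f2" "interacting f3" "interacting f4"
  shows "integrable (lborel \<Otimes>\<^sub>M lborel) (\<lambda>(x, y). f1 x * f2 x * (f3 y * f4 y) * ln (norm (x - y)))"
proof (rule Bochner_Integration.integrable_bound)
  note [measurable] = assms[THEN interacting_measurable]
  let ?q = "\<lambda>f g (x, y). (f x)\<^sup>2 * (g y)\<^sup>2 * \<bar>ln (norm (x - y))\<bar>"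
  have i: "integrable (lborel \<Otimes>\<^sub>M lborel) (?q f g)" if "interacting f" "interacting g" for f g
    using interaction_pair(1)[OF interacting_measurable[OF that(1)] interacting_weighted[OF that(1)] that(2)] .
  show "integrable (lborel \<Otimes>\<^sub>M lborel) (\<lambda>p. ?q f1 f3 p + ?q f1 f4 p + (?q f2 f3 p + ?q f2 f4 p))"
    using i assms by (intro Bochner_Integration.integrable_add)
  show "(\<lambda>(x, y). f1 x * f2 x * (f3 y * f4 y) * ln (norm (x - y))) \<in> borel_measurable (lborel \<Otimes>\<^sub>M lborel)"
    by measurable
  have ab: "\<bar>a * b\<bar> \<le> a\<^sup>2 + b\<^sup>2" for a b :: real
    using sum_squares_bound[of "\<bar>a\<bar>" "\<bar>b\<bar>"] mult_nonneg_nonneg[OF abs_ge_zero abs_ge_zero, of a b]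
    unfolding abs_mult power2_abs mult.assoc by linarith
  have "\<bar>f1 x * f2 x * (f3 y * f4 y) * ln (norm (x - y))\<bar> \<le> \<bar>?q f1 f3 (x, y) + ?q f1 f4 (x, y) + (?q f2 f3 (x, y) + ?q f2 f4 (x, y))\<bar>" for x y
  proof -
    have "\<bar>f1 x * f2 x * (f3 y * f4 y) * ln (norm (x - y))\<bar> = \<bar>f1 x * f2 x\<bar> * \<bar>f3 y * f4 y\<bar> * \<bar>ln (norm (x - y))\<bar>"
      by (simp add: abs_mult)
    also have "\<dots> \<le> ((f1 x)\<^sup>2 + (f2 x)\<^sup>2) * ((f3 y)\<^sup>2 + (f4 y)\<^sup>2) * \<bar>ln (norm (x - y))\<bar>"
      by (intro mult_right_mono mult_mono ab) auto
    also have "\<dots> = ?q f1 f3 (x, y) + ?q f1 f4 (x, y) + (?q f2 f3 (x, y) + ?q f2 f4 (x, y))"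
      by (simp add: algebra_simps)
    finally show ?thesis by linarith
  qed
  then show "AE p in lborel \<Otimes>\<^sub>M lborel. norm (case p of (x, y) \<Rightarrow> f1 x * f2 x * (f3 y * f4 y) * ln (norm (x - y)))
     \<le> norm (?q f1 f3 p + ?q f1 f4 p + (?q f2 f3 p + ?q f2 f4 p))"
    by (intro AE_I2) auto
qed

definition interaction :: "(plane \<Rightarrow> real) \<Rightarrow> real" where
  "interaction u = (LINT (x, y)|(lborel \<Otimes>\<^sub>M lborel). \<bar>u x\<bar>\<^sup>2 * \<bar>u y\<bar>\<^sup>2 * ln (norm (x - y)))"

lemma interaction_integrable':
  "interacting u \<Longrightarrow> integrable (lborel \<Otimes>\<^sub>M lborel) (\<lambda>(x, y). \<bar>u x\<bar>\<^sup>2 * \<bar>u y\<bar>\<^sup>2 * ln (norm (x - y)))"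
  using interaction_integrable[of u u u u] by (simp add: power2_eq_square)

text \<open>Half of the derivative of the interaction at \<open>u\<close> in the direction \<open>\<psi>\<close>.\<close>

definition interaction_variation :: "(plane \<Rightarrow> real) \<Rightarrow> (plane \<Rightarrow> real) \<Rightarrow> real" where
  "interaction_variation u \<psi> = (LINT (x, y)|(lborel \<Otimes>\<^sub>M lborel).
     (u x * \<psi> x * (u y * u y) + u x * u x * (u y * \<psi> y)) * ln (norm (x - y)))"

lemma interaction_variation_integrable:
  assumes "interacting u" "interacting \<psi>"
  shows "integrable (lborel \<Otimes>\<^sub>M lborel) (\<lambda>(x, y).
     (u x * \<psi> x * (u y * u y) + u x * u x * (u y * \<psi> y)) * ln (norm (x - y)))"
  using Bochner_Integration.integrable_add[OF interaction_integrable[of u \<psi> u u] interaction_integrable[of u u u \<psi>]] assms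
  by (simp add: case_prod_unfold distrib_right)

text \<open>Along a line the interaction is a polynomial of degree four.\<close>

lemma interaction_has_derivative:
  assumes u: "interacting u" and \<psi>: "interacting \<psi>"
  shows "((\<lambda>s. interaction (\<lambda>x. u x + s * \<psi> x)) has_real_derivative 2 * interaction_variation u \<psi>) (at 0)"
proof -
  let ?M = "(lborel \<Otimes>\<^sub>M lborel) :: (plane \<times> plane) measure"
  define J where "J f1 f2 f3 f4 = (LINT (x, y)|?M. f1 x * f2 x * (f3 y * f4 y) * ln (norm (x - y)))" for f1 f2 f3 f4 :: "plane \<Rightarrow> real"
  note i = interaction_integrable
  have exp: "interaction (\<lambda>x. u x + s * \<psi> x) = J u u u u + s * (2 * interaction_variation u \<psi>)
     + s\<^sup>2 * (J u u \<psi> \<psi> + 4 * J u \<psi> u \<psi> + J \<psi> \<psi> u u) + s ^ 3 * (2 * J u \<psi> \<psi> \<psi> + 2 * J \<psi> \<psi> u \<psi>) + s ^ 4 * J \<psi> \<psi> \<psi> \<psi>" for s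
  proof -
    have "interaction (\<lambda>x. u x + s * \<psi> x) = (LINT p|?M.
       (\<lambda>(x, y). u x * u x * (u y * u y) * ln (norm (x - y))) p
     + s * (2 * (\<lambda>(x, y). (u x * \<psi> x * (u y * u y) + u x * u x * (u y * \<psi> y)) * ln (norm (x - y))) p)
     + s\<^sup>2 * ((\<lambda>(x, y). u x * u x * (\<psi> y * \<psi> y) * ln (norm (x - y))) p
          + 4 * (\<lambda>(x, y). u x * \<psi> x * (u y * \<psi> y) * ln (norm (x - y))) p
          + (\<lambda>(x, y). \<psi> x * \<psi> x * (u y * u y) * ln (norm (x - y))) p)
     + s ^ 3 * (2 * (\<lambda>(x, y). u x * \<psi> x * (\<psi> y * \<psi> y) * ln (norm (x - y))) p
          + 2 * (\<lambda>(x, y). \<psi> x * \<psi> x * (u y * \<psi> y) * ln (norm (x - y))) p)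
     + s ^ 4 * (\<lambda>(x, y). \<psi> x * \<psi> x * (\<psi> y * \<psi> y) * ln (norm (x - y))) p)"
      unfolding interaction_def
      by (rule Bochner_Integration.integral_cong) (auto simp: power2_eq_square power3_eq_cube power4_eq_xxxx algebra_simps)
    also have "\<dots> = J u u u u + s * (2 * interaction_variation u \<psi>)
     + s\<^sup>2 * (J u u \<psi> \<psi> + 4 * J u \<psi> u \<psi> + J \<psi> \<psi> u u) + s ^ 3 * (2 * J u \<psi> \<psi> \<psi> + 2 * J \<psi> \<psi> u \<psi>) + s ^ 4 * J \<psi> \<psi> \<psi> \<psi>"
      unfolding J_def interaction_variation_def
      using i[OF u u u u] interaction_variation_integrable[OF u \<psi>] i[OF u u \<psi> \<psi>] i[OF u \<psi> u \<psi>] i[OF \<psi> \<psi> u u]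
        i[OF u \<psi> \<psi> \<psi>] i[OF \<psi> \<psi> u \<psi>] i[OF \<psi> \<psi> \<psi> \<psi>]
      by (simp add: Bochner_Integration.integrable_add integrable_mult_right)
    finally show ?thesis .
  qed
  show ?thesis unfolding exp by (auto intro!: derivative_eq_intros)
qed

text \<open>With \<open>v = V - U\<close> and primes for values at \<open>y\<close>,
  \<open>2(UVU'\<^sup>2 + U\<^sup>2U'V') = 3U\<^sup>2U'\<^sup>2 + V\<^sup>2V'\<^sup>2 - (V\<^sup>2 - U\<^sup>2)(V'\<^sup>2 - U'\<^sup>2) - v\<^sup>2U'\<^sup>2 - U\<^sup>2v'\<^sup>2\<close>,
  and \<open>V\<^sup>2 - U\<^sup>2 = v (U + V)\<close>, so that the three last terms are quadratic in \<open>v\<close>. The weight enters through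
  the bound for the logarithmic potential of \<open>U\<^sup>2\<close> and \<open>V\<^sup>2\<close>.\<close>

lemma interaction_variation_expansion:
  assumes U: "interacting U" and V: "interacting V"
  shows "\<bar>interaction_variation U V - (3 / 2 * interaction U + 1 / 2 * interaction V)\<bar>
     \<le> 2 * (interaction_const U + interaction_const V) * (LINT x|lborel. log_weight x * (V x - U x)\<^sup>2)"
proof -
  let ?M = "(lborel \<Otimes>\<^sub>M lborel) :: (plane \<times> plane) measure"
  define v where "v x = V x - U x" for x
  have v: "interacting v" using interacting_combination[OF V U, of "-1"] by (simp add: v_def[abs_def])
  let ?W = "LINT x|lborel. log_weight x * (v x)\<^sup>2"
  note vm = interacting_measurable[OF v] and vw = interacting_weighted[OF v]
  define q :: "(plane \<Rightarrow> real) \<Rightarrow> (plane \<Rightarrow> real) \<Rightarrow> plane \<times> plane \<Rightarrow> real"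
    where "q f g = (\<lambda>(x, y). (f x)\<^sup>2 * (g y)\<^sup>2 * \<bar>ln (norm (x - y))\<bar>)" for f g
  define e where "e = (\<lambda>(x, y). (U x * V x * (U y * U y) + U x * U x * (U y * V y)) * ln (norm (x - y)))"
  define n where "n f = (\<lambda>(x, y). \<bar>f x\<bar>\<^sup>2 * \<bar>f y\<bar>\<^sup>2 * ln (norm (x - y)))" for f :: "plane \<Rightarrow> real"
  note int = interaction_variation_integrable[OF U V, folded e_def]
    interaction_integrable'[OF U, folded n_def] interaction_integrable'[OF V, folded n_def]
  note qi = interaction_pair(1)[OF vm vw U, folded q_def] interaction_pair(1)[OF vm vw V, folded q_def]
    interaction_pair_swapped(1)[OF vm vw U, folded q_def] interaction_pair_swapped(1)[OF vm vw V, folded q_def]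
  note qb = interaction_pair(2)[OF vm vw U, folded q_def] interaction_pair(2)[OF vm vw V, folded q_def]
    interaction_pair_swapped(2)[OF vm vw U, folded q_def] interaction_pair_swapped(2)[OF vm vw V, folded q_def]
  have "interaction_variation U V - (3 / 2 * interaction U + 1 / 2 * interaction V)
      = (LINT p|?M. e p - (3 / 2 * n U p + 1 / 2 * n V p))"
    unfolding interaction_variation_def interaction_def e_def[symmetric] n_def[symmetric]
    using int by simp
  also have "\<bar>\<dots>\<bar> \<le> (LINT p|?M. \<bar>e p - (3 / 2 * n U p + 1 / 2 * n V p)\<bar>)" by (rule integral_abs_bound)
  also have "\<dots> \<le> (LINT p|?M. q v U p + q v V p + (q U v p + q V v p))"
  proof (rule integral_mono)
    show "integrable ?M (\<lambda>p. \<bar>e p - (3 / 2 * n U p + 1 / 2 * n V p)\<bar>)" using int by simp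
    show "integrable ?M (\<lambda>p. q v U p + q v V p + (q U v p + q V v p))" using qi by simp
    fix p :: "plane \<times> plane" obtain x y where p: "p = (x, y)" by (cases p)
    define A B A' B' L where d: "A = U x" "B = V x" "A' = U y" "B' = V y" "L = ln (norm (x - y))"
    let ?S = "(B - A)\<^sup>2 * A'\<^sup>2 + (B - A)\<^sup>2 * B'\<^sup>2 + (A\<^sup>2 * (B' - A')\<^sup>2 + B\<^sup>2 * (B' - A')\<^sup>2)"
    define E where "E = A * B * (A' * A') + A * A * (A' * B') - (3 / 2 * (A\<^sup>2 * A'\<^sup>2) + 1 / 2 * (B\<^sup>2 * B'\<^sup>2))"
    define P where "P = (B - A) * (A' + B')"
    define Q where "Q = (B' - A') * (A + B)"
    have E: "E = - (P * Q) / 2 - ((B - A)\<^sup>2 * A'\<^sup>2 + A\<^sup>2 * (B' - A')\<^sup>2) / 2"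
      by (simp add: E_def P_def Q_def power2_eq_square field_simps)
    have "\<bar>P * Q\<bar> \<le> (P\<^sup>2 + Q\<^sup>2) / 2"
      using sum_squares_bound[of "\<bar>P\<bar>" "\<bar>Q\<bar>"] by (simp add: abs_mult mult.assoc)
    moreover have "P\<^sup>2 \<le> 2 * ((B - A)\<^sup>2 * A'\<^sup>2) + 2 * ((B - A)\<^sup>2 * B'\<^sup>2)"
    proof -
      have "(A' + B')\<^sup>2 \<le> 2 * A'\<^sup>2 + 2 * B'\<^sup>2" using sum_squares_bound[of A' B'] by (simp add: power2_sum)
      then have "(B - A)\<^sup>2 * (A' + B')\<^sup>2 \<le> (B - A)\<^sup>2 * (2 * A'\<^sup>2 + 2 * B'\<^sup>2)" by (rule mult_left_mono) simp
      then show ?thesis unfolding P_def power_mult_distrib by (simp add: distrib_left mult.left_commute)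
    qed
    moreover have "Q\<^sup>2 \<le> 2 * (A\<^sup>2 * (B' - A')\<^sup>2) + 2 * (B\<^sup>2 * (B' - A')\<^sup>2)"
    proof -
      have "(A + B)\<^sup>2 \<le> 2 * A\<^sup>2 + 2 * B\<^sup>2" using sum_squares_bound[of A B] by (simp add: power2_sum)
      then have "(A + B)\<^sup>2 * (B' - A')\<^sup>2 \<le> (2 * A\<^sup>2 + 2 * B\<^sup>2) * (B' - A')\<^sup>2" by (rule mult_right_mono) simp
      then show ?thesis unfolding Q_def power_mult_distrib distrib_right by (simp only: mult_ac)
    qed
    moreover have "0 \<le> (B - A)\<^sup>2 * A'\<^sup>2" "0 \<le> A\<^sup>2 * (B' - A')\<^sup>2" "0 \<le> (B - A)\<^sup>2 * B'\<^sup>2" "0 \<le> B\<^sup>2 * (B' - A')\<^sup>2"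
      by simp_all
    moreover have "\<bar>- r / 2 - (a + c) / 2\<bar> \<le> a + b + (c + d)"
      if "\<bar>r\<bar> \<le> (s + t) / 2" "s \<le> 2 * a + 2 * b" "t \<le> 2 * c + 2 * d" "0 \<le> a" "0 \<le> c" "0 \<le> b" "0 \<le> d"
      for r s t a b c d :: real
      using that abs_ge_self[of r] abs_ge_minus_self[of r] by (intro abs_leI) (simp_all add: field_simps)
    ultimately have "\<bar>E\<bar> \<le> ?S" unfolding E by blast
    from mult_right_mono[OF this abs_ge_zero[of L]] have "\<bar>E * L\<bar> \<le> ?S * \<bar>L\<bar>" by (simp add: abs_mult)
    then show "\<bar>e p - (3 / 2 * n U p + 1 / 2 * n V p)\<bar> \<le> q v U p + q v V p + (q U v p + q V v p)"
      unfolding p e_def n_def q_def v_def prod.case d[symmetric] E_def power2_abs by (simp add: algebra_simps)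
  qed
  also have "\<dots> = ((LINT p|?M. q v U p) + (LINT p|?M. q v V p)) + ((LINT p|?M. q U v p) + (LINT p|?M. q V v p))"
    using qi by simp
  also have "\<dots> \<le> (interaction_const U * ?W + interaction_const V * ?W) + (interaction_const U * ?W + interaction_const V * ?W)"
    by (intro add_mono qb)
  finally show ?thesis by (simp add: v_def algebra_simps)
qed

section \<open>A bounded stretching of the plane in one direction\<close>

definition drift_denom :: "real \<Rightarrow> plane \<Rightarrow> real" where
  "drift_denom e x = 1 + e * ((x $ 1)\<^sup>2 + (x $ 2)\<^sup>2)"

text \<open>A truncation of \<open>x\<^sub>1\<close>, the speed of a dilation of the first coordinate. It tends to \<open>x\<^sub>1\<close> as \<open>e\<close> tends
  to \<open>0\<close>, with first derivatives bounded by \<open>1\<close> uniformly in \<open>e\<close>, and vanishes at infinity for \<open>e > 0\<close>.\<close>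

definition drift :: "real \<Rightarrow> plane \<Rightarrow> real" where
  "drift e x = x $ 1 / drift_denom e x"

text \<open>This and the next function are the partial derivatives \<open>\<partial>\<^sub>1\<xi>\<close> and \<open>\<partial>\<^sub>2\<xi>\<close> of the drift \<open>\<xi>\<close>.\<close>

definition drift1 :: "real \<Rightarrow> plane \<Rightarrow> real" where
  "drift1 e x = (1 + e * ((x $ 2)\<^sup>2 - (x $ 1)\<^sup>2)) / (drift_denom e x)\<^sup>2"

definition drift2 :: "real \<Rightarrow> plane \<Rightarrow> real" where
  "drift2 e x = - (2 * e * (x $ 1 * x $ 2)) / (drift_denom e x)\<^sup>2"

definition stretch :: "real \<Rightarrow> real \<Rightarrow> plane \<Rightarrow> plane" where
  "stretch e t x = x + (t * drift e x) *\<^sub>R axis 1 1"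

definition stretch_jacobian :: "real \<Rightarrow> real \<Rightarrow> plane \<Rightarrow> real" where
  "stretch_jacobian e t x = 1 + t * drift1 e x"

lemma norm_plane: "(norm x)\<^sup>2 = (x $ 1)\<^sup>2 + (x $ 2)\<^sup>2" for x :: plane
  by (simp add: norm_vec_def L2_set_def UNIV_2)

lemma drift_denom_ge_1: "e \<ge> 0 \<Longrightarrow> drift_denom e x \<ge> 1"
  by (simp add: drift_denom_def)

lemma drift_denom_pos: "e \<ge> 0 \<Longrightarrow> drift_denom e x > 0"
  using drift_denom_ge_1[of e x] by linarith

lemma drift_denom_smooth: "smooth (drift_denom e)"
  unfolding drift_denom_def[abs_def] by (intro smooth_intros smooth_power)

lemma drift_smooth: "e \<ge> 0 \<Longrightarrow> smooth (drift e)"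
  unfolding drift_def[abs_def] by (intro smooth_divide smooth_intros drift_denom_smooth drift_denom_pos)

lemma drift1_smooth: "e \<ge> 0 \<Longrightarrow> smooth (drift1 e)"
  unfolding drift1_def[abs_def]
  by (intro smooth_divide smooth_intros smooth_diff smooth_power drift_denom_smooth zero_less_power drift_denom_pos)

lemma drift2_smooth: "e \<ge> 0 \<Longrightarrow> smooth (drift2 e)"
  unfolding drift2_def[abs_def]
  by (intro smooth_divide smooth_intros smooth_uminus smooth_power drift_denom_smooth zero_less_power drift_denom_pos)

lemma coord_has_derivative: "((\<lambda>x::plane. x $ i) has_derivative (\<lambda>h. h $ i)) (at x)"
  by (intro bounded_linear_imp_has_derivative bounded_linear_vec_nth)

lemma drift_has_derivative:
  assumes e: "e \<ge> 0"
  shows "(drift e has_derivative (\<lambda>h. h $ 1 * drift1 e x + h $ 2 * drift2 e x)) (at x)"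
proof -
  have nz: "drift_denom e x \<noteq> 0" using drift_denom_pos[OF e] by (metis less_irrefl)
  have q: "(drift_denom e has_derivative (\<lambda>h. e * (2 * (x $ 1) * h $ 1 + 2 * (x $ 2) * h $ 2))) (at x)"
    unfolding drift_denom_def[abs_def]
    by (rule has_derivative_eq_rhs) (auto intro!: derivative_eq_intros coord_has_derivative simp: fun_eq_iff algebra_simps)
  have "drift1 e x = (drift_denom e x - x $ 1 * (e * (2 * (x $ 1)))) / (drift_denom e x * drift_denom e x)"
    by (simp add: drift1_def drift_denom_def power2_eq_square algebra_simps)
  moreover have "drift2 e x = (- (x $ 1 * (e * (2 * (x $ 2))))) / (drift_denom e x * drift_denom e x)"
    by (simp add: drift2_def power2_eq_square algebra_simps)
  ultimately have "(h $ 1 * drift_denom e x - x $ 1 * (e * (2 * (x $ 1) * h $ 1 + 2 * (x $ 2) * h $ 2))) / (drift_denom e x * drift_denom e x)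
      = h $ 1 * drift1 e x + h $ 2 * drift2 e x" for h :: plane
    by (simp only: times_divide_eq_right add_divide_distrib[symmetric]) (simp add: algebra_simps)
  then show ?thesis
    unfolding drift_def[abs_def] by (intro has_derivative_eq_rhs[OF has_derivative_divide'[OF coord_has_derivative q nz]]) (simp add: fun_eq_iff)
qed

lemma partial_drift:
  assumes "e \<ge> 0" shows "partial 1 (drift e) = drift1 e" "partial 2 (drift e) = drift2 e"
  using partial_eqI[OF drift_has_derivative[OF assms]] by (auto simp: fun_eq_iff axis_def)

text \<open>Both sides are the mixed second derivative of the drift.\<close>

lemma drift_mixed_partials:
  assumes e: "e \<ge> 0"
  shows "partial 2 (drift1 e) = partial 1 (drift2 e)"
proof
  fix x
  have nz: "drift_denom e x \<noteq> 0" using drift_denom_pos[OF e] by (metis less_irrefl)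
  have q: "(drift_denom e has_derivative (\<lambda>h. e * (2 * (x $ 1) * h $ 1 + 2 * (x $ 2) * h $ 2))) (at x)"
    unfolding drift_denom_def[abs_def]
    by (rule has_derivative_eq_rhs) (auto intro!: derivative_eq_intros coord_has_derivative simp: fun_eq_iff algebra_simps)
  have q2: "((\<lambda>x. (drift_denom e x)\<^sup>2) has_derivative
      (\<lambda>h. 2 * drift_denom e x * (e * (2 * (x $ 1) * h $ 1 + 2 * (x $ 2) * h $ 2)))) (at x)"
    by (rule has_derivative_eq_rhs[OF has_derivative_power[OF q, of 2]]) (auto simp: fun_eq_iff)
  have nz2: "(drift_denom e x)\<^sup>2 \<noteq> 0" using nz by simp
  have n1: "((\<lambda>x::plane. 1 + e * ((x $ 2)\<^sup>2 - (x $ 1)\<^sup>2)) has_derivative (\<lambda>h. e * (2 * (x $ 2) * h $ 2 - 2 * (x $ 1) * h $ 1))) (at x)"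
    by (rule has_derivative_eq_rhs) (auto intro!: derivative_eq_intros coord_has_derivative simp: fun_eq_iff algebra_simps)
  have n2: "((\<lambda>x::plane. - (2 * e * (x $ 1 * x $ 2))) has_derivative (\<lambda>h. - (2 * e * (x $ 1 * h $ 2 + h $ 1 * x $ 2)))) (at x)"
    by (rule has_derivative_eq_rhs) (auto intro!: derivative_eq_intros coord_has_derivative simp: fun_eq_iff algebra_simps)
  have "partial 2 (drift1 e) x = (e * (2 * (x $ 2)) * (drift_denom e x)\<^sup>2
      - (1 + e * ((x $ 2)\<^sup>2 - (x $ 1)\<^sup>2)) * (2 * drift_denom e x * (e * (2 * (x $ 2))))) / ((drift_denom e x)\<^sup>2 * (drift_denom e x)\<^sup>2)"
    unfolding drift1_def[abs_def] using partial_eqI[OF has_derivative_divide'[OF n1 q2 nz2], of 2] by (simp add: axis_def)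
  also have "\<dots> = (- (2 * e * (x $ 2)) * (drift_denom e x)\<^sup>2
      - (- (2 * e * (x $ 1 * x $ 2))) * (2 * drift_denom e x * (e * (2 * (x $ 1))))) / ((drift_denom e x)\<^sup>2 * (drift_denom e x)\<^sup>2)"
    by (rule arg_cong[where f="\<lambda>y. y / _"]) (simp add: drift_denom_def power2_eq_square algebra_simps)
  also have "\<dots> = partial 1 (drift2 e) x"
    unfolding drift2_def[abs_def] using partial_eqI[OF has_derivative_divide'[OF n2 q2 nz2], of 1] by (simp add: axis_def)
  finally show "partial 2 (drift1 e) x = partial 1 (drift2 e) x" .
qed

lemma abs_drift1_le_1: assumes e: "e \<ge> 0" shows "\<bar>drift1 e x\<bar> \<le> 1"
proof -
  let ?q = "drift_denom e x"
  have q: "?q \<ge> 1" by (rule drift_denom_ge_1[OF e])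
  have "\<bar>1 + e * ((x $ 2)\<^sup>2 - (x $ 1)\<^sup>2)\<bar> \<le> ?q"
    using e mult_nonneg_nonneg[OF e zero_le_power2, of "x $ 1"] mult_nonneg_nonneg[OF e zero_le_power2, of "x $ 2"]
    unfolding drift_denom_def by (auto simp: abs_le_iff algebra_simps)
  also have "?q \<le> ?q\<^sup>2" using q mult_right_mono[of 1 ?q ?q] by (simp add: power2_eq_square)
  finally show ?thesis using q by (simp add: drift1_def abs_divide divide_le_eq)
qed

lemma abs_drift2_le_1: assumes e: "e \<ge> 0" shows "\<bar>drift2 e x\<bar> \<le> 1"
proof -
  let ?q = "drift_denom e x"
  have q: "?q \<ge> 1" by (rule drift_denom_ge_1[OF e])
  have "2 * \<bar>x $ 1\<bar> * \<bar>x $ 2\<bar> \<le> (x $ 1)\<^sup>2 + (x $ 2)\<^sup>2"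
    using sum_squares_bound[of "\<bar>x $ 1\<bar>" "\<bar>x $ 2\<bar>"] by simp
  from mult_left_mono[OF this e] have "\<bar>2 * e * (x $ 1 * x $ 2)\<bar> \<le> ?q"
    using e by (simp add: drift_denom_def abs_mult mult_ac)
  also have "?q \<le> ?q\<^sup>2" using q mult_right_mono[of 1 ?q ?q] by (simp add: power2_eq_square)
  finally show ?thesis using q by (simp add: drift2_def abs_divide divide_le_eq)
qed

lemma drift_Lipschitz: assumes e: "e \<ge> 0" shows "\<bar>drift e x - drift e y\<bar> \<le> 2 * norm (x - y)"
proof -
  have "norm (drift e x - drift e y) \<le> 2 * norm (x - y)"
  proof (rule differentiable_bound[where S=UNIV])
    fix z
    show "(drift e has_derivative (\<lambda>h. h $ 1 * drift1 e z + h $ 2 * drift2 e z)) (at z within UNIV)"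
      by (rule drift_has_derivative[OF e])
    show "onorm (\<lambda>h::plane. h $ 1 * drift1 e z + h $ 2 * drift2 e z) \<le> 2"
    proof (rule onorm_le)
      fix h :: plane
      have "\<bar>h $ 1\<bar> * \<bar>drift1 e z\<bar> \<le> norm h * 1"
        by (intro mult_mono component_le_norm_cart abs_drift1_le_1 e) auto
      moreover have "\<bar>h $ 2\<bar> * \<bar>drift2 e z\<bar> \<le> norm h * 1"
        by (intro mult_mono component_le_norm_cart abs_drift2_le_1 e) auto
      ultimately show "norm (h $ 1 * drift1 e z + h $ 2 * drift2 e z) \<le> 2 * norm h"
        using abs_triangle_ineq[of "h $ 1 * drift1 e z" "h $ 2 * drift2 e z"] by (simp add: abs_mult)
    qed
  qed auto
  then show ?thesis by simp
qed

text \<open>The drift decays fast enough to absorb the logarithmic weight.\<close>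

lemma drift_weighted_bound:
  assumes e: "0 < e" "e \<le> 1"
  shows "log_weight x * (drift e x)\<^sup>2 \<le> 2 / e\<^sup>2"
proof -
  define r where "r = norm x"
  have r0: "r \<ge> 0" by (simp add: r_def)
  let ?q = "drift_denom e x"
  have q: "?q = 1 + e * r\<^sup>2" by (simp add: drift_denom_def r_def norm_plane)
  have q0: "?q > 0" using drift_denom_pos[of e x] e by simp
  have "ln (1 + r) \<le> r" using r0 by (intro ln_add_one_self_le_self) auto
  then have w: "log_weight x \<le> 1 + r" by (simp add: log_weight_def r_def)
  have "(x $ 1)\<^sup>2 \<le> r\<^sup>2" by (simp add: r_def norm_plane)
  then have "log_weight x * (x $ 1)\<^sup>2 \<le> (1 + r) * r\<^sup>2"
    using w r0 by (intro mult_mono) auto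
  also have "(1 + r) * r\<^sup>2 \<le> 2 * (1 + r\<^sup>2)\<^sup>2"
  proof -
    have "r \<le> 1 + r\<^sup>2" using sum_squares_bound[of 1 r] r0 by simp
    then have "1 + r \<le> 2 * (1 + r\<^sup>2)" using zero_le_power2[of r] unfolding distrib_left by linarith
    then have "(1 + r) * r\<^sup>2 \<le> (2 * (1 + r\<^sup>2)) * (1 + r\<^sup>2)" using r0 by (intro mult_mono) auto
    then show ?thesis by (simp only: power2_eq_square mult.assoc)
  qed
  also have "e\<^sup>2 * (1 + r\<^sup>2)\<^sup>2 \<le> ?q\<^sup>2"
    unfolding power_mult_distrib[symmetric] q using e by (intro power_mono) (auto simp: algebra_simps)
  then have "2 * (1 + r\<^sup>2)\<^sup>2 \<le> 2 / e\<^sup>2 * ?q\<^sup>2" using e by (simp add: field_simps)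
  finally have "log_weight x * (x $ 1)\<^sup>2 \<le> 2 / e\<^sup>2 * ?q\<^sup>2" .
  then show ?thesis using q0 by (simp add: drift_def power_divide pos_divide_le_eq)
qed

lemma stretch_components: "stretch e t x $ 1 = x $ 1 + t * drift e x" "stretch e t x $ 2 = x $ 2"
  by (simp_all add: stretch_def axis_def)

lemma stretch_smooth: "e \<ge> 0 \<Longrightarrow> smooth (\<lambda>x. stretch e t x $ i)"
  using exhaust_2[of i] by (auto simp: stretch_components intro!: smooth_intros drift_smooth)

lemma stretch_diff: "stretch e t x - stretch e t y = (x - y) + (t * (drift e x - drift e y)) *\<^sub>R axis 1 1"
  by (simp add: stretch_def algebra_simps)

lemma stretch_diff_bounds:
  assumes e: "e \<ge> 0" and t: "0 \<le> t"
  shows "(1 - 2 * t) * norm (x - y) \<le> norm (stretch e t x - stretch e t y)"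
    and "norm (stretch e t x - stretch e t y) \<le> (1 + 2 * t) * norm (x - y)"
proof -
  have "norm ((t * (drift e x - drift e y)) *\<^sub>R axis 1 (1::real) :: plane) = t * \<bar>drift e x - drift e y\<bar>"
    using t by (simp add: abs_mult)
  also have "\<dots> \<le> t * (2 * norm (x - y))" by (intro mult_left_mono drift_Lipschitz e t)
  finally have *: "norm ((t * (drift e x - drift e y)) *\<^sub>R axis 1 (1::real) :: plane) \<le> 2 * t * norm (x - y)" by simp
  show "(1 - 2 * t) * norm (x - y) \<le> norm (stretch e t x - stretch e t y)"
    using norm_diff_ineq[of "x - y" "(t * (drift e x - drift e y)) *\<^sub>R axis 1 1"] *
    unfolding stretch_diff by (simp add: algebra_simps)
  show "norm (stretch e t x - stretch e t y) \<le> (1 + 2 * t) * norm (x - y)"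
    using norm_triangle_ineq[of "x - y" "(t * (drift e x - drift e y)) *\<^sub>R axis 1 1"] *
    unfolding stretch_diff by (simp add: algebra_simps)
qed

lemma stretch_0: "stretch e t 0 = 0" by (simp add: stretch_def drift_def)

lemma norm_stretch_bounds:
  assumes "e \<ge> 0" "0 \<le> t" "t \<le> 1 / 4"
  shows "norm x / 2 \<le> norm (stretch e t x)" "norm (stretch e t x) \<le> 2 * norm x"
proof -
  have "norm x / 2 \<le> (1 - 2 * t) * norm x" "(1 + 2 * t) * norm x \<le> 2 * norm x"
    using assms mult_right_mono[of "1 / 2" "1 - 2 * t" "norm x"] mult_right_mono[of "1 + 2 * t" 2 "norm x"] by auto
  then show "norm x / 2 \<le> norm (stretch e t x)" "norm (stretch e t x) \<le> 2 * norm x"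
    using stretch_diff_bounds[OF assms(1,2), of x 0] by (auto simp: stretch_0)
qed

lemma log_weight_stretch:
  assumes "e \<ge> 0" "0 \<le> t" "t \<le> 1 / 4"
  shows "log_weight (stretch e t x) \<le> 2 * log_weight x"
proof -
  have "1 + norm (stretch e t x) \<le> 2 * (1 + norm x)" using norm_stretch_bounds(2)[OF assms, of x] by simp
  then have "ln (1 + norm (stretch e t x)) \<le> ln (2 * (1 + norm x))"
    by (intro ln_mono) (auto simp: add_pos_nonneg)
  also have "\<dots> = ln 2 + ln (1 + norm x)" by (intro ln_mult_pos) (auto simp: add_pos_nonneg)
  finally have "ln (1 + norm (stretch e t x)) \<le> ln 2 + ln (1 + norm x)" .
  moreover have "ln 2 \<le> (1::real)" using ln_2_less_1 by simp
  moreover have "0 \<le> ln (1 + norm x)" by simp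
  ultimately show ?thesis unfolding log_weight_def distrib_left by linarith
qed

text \<open>Surjectivity: \<open>x \<mapsto> y - t \<xi>(x) e\<^sub>1\<close> is a contraction, and its fixed point is a preimage of \<open>y\<close>.\<close>

lemma stretch_bij:
  assumes "e \<ge> 0" "0 \<le> t" "t \<le> 1 / 4"
  shows "bij (stretch e t)"
proof (rule bijI)
  show "inj (stretch e t)"
  proof (rule injI)
    fix x y assume "stretch e t x = stretch e t y"
    then have "(1 - 2 * t) * norm (x - y) \<le> 0" using stretch_diff_bounds(1)[OF assms(1,2), of x y] by simp
    then show "x = y" using assms by (simp add: mult_le_0_iff)
  qed
  show "surj (stretch e t)"
    unfolding surj_def
  proof
    fix y :: plane
    let ?f = "\<lambda>x. y - (t * drift e x) *\<^sub>R axis 1 1"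
    have "\<forall>x x'. dist (?f x) (?f x') \<le> 1 / 2 * dist x x'"
    proof (intro allI)
      fix x x' :: plane
      have "?f x - ?f x' = (t * (drift e x' - drift e x)) *\<^sub>R axis 1 1" by (simp add: algebra_simps)
      then have "dist (?f x) (?f x') = t * \<bar>drift e x' - drift e x\<bar>"
        using assms by (simp add: dist_norm abs_mult)
      also have "\<dots> \<le> 1 / 4 * (2 * norm (x' - x))" using assms by (intro mult_mono drift_Lipschitz) auto
      finally show "dist (?f x) (?f x') \<le> 1 / 2 * dist x x'" by (simp add: dist_norm norm_minus_commute)
    qed
    then have "\<exists>!x. ?f x = x" by (rule banach_fix_type[rotated 2]) auto
    then obtain x where "y - (t * drift e x) *\<^sub>R axis 1 1 = x" by blast
    then have "y = stretch e t x" by (simp add: stretch_def diff_eq_eq)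
    then show "\<exists>x. y = stretch e t x" by blast
  qed
qed

lemma stretch_jacobian_bounds:
  assumes "e \<ge> 0" "0 \<le> t" "t \<le> 1 / 4"
  shows "1 / 2 \<le> stretch_jacobian e t x" "stretch_jacobian e t x \<le> 2"
proof -
  have "\<bar>t * drift1 e x\<bar> \<le> 1 / 4 * 1"
    unfolding abs_mult using assms by (intro mult_mono abs_drift1_le_1) auto
  then show "1 / 2 \<le> stretch_jacobian e t x" "stretch_jacobian e t x \<le> 2"
    unfolding stretch_jacobian_def by linarith+
qed

lemma stretch_jacobian_smooth: "e \<ge> 0 \<Longrightarrow> smooth (stretch_jacobian e t)"
  unfolding stretch_jacobian_def[abs_def] by (intro smooth_intros drift1_smooth)

lemma stretch_has_derivative:
  assumes "e \<ge> 0"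
  shows "(stretch e t has_derivative (\<lambda>h. h + (t * (h $ 1 * drift1 e x + h $ 2 * drift2 e x)) *\<^sub>R axis 1 1)) (at x)"
  unfolding stretch_def[abs_def]
  by (auto intro!: derivative_eq_intros drift_has_derivative assms)

lemma stretch_continuous_on: "e \<ge> 0 \<Longrightarrow> continuous_on A (stretch e t)"
  using stretch_has_derivative has_derivative_continuous by (blast intro: continuous_at_imp_continuous_on)

lemma stretch_measurable: "e \<ge> 0 \<Longrightarrow> stretch e t \<in> borel_measurable borel"
  using stretch_continuous_on borel_measurable_continuous_onI by blast

lemma stretch_det:
  "det (matrix (\<lambda>h::plane. h + (t * (h $ 1 * drift1 e x + h $ 2 * drift2 e x)) *\<^sub>R axis 1 1)) = stretch_jacobian e t x"
  unfolding det_2 matrix_def by (simp add: axis_def stretch_jacobian_def)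

text \<open>It suffices to compare both measures on boxes. The matrix of the derivative is
  triangular, so that its determinant is the entry \<open>1 + t \<partial>\<^sub>1\<xi>\<close>.\<close>

theorem stretch_change_of_variables:
  assumes "e \<ge> 0" "0 \<le> t" "t \<le> 1 / 4"
  shows "distr (density lborel (\<lambda>x. ennreal (stretch_jacobian e t x))) borel (stretch e t) = lborel"
proof (rule lborel_eqI[symmetric])
  let ?J = "stretch_jacobian e t" and ?f = "stretch e t"
  let ?M = "distr (density lborel (\<lambda>x. ennreal (?J x))) borel ?f"
  have J0: "0 \<le> ?J x" for x using stretch_jacobian_bounds(1)[OF assms, of x] by linarith
  note [measurable] = stretch_measurable[OF assms(1), of t] smooth_measurable[OF stretch_jacobian_smooth[OF assms(1)], of t]
  show "sets ?M = sets borel" by simp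
  fix l u :: plane assume le: "\<And>b. b \<in> Basis \<Longrightarrow> l \<bullet> b \<le> u \<bullet> b"
  let ?S = "?f -` box l u"
  have S: "?S \<in> sets borel" using measurable_sets[OF stretch_measurable[OF assms(1), of t], of "box l u"] by simp
  have img: "?f ` ?S = box l u" using stretch_bij[OF assms] by (simp add: bij_is_surj surj_image_vimage_eq)
  have "((\<lambda>x. \<bar>det (matrix (\<lambda>h::plane. h + (t * (h $ 1 * drift1 e x + h $ 2 * drift2 e x)) *\<^sub>R axis 1 1))\<bar>)
      has_integral measure lebesgue (box l u)) ?S"
  proof (subst has_measure_differentiable_image[symmetric])
    show "?S \<in> sets lebesgue" using S by (intro sets_completionI_sets) simp
    show "(?f has_derivative (\<lambda>h. h + (t * (h $ 1 * drift1 e x + h $ 2 * drift2 e x)) *\<^sub>R axis 1 1)) (at x within ?S)" for x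
      by (rule has_derivative_at_withinI[OF stretch_has_derivative[OF assms(1)]])
    show "inj_on ?f ?S" using stretch_bij[OF assms] by (meson bij_is_inj inj_on_subset subset_UNIV)
    show "?f ` ?S \<in> lmeasurable \<and> measure lebesgue (?f ` ?S) = measure lebesgue (box l u)"
      unfolding img by simp
  qed
  then have "(?J has_integral measure lebesgue (box l u)) ?S"
    unfolding stretch_det by (simp add: abs_of_nonneg[OF J0])
  from nn_integral_has_integral_lebesgue'[OF J0 this]
  have "(\<integral>\<^sup>+x. ennreal (?J x) * indicator ?S x \<partial>lborel) = ennreal (measure lebesgue (box l u))" .
  then have "emeasure ?M (box l u) = ennreal (measure lebesgue (box l u))"
    using S by (simp add: emeasure_distr emeasure_density)
  also have "\<dots> = emeasure lborel (box l u)"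
    using emeasure_lborel_box_finite[of l u] by (subst emeasure_eq_ennreal_measure) (auto simp: measure_completion)
  also have "\<dots> = (\<Prod>b\<in>Basis. (u - l) \<bullet> b)" using le by (rule emeasure_lborel_box)
  finally show "emeasure ?M (box l u) = (\<Prod>b\<in>Basis. (u - l) \<bullet> b)" .
qed

lemma stretch_integral:
  fixes f :: "plane \<Rightarrow> real"
  assumes "e \<ge> 0" "0 \<le> t" "t \<le> 1 / 4" and [measurable]: "f \<in> borel_measurable borel"
  shows "(LINT x|lborel. f x) = (LINT y|lborel. stretch_jacobian e t y * f (stretch e t y))"
    and "integrable lborel f \<longleftrightarrow> integrable lborel (\<lambda>y. stretch_jacobian e t y * f (stretch e t y))"
proof -
  have J0: "0 \<le> stretch_jacobian e t x" for x using stretch_jacobian_bounds(1)[OF assms(1-3), of x] by linarith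
  note [measurable] = stretch_measurable[OF assms(1), of t] smooth_measurable[OF stretch_jacobian_smooth[OF assms(1)], of t]
  note e = stretch_change_of_variables[OF assms(1-3), symmetric]
  show "(LINT x|lborel. f x) = (LINT y|lborel. stretch_jacobian e t y * f (stretch e t y))"
    by (subst e) (simp add: integral_distr integral_density J0)
  show "integrable lborel f \<longleftrightarrow> integrable lborel (\<lambda>y. stretch_jacobian e t y * f (stretch e t y))"
    by (subst e) (simp add: integrable_distr_eq integrable_density J0)
qed

section \<open>Functions transported by the stretching\<close>

lemma partial_mult:
  assumes "smooth f" "smooth g"
  shows "partial i (\<lambda>x. f x * g x) = (\<lambda>x. f x * partial i g x + partial i f x * g x)"
proof
  fix x
  show "partial i (\<lambda>x. f x * g x) x = f x * partial i g x + partial i f x * g x"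
    using partial_eqI[OF has_derivative_mult[OF smooth_has_derivative[OF assms(1)] smooth_has_derivative[OF assms(2)]]]
    by (simp add: partial_def)
qed

lemma partial_compose_stretch:
  assumes "e \<ge> 0" "smooth \<psi>"
  shows "partial 1 (\<lambda>y. \<psi> (stretch e t y)) = (\<lambda>y. stretch_jacobian e t y * partial 1 \<psi> (stretch e t y))"
    and "partial 2 (\<lambda>y. \<psi> (stretch e t y)) = (\<lambda>y. t * drift2 e y * partial 1 \<psi> (stretch e t y) + partial 2 \<psi> (stretch e t y))"
proof -
  have "partial i (\<lambda>y. \<psi> (stretch e t y)) y =
     (axis i 1 + (t * (axis i 1 $ 1 * drift1 e y + axis i 1 $ 2 * drift2 e y)) *\<^sub>R axis 1 1) $ 1 * partial 1 \<psi> (stretch e t y)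
     + (axis i 1 + (t * (axis i 1 $ 1 * drift1 e y + axis i 1 $ 2 * drift2 e y)) *\<^sub>R axis 1 1) $ 2 * partial 2 \<psi> (stretch e t y)" for i y
    by (rule partial_eqI[OF has_derivative_compose[OF stretch_has_derivative[OF assms(1)] smooth_has_derivative'[OF assms(2)]]])
  then show "partial 1 (\<lambda>y. \<psi> (stretch e t y)) = (\<lambda>y. stretch_jacobian e t y * partial 1 \<psi> (stretch e t y))"
    and "partial 2 (\<lambda>y. \<psi> (stretch e t y)) = (\<lambda>y. t * drift2 e y * partial 1 \<psi> (stretch e t y) + partial 2 \<psi> (stretch e t y))"
    by (auto simp: fun_eq_iff axis_def stretch_jacobian_def algebra_simps)
qed

definition deformed :: "real \<Rightarrow> real \<Rightarrow> (plane \<Rightarrow> real) \<Rightarrow> plane \<Rightarrow> real" where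
  "deformed e t u x = u (inv (stretch e t) x)"

text \<open>The gradient of the transported function at the point \<open>\<Phi>(y)\<close>, by the chain rule.\<close>

definition deformed_grad :: "real \<Rightarrow> real \<Rightarrow> (plane \<Rightarrow> plane) \<Rightarrow> plane \<Rightarrow> plane" where
  "deformed_grad e t g y = (\<chi> i. if i = 1 then g y $ 1 / stretch_jacobian e t y
     else g y $ 2 - t * drift2 e y * (g y $ 1 / stretch_jacobian e t y))"

lemma deformed_grad_components:
  "deformed_grad e t g y $ 1 = g y $ 1 / stretch_jacobian e t y"
  "deformed_grad e t g y $ 2 = g y $ 2 - t * drift2 e y * (g y $ 1 / stretch_jacobian e t y)"
  by (simp_all add: deformed_grad_def)

text \<open>For \<open>t \<le> 1/4\<close> distances and areas change by a factor of at most \<open>2\<close>.\<close>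

locale stretching =
  fixes e t :: real
  assumes e_pos: "0 < e" and e_le: "e \<le> 1" and t_nonneg: "0 \<le> t" and t_le: "t \<le> 1 / 4"
begin

lemma e_nonneg: "0 \<le> e" using e_pos by simp

lemmas adm = e_nonneg t_nonneg t_le

abbreviation \<Phi> :: "plane \<Rightarrow> plane" where "\<Phi> \<equiv> stretch e t"
abbreviation J :: "plane \<Rightarrow> real" where "J \<equiv> stretch_jacobian e t"

lemma J_pos: "J y > 0" and J_nonneg: "J y \<ge> 0" and J_nz: "J y \<noteq> 0"
  using stretch_jacobian_bounds(1)[OF adm, of y] by simp_all

lemma J_measurable [measurable]: "J \<in> borel_measurable borel"
  by (rule smooth_measurable[OF stretch_jacobian_smooth[OF e_nonneg]])

lemma \<Phi>_measurable [measurable]: "\<Phi> \<in> borel_measurable borel"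
  by (rule stretch_measurable[OF e_nonneg])

lemma inv_\<Phi>: "inv \<Phi> (\<Phi> y) = y" "\<Phi> (inv \<Phi> x) = x"
  using stretch_bij[OF adm] by (auto simp: bij_is_inj bij_is_surj surj_f_inv_f)

lemma inv_\<Phi>_measurable [measurable]: "inv \<Phi> \<in> borel_measurable borel"
proof -
  have "dist (inv \<Phi> x) (inv \<Phi> y) \<le> 2 * dist x y" for x y
  proof -
    have "(1 / 2) * norm (inv \<Phi> x - inv \<Phi> y) \<le> (1 - 2 * t) * norm (inv \<Phi> x - inv \<Phi> y)"
      using t_le by (intro mult_right_mono) auto
    then show ?thesis
      using stretch_diff_bounds(1)[OF adm(1,2), of "inv \<Phi> x" "inv \<Phi> y"] by (simp add: inv_\<Phi> dist_norm)
  qed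
  then have "2-lipschitz_on UNIV (inv \<Phi>)" by (intro lipschitz_onI) auto
  then show ?thesis by (intro borel_measurable_continuous_onI lipschitz_on_continuous_on)
qed

lemma deformed_\<Phi>: "deformed e t u (\<Phi> y) = u y"
  by (simp add: deformed_def inv_\<Phi>)

lemma deformed_measurable: "u \<in> borel_measurable borel \<Longrightarrow> deformed e t u \<in> borel_measurable borel"
  unfolding deformed_def[abs_def] by (rule measurable_compose[OF inv_\<Phi>_measurable])

lemma J_mult_integrable:
  fixes f :: "plane \<Rightarrow> real"
  assumes "integrable lborel f" shows "integrable lborel (\<lambda>y. J y * f y)"
proof (rule Bochner_Integration.integrable_bound[OF integrable_mult_right[OF assms, of 2]])
  have [measurable]: "f \<in> borel_measurable borel" using borel_measurable_integrable[OF assms] by simp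
  show "(\<lambda>y. J y * f y) \<in> borel_measurable lborel" by measurable
  show "AE y in lborel. norm (J y * f y) \<le> norm (2 * f y)"
    using stretch_jacobian_bounds(2)[OF adm] J_nonneg by (intro AE_I2) (auto simp: abs_mult intro!: mult_right_mono)
qed

lemma J_mult_integral_le:
  fixes f :: "plane \<Rightarrow> real"
  assumes "integrable lborel f" "\<And>y. 0 \<le> f y"
  shows "(LINT y|lborel. J y * f y) \<le> 2 * (LINT y|lborel. f y)"
proof -
  have "(LINT y|lborel. J y * f y) \<le> (LINT y|lborel. 2 * f y)"
    using assms stretch_jacobian_bounds(2)[OF adm]
    by (intro integral_mono J_mult_integrable integrable_mult_right mult_right_mono) auto
  then show ?thesis by simp
qed

lemma deformed_integral:
  fixes u :: "plane \<Rightarrow> real" and h :: "real \<Rightarrow> real"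
  assumes "u \<in> borel_measurable borel" "h \<in> borel_measurable borel"
  shows "(LINT x|lborel. h (deformed e t u x)) = (LINT y|lborel. J y * h (u y))"
    and "integrable lborel (\<lambda>y. h (u y)) \<Longrightarrow> integrable lborel (\<lambda>x. h (deformed e t u x))"
proof -
  note [measurable] = deformed_measurable[OF assms(1)] assms
  have m: "(\<lambda>x. h (deformed e t u x)) \<in> borel_measurable borel" by measurable
  show "(LINT x|lborel. h (deformed e t u x)) = (LINT y|lborel. J y * h (u y))"
    using stretch_integral(1)[OF adm m] by (simp add: deformed_\<Phi>)
  show "integrable lborel (\<lambda>y. h (u y)) \<Longrightarrow> integrable lborel (\<lambda>x. h (deformed e t u x))"
    using stretch_integral(2)[OF adm m] J_mult_integrable by (simp add: deformed_\<Phi>)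
qed

lemma deformed_L2:
  assumes "u \<in> L2" shows "deformed e t u \<in> L2"
  using deformed_integral(2)[OF L2_measurable_borel[OF assms], of "\<lambda>s. s\<^sup>2"] L2_square_integrable[OF assms]
    deformed_measurable[OF L2_measurable_borel[OF assms]]
  unfolding L2_real by simp

lemma deformed_weighted:
  assumes u: "u \<in> L2" "integrable lborel (\<lambda>x. log_weight x * (u x)\<^sup>2)"
  shows "integrable lborel (\<lambda>x. log_weight x * (deformed e t u x)\<^sup>2)"
    and "(LINT x|lborel. log_weight x * (deformed e t u x)\<^sup>2) \<le> 4 * (LINT x|lborel. log_weight x * (u x)\<^sup>2)"
proof -
  note [measurable] = deformed_measurable[OF L2_measurable_borel[OF u(1)]] L2_measurable_borel[OF u(1)]
  have m: "(\<lambda>x. log_weight x * (deformed e t u x)\<^sup>2) \<in> borel_measurable borel" by measurable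
  have le: "J y * (log_weight (\<Phi> y) * (u y)\<^sup>2) \<le> 4 * (log_weight y * (u y)\<^sup>2)" for y
  proof -
    have "J y * log_weight (\<Phi> y) \<le> 2 * (2 * log_weight y)"
      using stretch_jacobian_bounds(2)[OF adm, of y] J_nonneg[of y] log_weight_stretch[OF adm, of y] log_weight_ge_1[of "\<Phi> y"]
      by (intro mult_mono) auto
    then have "J y * log_weight (\<Phi> y) * (u y)\<^sup>2 \<le> 2 * (2 * log_weight y) * (u y)\<^sup>2" by (rule mult_right_mono) simp
    then show ?thesis by (simp add: mult.assoc)
  qed
  have nn: "0 \<le> J y * (log_weight (\<Phi> y) * (u y)\<^sup>2)" for y
    using J_nonneg[of y] log_weight_ge_1[of "\<Phi> y"] by simp
  have i: "integrable lborel (\<lambda>y. J y * (log_weight (\<Phi> y) * (u y)\<^sup>2))"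
    by (rule Bochner_Integration.integrable_bound[OF integrable_mult_right[OF u(2), of 4]])
       (measurable, use le nn in \<open>auto simp: abs_of_nonneg intro!: AE_I2 order_trans[OF _ abs_ge_self]\<close>)
  show "integrable lborel (\<lambda>x. log_weight x * (deformed e t u x)\<^sup>2)"
    using i unfolding stretch_integral(2)[OF adm m] by (simp add: deformed_\<Phi>)
  have "(LINT x|lborel. log_weight x * (deformed e t u x)\<^sup>2) = (LINT y|lborel. J y * (log_weight (\<Phi> y) * (u y)\<^sup>2))"
    unfolding stretch_integral(1)[OF adm m] by (simp add: deformed_\<Phi>)
  also have "\<dots> \<le> (LINT y|lborel. 4 * (log_weight y * (u y)\<^sup>2))"
    using i u(2) le by (intro integral_mono) auto
  finally show "(LINT x|lborel. log_weight x * (deformed e t u x)\<^sup>2) \<le> 4 * (LINT x|lborel. log_weight x * (u x)\<^sup>2)"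
    by simp
qed

lemma deformed_interacting:
  assumes u: "interacting u"
  shows "interacting (deformed e t u)" "interaction_const (deformed e t u) \<le> 4 * interaction_const u"
proof -
  note um = interacting_measurable[OF u]
  have i4: "integrable lborel (\<lambda>x. (u x) ^ 4)" using u by (simp add: interacting_def)
  have p: "(LINT x|lborel. (deformed e t u x) ^ 4) \<le> 2 * (LINT x|lborel. (u x) ^ 4)"
    using deformed_integral(1)[OF um, of "\<lambda>s. s ^ 4"] J_mult_integral_le[OF i4] by simp
  show "interacting (deformed e t u)"
    using deformed_L2 deformed_weighted(1) deformed_integral(2)[OF um, of "\<lambda>s. s ^ 4"] u
    unfolding interacting_def by simp
  have "a + (k + b) / 2 \<le> 4 * (a' + (k + b') / 2)"
    if "a \<le> 4 * a'" "b \<le> 2 * b'" "0 \<le> k" "0 \<le> b'" for a b k a' b' :: real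
    using that by (simp add: field_simps)
  then show "interaction_const (deformed e t u) \<le> 4 * interaction_const u"
    unfolding interaction_const_def
    using p deformed_weighted(2)[OF interacting_L2[OF u] interacting_weighted[OF u]] by simp
qed

lemma test_function_compose_\<Phi>:
  assumes "test_function \<psi>" shows "test_function (\<lambda>y. \<psi> (\<Phi> y))"
proof -
  obtain R where R: "R > 0" "\<And>x. norm x \<ge> R \<Longrightarrow> \<psi> x = 0"
    using test_function_outside[OF assms] by blast
  have "norm y \<le> 2 * R" if "\<psi> (\<Phi> y) \<noteq> 0" for y
  proof (rule ccontr)
    assume "\<not> norm y \<le> 2 * R"
    then have "R \<le> norm (\<Phi> y)" using norm_stretch_bounds(1)[OF adm, of y] by simp
    with R(2) that show False by blast
  qed
  then have "bounded {y. \<psi> (\<Phi> y) \<noteq> 0}" unfolding bounded_iff by blast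
  moreover have "smooth (\<lambda>y. \<psi> (\<Phi> y))"
    by (rule smooth_compose_map[OF stretch_smooth[OF e_nonneg] test_function_smooth[OF assms]])
  ultimately show ?thesis by (simp add: test_function_iff)
qed

lemma deformed_grad_bound: "norm (deformed_grad e t g y) \<le> 4 * norm (g y)"
proof -
  have g: "\<bar>g y $ i\<bar> \<le> norm (g y)" for i by (rule component_le_norm_cart)
  have a: "\<bar>g y $ 1 / J y\<bar> \<le> 2 * norm (g y)"
  proof -
    have "\<bar>g y $ 1\<bar> \<le> norm (g y) * (2 * J y)"
      using g[of 1] stretch_jacobian_bounds(1)[OF adm, of y] mult_left_mono[of 1 "2 * J y" "norm (g y)"] by simp
    then show ?thesis using J_pos[of y] by (simp add: abs_divide pos_divide_le_eq mult_ac)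
  qed
  have "\<bar>t * drift2 e y * (g y $ 1 / J y)\<bar> \<le> 1 / 4 * 1 * (2 * norm (g y))"
    unfolding abs_mult using a t_nonneg t_le abs_drift2_le_1[OF e_nonneg, of y] by (intro mult_mono) auto
  then have "\<bar>t * drift2 e y * (g y $ 1 / J y)\<bar> \<le> norm (g y) / 2" by simp
  moreover have "\<bar>r - s\<bar> \<le> 2 * n" if "\<bar>r\<bar> \<le> n" "\<bar>s\<bar> \<le> n / 2" for r s n :: real
    using that by linarith
  ultimately have "\<bar>deformed_grad e t g y $ 2\<bar> \<le> 2 * norm (g y)"
    unfolding deformed_grad_components using g[of 2] by blast
  moreover have "\<bar>deformed_grad e t g y $ 1\<bar> \<le> 2 * norm (g y)" using a by (simp add: deformed_grad_components)
  ultimately show ?thesis using norm_le_l1_cart[of "deformed_grad e t g y"] by (simp add: UNIV_2)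
qed

lemma deformed_grad_measurable:
  assumes g: "g \<in> borel_measurable borel" shows "deformed_grad e t g \<in> borel_measurable borel"
proof (rule borel_measurable_planeI)
  note [measurable] = borel_measurable_component[OF g] smooth_measurable[OF drift2_smooth[OF e_nonneg]]
  show "(\<lambda>y. deformed_grad e t g y $ i) \<in> borel_measurable borel" for i
    using exhaust_2[of i] by (auto simp: deformed_grad_components)
qed

text \<open>The cofactors of the derivative of \<open>\<Phi>\<close> have divergence zero. In coordinates,
  \<open>J (\<partial>\<^sub>1\<phi>) \<circ> \<Phi> = \<partial>\<^sub>1(\<phi> \<circ> \<Phi>)\<close> and \<open>J (\<partial>\<^sub>2\<phi>) \<circ> \<Phi> = \<partial>\<^sub>2(J \<phi> \<circ> \<Phi>) - t \<partial>\<^sub>1(\<partial>\<^sub>2\<xi> \<phi> \<circ> \<Phi>)\<close>, so that after the change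
  of variables only derivatives of test functions are paired with \<open>u\<close>.\<close>

theorem deformed_weak_gradient:
  assumes u: "u \<in> L2" "weak_gradient u g"
  shows "weak_gradient (deformed e t u) (\<lambda>x. deformed_grad e t g (inv \<Phi> x))"
    and "(LINT x|lborel. (norm (deformed_grad e t g (inv \<Phi> x)))\<^sup>2) = (LINT y|lborel. J y * (norm (deformed_grad e t g y))\<^sup>2)"
proof -
  let ?G = "\<lambda>x. deformed_grad e t g (inv \<Phi> x)"
  note gL = weak_gradient_L2[OF u(2)]
  note gm [measurable] = L2_measurable_borel[OF gL] deformed_grad_measurable[OF L2_measurable_borel[OF gL]]
  note um [measurable] = L2_measurable_borel[OF u(1)] deformed_measurable[OF L2_measurable_borel[OF u(1)]]
  have m: "(\<lambda>x. (norm (?G x))\<^sup>2) \<in> borel_measurable borel" by measurable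
  have i: "integrable lborel (\<lambda>y. J y * (norm (deformed_grad e t g y))\<^sup>2)"
  proof (rule J_mult_integrable, rule Bochner_Integration.integrable_bound)
    show "integrable lborel (\<lambda>y. 16 * (norm (g y))\<^sup>2)" using L2_vector_integrable[OF gL] by simp
    show "AE y in lborel. norm ((norm (deformed_grad e t g y))\<^sup>2) \<le> norm (16 * (norm (g y))\<^sup>2)"
    proof (rule AE_I2)
      fix y
      from power_mono[OF deformed_grad_bound norm_ge_zero, of g y 2]
      show "norm ((norm (deformed_grad e t g y))\<^sup>2) \<le> norm (16 * (norm (g y))\<^sup>2)" by (simp add: power_mult_distrib)
    qed
  qed measurable
  show "(LINT x|lborel. (norm (?G x))\<^sup>2) = (LINT y|lborel. J y * (norm (deformed_grad e t g y))\<^sup>2)"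
    unfolding stretch_integral(1)[OF adm m] by (simp add: inv_\<Phi>)
  have GL: "?G \<in> L2"
    unfolding L2_def mem_Collect_eq
  proof
    show "?G \<in> borel_measurable lborel" by measurable
    show "integrable lborel (\<lambda>x. (norm (?G x))\<^sup>2)"
      using i unfolding stretch_integral(2)[OF adm m] by (simp add: inv_\<Phi>)
  qed
  show "weak_gradient (deformed e t u) ?G"
    unfolding weak_gradient_def
  proof (intro conjI allI impI GL)
    fix \<phi> :: "plane \<Rightarrow> real" and i :: 2 assume \<phi>: "test_function \<phi>"
    note \<phi>s = test_function_smooth[OF \<phi>]
    let ?\<psi> = "\<lambda>y. \<phi> (\<Phi> y)"
    have \<psi>: "test_function ?\<psi>" by (rule test_function_compose_\<Phi>[OF \<phi>])
    note \<psi>s = test_function_smooth[OF \<psi>]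
    note [measurable] = smooth_measurable[OF \<phi>s] smooth_measurable[OF smooth_partial[OF \<phi>s]]
      borel_measurable_component[OF gm(2)]
    have l: "(LINT x|lborel. deformed e t u x * partial i \<phi> x) = (LINT y|lborel. u y * (J y * partial i \<phi> (\<Phi> y)))" for i
    proof -
      have mm: "(\<lambda>x. deformed e t u x * partial i \<phi> x) \<in> borel_measurable borel" by measurable
      show ?thesis unfolding stretch_integral(1)[OF adm mm] by (simp add: deformed_\<Phi> mult_ac)
    qed
    have r: "(LINT x|lborel. ?G x $ i * \<phi> x) = (LINT y|lborel. J y * (deformed_grad e t g y $ i) * ?\<psi> y)" for i
    proof -
      have mm: "(\<lambda>x. ?G x $ i * \<phi> x) \<in> borel_measurable borel" by measurable
      show ?thesis unfolding stretch_integral(1)[OF adm mm] by (simp add: inv_\<Phi> mult_ac)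
    qed
    show "(LINT x|lborel. deformed e t u x * partial i \<phi> x) = - (LINT x|lborel. ?G x $ i * \<phi> x)"
    proof (cases "i = 1")
      case True
      have "(LINT y|lborel. u y * (J y * partial 1 \<phi> (\<Phi> y))) = - (LINT y|lborel. g y $ 1 * ?\<psi> y)"
        using weak_gradient_eq[OF u(2) \<psi>, of 1] unfolding partial_compose_stretch(1)[OF e_nonneg \<phi>s] .
      then show ?thesis unfolding l r True by (simp add: deformed_grad_components J_nz)
    next
      case False
      then have i2: "i = 2" using exhaust_2[of i] by blast
      let ?a = "\<lambda>y. J y * ?\<psi> y" and ?b = "\<lambda>y. drift2 e y * ?\<psi> y"
      have Js: "smooth J" "smooth (drift2 e)"
        using stretch_jacobian_smooth drift2_smooth e_nonneg by auto
      have ta: "test_function ?a" and tb: "test_function ?b"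
        by (rule test_function_mult[OF _ \<psi>], rule Js)+
      have J2: "partial 2 J y = t * partial 1 (drift2 e) y" for y
      proof -
        have "(J has_derivative (\<lambda>h. t * frechet_derivative (drift1 e) (at y) h)) (at y)"
          unfolding stretch_jacobian_def[abs_def]
          by (auto intro!: derivative_eq_intros smooth_has_derivative drift1_smooth e_nonneg)
        from partial_eqI[OF this, of 2] show ?thesis
          using drift_mixed_partials[OF e_nonneg] by (simp add: partial_def fun_eq_iff)
      qed
      have eq: "J y * partial 2 \<phi> (\<Phi> y) = partial 2 ?a y - t * partial 1 ?b y" for y
        unfolding partial_mult[OF Js(1) \<psi>s] partial_mult[OF Js(2) \<psi>s] partial_compose_stretch[OF e_nonneg \<phi>s] J2
        by (simp add: algebra_simps)
      have ia: "integrable lborel (\<lambda>y. u y * partial 2 ?a y)" "integrable lborel (\<lambda>y. u y * partial 1 ?b y)"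
        by (intro L2_integrable_mult[OF u(1)] test_function_L2 test_function_partial ta tb)+
      have ib: "integrable lborel (\<lambda>y. g y $ 2 * ?a y)" "integrable lborel (\<lambda>y. g y $ 1 * ?b y)"
        by (intro L2_integrable_mult L2_component[OF gL] test_function_L2 ta tb)+
      have "(LINT y|lborel. u y * (J y * partial 2 \<phi> (\<Phi> y))) = (LINT y|lborel. u y * partial 2 ?a y - t * (u y * partial 1 ?b y))"
        unfolding eq by (simp add: algebra_simps)
      also have "\<dots> = - (LINT y|lborel. g y $ 2 * ?a y) + t * (LINT y|lborel. g y $ 1 * ?b y)"
        using ia weak_gradient_eq[OF u(2) ta, of 2] weak_gradient_eq[OF u(2) tb, of 1] by simp
      also have "\<dots> = - (LINT y|lborel. g y $ 2 * ?a y - t * (g y $ 1 * ?b y))"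
        using ib by simp
      also have "(\<lambda>y. g y $ 2 * ?a y - t * (g y $ 1 * ?b y)) = (\<lambda>y. J y * (deformed_grad e t g y $ 2) * ?\<psi> y)"
        using J_nz by (simp add: fun_eq_iff deformed_grad_components field_simps)
      finally show ?thesis unfolding l r i2 .
    qed
  qed
qed

text \<open>The product measure is the image of the product of the two weighted measures.\<close>

lemma stretch_integral_pair:
  fixes f :: "plane \<times> plane \<Rightarrow> real"
  assumes [measurable]: "f \<in> borel_measurable (borel \<Otimes>\<^sub>M borel)"
  shows "(LINT p|(lborel \<Otimes>\<^sub>M lborel). f p) = (LINT (x, y)|(lborel \<Otimes>\<^sub>M lborel). J x * J y * f (\<Phi> x, \<Phi> y))"
proof -
  let ?D = "density lborel (\<lambda>x. ennreal (J x))"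
  let ?M = "(lborel \<Otimes>\<^sub>M lborel) :: (plane \<times> plane) measure"
  have sf: "sigma_finite_measure ?D"
    by (subst sigma_finite_measure.sigma_finite_iff_density_finite[OF lborel.sigma_finite_measure_axioms]) auto
  have e1: "distr ?D borel \<Phi> = lborel" by (rule stretch_change_of_variables[OF adm])
  have "?M = distr ?D borel \<Phi> \<Otimes>\<^sub>M distr ?D borel \<Phi>" by (simp only: e1)
  also have "\<dots> = distr (?D \<Otimes>\<^sub>M ?D) (borel \<Otimes>\<^sub>M borel) (\<lambda>(x, y). (\<Phi> x, \<Phi> y))"
    by (rule pair_measure_distr) (auto simp: e1 intro: lborel.sigma_finite_measure_axioms)
  also have "?D \<Otimes>\<^sub>M ?D = density ?M (\<lambda>(x, y). ennreal (J x) * ennreal (J y))"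
    by (rule pair_measure_density) (use sf lborel.sigma_finite_measure_axioms in auto)
  also have "(\<lambda>(x, y). ennreal (J x) * ennreal (J y)) = (\<lambda>p. ennreal (J (fst p) * J (snd p)))"
    by (auto simp: fun_eq_iff ennreal_mult J_nonneg)
  finally have e2: "?M = distr (density ?M (\<lambda>p. ennreal (J (fst p) * J (snd p)))) (borel \<Otimes>\<^sub>M borel) (\<lambda>(x, y). (\<Phi> x, \<Phi> y))" .
  have "(LINT p|?M. f p) = (LINT p|density ?M (\<lambda>p. ennreal (J (fst p) * J (snd p))). f (case p of (x, y) \<Rightarrow> (\<Phi> x, \<Phi> y)))"
    by (subst e2, rule integral_distr) measurable
  also have "\<dots> = (LINT p|?M. (J (fst p) * J (snd p)) *\<^sub>R f (case p of (x, y) \<Rightarrow> (\<Phi> x, \<Phi> y)))"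
    by (rule integral_density) (auto simp: J_nonneg)
  finally show ?thesis by (simp add: case_prod_unfold)
qed

lemma interaction_deformed:
  assumes u: "u \<in> borel_measurable borel"
  shows "interaction (deformed e t u) = (LINT (x, y)|(lborel \<Otimes>\<^sub>M lborel).
     J x * J y * (\<bar>u x\<bar>\<^sup>2 * \<bar>u y\<bar>\<^sup>2 * ln (norm (\<Phi> x - \<Phi> y))))"
proof -
  note [measurable] = u deformed_measurable[OF u]
  have m: "(\<lambda>(x, y). \<bar>deformed e t u x\<bar>\<^sup>2 * \<bar>deformed e t u y\<bar>\<^sup>2 * ln (norm (x - y))) \<in> borel_measurable (borel \<Otimes>\<^sub>M borel)"
    by measurable
  show ?thesis unfolding interaction_def stretch_integral_pair[OF m] by (simp add: deformed_\<Phi>)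
qed

end

text \<open>For a test function \<open>\<psi>\<close> the pairing of \<open>u\<close> with \<open>\<psi> \<circ> \<Phi>\<^sub>\<tau>\<close>, weighted by the Jacobian, has
  \<open>\<tau>\<close>-derivative \<open>\<integral> u \<partial>\<^sub>1(\<xi> (\<psi> \<circ> \<Phi>\<^sub>\<tau>))\<close>, so that only the weak gradient of \<open>u\<close> enters; the
  decay of the drift \<open>\<xi>\<close> pays for the logarithmic weight.\<close>

theorem deformed_diff_bound:
  assumes u: "u \<in> L2" "weak_gradient u g" and e: "0 < e" "e \<le> 1" and t: "0 \<le> t" "t \<le> 1 / 4"
  shows "(LINT x|lborel. log_weight x * (deformed e t u x - u x)\<^sup>2) \<le> 8 * t\<^sup>2 / e\<^sup>2 * (LINT x|lborel. (norm (g x))\<^sup>2)"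
proof -
  have e0: "e \<ge> 0" using e by simp
  interpret T: stretching e t using e t by unfold_locales
  define G where "G = (LINT x|lborel. (norm (g x))\<^sup>2)"
  have G0: "G \<ge> 0" by (simp add: G_def)
  note gL = weak_gradient_L2[OF u(2)] and um = L2_measurable_borel[OF u(1)]
  have w0: "log_weight x > 0" "log_weight x \<noteq> 0" for x using log_weight_ge_1[of x] by auto
  have "(LINT x|lborel. log_weight x * (deformed e t u x - u x)\<^sup>2) \<le> (sqrt (8 / e\<^sup>2 * G) * t)\<^sup>2"
  proof (rule weighted_duality(2))
    show "(\<lambda>x. deformed e t u x - u x) \<in> L2" by (intro L2_diff T.deformed_L2 u)
    show "log_weight \<in> borel_measurable borel" by measurable
    show "log_weight x \<ge> 1" for x by (rule log_weight_ge_1)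
    show "0 \<le> sqrt (8 / e\<^sup>2 * G) * t" using G0 t by simp
    fix \<psi> :: "plane \<Rightarrow> real" assume \<psi>: "test_function \<psi>"
    note \<psi>s = test_function_smooth[OF \<psi>]
    note \<psi>m = smooth_measurable[OF \<psi>s]
    define N where "N = (LINT x|lborel. (\<psi> x)\<^sup>2 / log_weight x)"
    define \<Theta> where "\<Theta> \<tau> y = stretch_jacobian e \<tau> y * \<psi> (stretch e \<tau> y)" for \<tau> y
    define h where "h \<tau> y = drift e y * (stretch_jacobian e \<tau> y * partial 1 \<psi> (stretch e \<tau> y)) + drift1 e y * \<psi> (stretch e \<tau> y)" for \<tau> y
    obtain R where R: "R > 0" "\<And>x. norm x \<ge> R \<Longrightarrow> \<psi> x = 0 \<and> partial 1 \<psi> x = 0"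
    proof -
      obtain R1 where R1: "R1 > 0" "\<And>x. norm x \<ge> R1 \<Longrightarrow> partial 1 \<psi> x = 0"
        using test_function_outside[OF test_function_partial[OF \<psi>]] by blast
      obtain R2 where R2: "R2 > 0" "\<And>x. norm x \<ge> R2 \<Longrightarrow> \<psi> x = 0"
        using test_function_outside[OF \<psi>] by blast
      show thesis using R1 R2 by (intro that[of "max R1 R2"]) auto
    qed
    have "\<bar>LINT y|lborel. u y * (\<Theta> t y - \<Theta> 0 y)\<bar> \<le> sqrt (8 / e\<^sup>2 * G) * sqrt N * t"
    proof (rule integral_parameter_bound[where h = h and R = "2 * R"])
      show "((\<lambda>\<tau>. \<Theta> \<tau> y) has_real_derivative h \<tau> y) (at \<tau>)" for \<tau> y
      proof -
        have s: "((\<lambda>\<tau>. stretch e \<tau> y) has_derivative (\<lambda>s. (s * drift e y) *\<^sub>R axis 1 1)) (at \<tau>)"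
          unfolding stretch_def by (auto intro!: derivative_eq_intros)
        have "((\<lambda>\<tau>. \<psi> (stretch e \<tau> y)) has_real_derivative drift e y * partial 1 \<psi> (stretch e \<tau> y)) (at \<tau>)"
          unfolding has_field_derivative_def
          by (rule has_derivative_eq_rhs[OF has_derivative_compose[OF s smooth_has_derivative'[OF \<psi>s]]])
             (auto simp: fun_eq_iff axis_def)
        moreover have "((\<lambda>\<tau>. stretch_jacobian e \<tau> y) has_real_derivative drift1 e y) (at \<tau>)"
          unfolding stretch_jacobian_def by (auto intro!: derivative_eq_intros)
        ultimately show ?thesis unfolding \<Theta>_def h_def
          by (auto intro!: derivative_eq_intros simp: mult_ac)
      qed
      have cs: "continuous_on UNIV (\<lambda>p. stretch e (fst p) (snd p))"
        unfolding stretch_def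
        by (intro continuous_intros continuous_on_compose2[OF smooth_continuous_on[OF drift_smooth[OF e0], of UNIV]]) auto
      have c: "continuous_on UNIV (\<lambda>p. f (stretch e (fst p) (snd p)))" "continuous_on UNIV (\<lambda>p. f (snd p))"
        if "smooth f" for f :: "plane \<Rightarrow> real"
        by (rule continuous_on_compose2[OF smooth_continuous_on[OF that, of UNIV] cs], simp)
           (rule continuous_on_compose2[OF smooth_continuous_on[OF that, of UNIV]], auto intro!: continuous_intros)
      show "continuous_on UNIV (\<lambda>(\<tau>, y). h \<tau> y)"
        unfolding h_def stretch_jacobian_def case_prod_unfold
        by (intro continuous_intros c smooth_partial \<psi>s drift_smooth drift1_smooth e0)
      show "h \<tau> y = 0" if "0 \<le> \<tau>" "\<tau> \<le> t" "norm y \<ge> 2 * R" for \<tau> y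
      proof -
        have "R \<le> norm (stretch e \<tau> y)"
          using norm_stretch_bounds(1)[OF e0 that(1), of y] that t by simp
        then show ?thesis using R(2) by (simp add: h_def)
      qed
      fix \<tau> assume \<tau>: "0 \<le> \<tau>" "\<tau> \<le> t"
      interpret S: stretching e \<tau> using e t \<tau> by unfold_locales auto
      note [measurable] = S.J_measurable S.\<Phi>_measurable smooth_measurable[OF drift_smooth[OF e0]] \<psi>m
      let ?\<phi> = "\<lambda>y. \<psi> (S.\<Phi> y)"
      have t\<phi>: "test_function ?\<phi>" by (rule S.test_function_compose_\<Phi>[OF \<psi>])
      let ?f = "\<lambda>y. drift e y * ?\<phi> y"
      have tf: "test_function ?f" by (rule test_function_mult[OF drift_smooth[OF e0] t\<phi>])
      have "h \<tau> y = partial 1 ?f y" for y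
        unfolding h_def partial_mult[OF drift_smooth[OF e0] test_function_smooth[OF t\<phi>]]
          partial_compose_stretch(1)[OF e0 \<psi>s] partial_drift(1)[OF e0] ..
      then have "(LINT y|lborel. u y * h \<tau> y) = - (LINT y|lborel. g y $ 1 * ?f y)"
        using weak_gradient_eq[OF u(2) tf, of 1] by simp
      also have "\<bar>\<dots>\<bar> \<le> sqrt (LINT y|lborel. (g y $ 1)\<^sup>2) * sqrt (LINT y|lborel. (?f y)\<^sup>2)"
        unfolding abs_minus_cancel by (rule L2_Cauchy_Schwarz[OF L2_component[OF gL] test_function_L2[OF tf]])
      also have "\<dots> \<le> sqrt G * sqrt (8 / e\<^sup>2 * N)"
      proof (intro mult_mono real_sqrt_le_mono)
        show "(LINT y|lborel. (g y $ 1)\<^sup>2) \<le> G"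
          unfolding G_def
        proof (rule integral_mono[OF L2_square_integrable[OF L2_component[OF gL]] L2_vector_integrable[OF gL]])
          show "(g y $ 1)\<^sup>2 \<le> (norm (g y))\<^sup>2" for y by (simp add: norm_plane)
        qed
        have m: "(\<lambda>x. (\<psi> x)\<^sup>2 / log_weight x) \<in> borel_measurable borel" by measurable
        have iN: "integrable lborel (\<lambda>x. (\<psi> x)\<^sup>2 / log_weight x)"
        proof (rule Bochner_Integration.integrable_bound[OF L2_square_integrable[OF test_function_L2[OF \<psi>]]])
          show "(\<lambda>x. (\<psi> x)\<^sup>2 / log_weight x) \<in> borel_measurable lborel" by measurable
          show "AE x in lborel. norm ((\<psi> x)\<^sup>2 / log_weight x) \<le> norm ((\<psi> x)\<^sup>2)"
          proof (rule AE_I2)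
            fix x show "norm ((\<psi> x)\<^sup>2 / log_weight x) \<le> norm ((\<psi> x)\<^sup>2)"
              using w0[of x] log_weight_ge_1[of x] mult_left_mono[of 1 "log_weight x" "(\<psi> x)\<^sup>2"]
              by (simp add: abs_divide pos_divide_le_eq)
          qed
        qed
        have iN': "integrable lborel (\<lambda>y. S.J y * ((?\<phi> y)\<^sup>2 / log_weight (S.\<Phi> y)))"
          using iN unfolding stretch_integral(2)[OF S.adm m] .
        have le: "(?f y)\<^sup>2 \<le> 8 / e\<^sup>2 * (S.J y * ((?\<phi> y)\<^sup>2 / log_weight (S.\<Phi> y)))" for y
        proof -
          have "(drift e y)\<^sup>2 * log_weight (S.\<Phi> y) \<le> 2 * (log_weight y * (drift e y)\<^sup>2)"
            using mult_right_mono[OF log_weight_stretch[OF S.adm, of y], of "(drift e y)\<^sup>2"] by (simp add: mult_ac)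
          also have "\<dots> \<le> 2 * (2 / e\<^sup>2)" by (intro mult_left_mono drift_weighted_bound e) simp
          also have "\<dots> \<le> 8 / e\<^sup>2 * S.J y"
            using mult_left_mono[OF stretch_jacobian_bounds(1)[OF S.adm, of y], of "8 / e\<^sup>2"] by simp
          finally have "(drift e y)\<^sup>2 \<le> 8 / e\<^sup>2 * S.J y / log_weight (S.\<Phi> y)"
            using w0[of "S.\<Phi> y"] by (subst pos_le_divide_eq) simp_all
          then have "(drift e y)\<^sup>2 * (?\<phi> y)\<^sup>2 \<le> 8 / e\<^sup>2 * S.J y / log_weight (S.\<Phi> y) * (?\<phi> y)\<^sup>2"
            by (rule mult_right_mono) simp
          then show ?thesis by (simp add: power_mult_distrib)
        qed
        have "(LINT y|lborel. (?f y)\<^sup>2) \<le> (LINT y|lborel. 8 / e\<^sup>2 * (S.J y * ((?\<phi> y)\<^sup>2 / log_weight (S.\<Phi> y))))"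
          by (rule integral_mono[OF L2_square_integrable[OF test_function_L2[OF tf]] integrable_mult_right[OF iN'] le])
        also have "\<dots> = 8 / e\<^sup>2 * N"
          unfolding N_def stretch_integral(1)[OF S.adm m] by (rule integral_mult_right_zero)
        finally show "(LINT y|lborel. (?f y)\<^sup>2) \<le> 8 / e\<^sup>2 * N" .
      qed (use G0 in auto)
      also have "\<dots> = sqrt (8 / e\<^sup>2 * G) * sqrt N" by (simp only: real_sqrt_mult mult_ac)
      finally show "\<bar>LINT y|lborel. u y * h \<tau> y\<bar> \<le> sqrt (8 / e\<^sup>2 * G) * sqrt N" .
    qed (use u t in auto)
    moreover have "(LINT x|lborel. (deformed e t u x - u x) * \<psi> x) = (LINT y|lborel. u y * (\<Theta> t y - \<Theta> 0 y))"
    proof -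
      note [measurable] = um \<psi>m T.deformed_measurable[OF um]
      note \<psi>L = test_function_L2[OF \<psi>]
      have m: "(\<lambda>x. deformed e t u x * \<psi> x) \<in> borel_measurable borel" by measurable
      have i: "integrable lborel (\<lambda>x. deformed e t u x * \<psi> x)"
        by (rule L2_integrable_mult[OF T.deformed_L2[OF u(1)] \<psi>L])
      then have i': "integrable lborel (\<lambda>y. u y * \<Theta> t y)"
        unfolding stretch_integral(2)[OF T.adm m] by (simp add: T.deformed_\<Phi> \<Theta>_def mult_ac)
      have z: "\<Theta> 0 y = \<psi> y" for y by (simp add: \<Theta>_def stretch_jacobian_def stretch_def)
      have "(LINT x|lborel. (deformed e t u x - u x) * \<psi> x) = (LINT x|lborel. deformed e t u x * \<psi> x) - (LINT x|lborel. u x * \<psi> x)"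
        using i L2_integrable_mult[OF u(1) \<psi>L] by (simp add: left_diff_distrib)
      also have "(LINT x|lborel. deformed e t u x * \<psi> x) = (LINT y|lborel. u y * \<Theta> t y)"
        unfolding stretch_integral(1)[OF T.adm m] by (simp add: T.deformed_\<Phi> \<Theta>_def mult_ac)
      finally show ?thesis
        using i' L2_integrable_mult[OF u(1) \<psi>L] by (simp add: z right_diff_distrib)
    qed
    ultimately show "\<bar>LINT x|lborel. (deformed e t u x - u x) * \<psi> x\<bar> \<le> sqrt (8 / e\<^sup>2 * G) * t * sqrt (LINT x|lborel. (\<psi> x)\<^sup>2 / log_weight x)"
      by (simp add: N_def mult_ac)
  qed
  also have "\<dots> = 8 * t\<^sup>2 / e\<^sup>2 * G" using G0 by (simp add: power_mult_distrib)
  finally show ?thesis by (simp add: G_def)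
qed

section \<open>What criticality says about competitors\<close>

lemma powr_abs_convex:
  fixes x y s p :: real
  assumes p: "p \<ge> 1" and s: "0 \<le> s" "s \<le> 1"
  shows "\<bar>x + s * (y - x)\<bar> powr p \<le> (1 - s) * \<bar>x\<bar> powr p + s * \<bar>y\<bar> powr p"
proof -
  have scale: "(r * z) powr p \<le> r * z powr p" if "0 \<le> r" "r \<le> 1" "0 \<le> z" for r z :: real
  proof -
    have "r powr p \<le> r powr 1" using that p by (intro powr_mono') auto
    also have "\<dots> = r" using that by simp
    finally show ?thesis using that by (simp add: powr_mult mult_right_mono)
  qed
  have conv: "((1 - s) * a + s * b) powr p \<le> (1 - s) * a powr p + s * b powr p" if "0 \<le> a" "0 \<le> b" for a b :: real
  proof (cases "a = 0 \<or> b = 0")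
    case True
    then show ?thesis using scale[of s b] scale[of "1 - s" a] s that p by auto
  next
    case False
    then show ?thesis
      using convex_onD[OF powr_convex[OF p] s, of a b] that by simp
  qed
  have "x + s * (y - x) = (1 - s) * x + s * y" by (simp add: algebra_simps)
  then have "\<bar>x + s * (y - x)\<bar> \<le> (1 - s) * \<bar>x\<bar> + s * \<bar>y\<bar>"
    using abs_triangle_ineq[of "(1 - s) * x" "s * y"] s by (simp add: abs_mult)
  then have "\<bar>x + s * (y - x)\<bar> powr p \<le> ((1 - s) * \<bar>x\<bar> + s * \<bar>y\<bar>) powr p"
    using p by (intro powr_mono2) auto
  also have "\<dots> \<le> (1 - s) * \<bar>x\<bar> powr p + s * \<bar>y\<bar> powr p" by (rule conv) auto
  finally show ?thesis .
qed

lemma derivative_le_secant_bound: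
  fixes f :: "real \<Rightarrow> real"
  assumes "(f has_real_derivative d) (at 0)" "\<And>s. 0 < s \<Longrightarrow> s \<le> 1 \<Longrightarrow> f s - f 0 \<le> s * B"
  shows "d \<le> B"
proof -
  have "((\<lambda>s. (f s - f 0) / s) \<longlongrightarrow> d) (at 0)"
    using assms(1) by (simp add: has_field_derivative_iff)
  then have "((\<lambda>s. (f s - f 0) / s) \<longlongrightarrow> d) (at_right 0)"
    by (rule filterlim_mono) (auto simp: at_within_le_at)
  moreover have "\<forall>\<^sub>F s in at_right 0. (f s - f 0) / s \<le> B"
    unfolding eventually_at_right_field
    using assms(2) by (intro exI[of _ 1]) (auto simp: pos_divide_le_eq mult.commute)
  ultimately show ?thesis by (intro tendsto_upperbound) auto
qed

lemma XI:
  assumes "weak_gradient f h" "interacting f" shows "f \<in> X"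
proof -
  have "integrable lborel (\<lambda>x. log_weight x * (f x)\<^sup>2 - (f x)\<^sup>2)"
    using assms(2) L2_square_integrable by (auto simp: interacting_def)
  then have "integrable lborel (\<lambda>x. ln (1 + norm x) * (f x)\<^sup>2)"
    by (simp add: log_weight_def algebra_simps)
  then show ?thesis using assms interacting_L2 by (auto simp: X_def H1_def)
qed

lemma X_interacting:
  assumes "f \<in> X"
  obtains h where "weak_gradient f h" "interacting f"
proof -
  from assms obtain h where h: "weak_gradient f h" and f: "f \<in> L2"
    and w: "integrable lborel (\<lambda>x. ln (1 + norm x) * (f x)\<^sup>2)"
    by (auto simp: X_def H1_def)
  have "integrable lborel (\<lambda>x. (f x)\<^sup>2 + ln (1 + norm x) * (f x)\<^sup>2)"
    using w L2_square_integrable[OF f] by simp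
  then have "integrable lborel (\<lambda>x. log_weight x * (f x)\<^sup>2)"
    by (simp add: log_weight_def algebra_simps)
  then have "interacting f"
    using f Sobolev_fourth_power[OF f h] by (simp add: interacting_def)
  with h that show thesis by blast
qed

lemma interaction_variation_diff:
  assumes "interacting u" "interacting m"
  shows "interaction_variation u (\<lambda>x. m x - u x) = interaction_variation u m - 2 * interaction u"
proof -
  let ?M = "(lborel \<Otimes>\<^sub>M lborel) :: (plane \<times> plane) measure"
  define E where "E = (\<lambda>(x, y). (u x * m x * (u y * u y) + u x * u x * (u y * m y)) * ln (norm (x - y)))"
  define N where "N = (\<lambda>(x, y). \<bar>u x\<bar>\<^sup>2 * \<bar>u y\<bar>\<^sup>2 * ln (norm (x - y)))"
  have i: "integrable ?M E" "integrable ?M N"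
    unfolding E_def N_def using interaction_variation_integrable interaction_integrable' assms by auto
  have "interaction_variation u (\<lambda>x. m x - u x) = (LINT p|?M. E p - 2 * N p)"
    unfolding interaction_variation_def
    by (rule Bochner_Integration.integral_cong) (auto simp: E_def N_def power2_eq_square algebra_simps)
  also have "\<dots> = interaction_variation u m - 2 * interaction u"
    using i by (simp add: interaction_variation_def interaction_def E_def N_def)
  finally show ?thesis .
qed

text \<open>Subtract the interaction from the functional: along the segment from \<open>u\<close> to \<open>m\<close> the rest is
  convex, because \<open>a \<le> 0\<close>, so that its derivative at \<open>u\<close> is at most its increment over the whole
  segment. The direction \<open>m - u\<close> is orthogonal to \<open>u\<close>, hence by criticality this derivative is
  the negative of that of the interaction.\<close>

theorem critical_point_convexity:
  assumes crit: "critical_point_on_S (F \<gamma> a p) c u" and a: "a \<le> 0" and p: "p > 2"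
    and g: "weak_gradient u g" and ui: "interacting u"
    and m: "interacting m" "weak_gradient m h" and mc: "(LINT x|lborel. u x * m x) = c"
  shows "0 \<le> 1 / 2 * ((LINT x|lborel. (norm (h x))\<^sup>2) - (LINT x|lborel. (norm (g x))\<^sup>2))
     - a / p * ((LINT x|lborel. \<bar>m x\<bar> powr p) - (LINT x|lborel. \<bar>u x\<bar> powr p))
     + \<gamma> / 2 * (interaction_variation u m - 2 * interaction u)"
proof -
  define \<psi> where "\<psi> x = m x - u x" for x
  define \<eta> where "\<eta> x = h x - g x" for x
  define K where "K f = (LINT x|lborel. (norm (f x))\<^sup>2)" for f :: "plane \<Rightarrow> plane"
  define P where "P f = (LINT x|lborel. \<bar>f x\<bar> powr p)" for f :: "plane \<Rightarrow> real"
  note uL = interacting_L2[OF ui] and mL = interacting_L2[OF m(1)]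
  have \<psi>i: "interacting \<psi>" using interacting_combination[OF m(1) ui, of "-1"] by (simp add: \<psi>_def[abs_def])
  have \<psi>g: "weak_gradient \<psi> \<eta>"
    using weak_gradient_combination[OF mL m(2) uL g, of "-1"] by (simp add: \<psi>_def[abs_def] \<eta>_def[abs_def])
  have uc: "(LINT x|lborel. (u x)\<^sup>2) = c" using crit by (auto simp: critical_point_on_S_def S_def)
  have "(LINT x|lborel. u x * \<psi> x) = 0"
    using L2_integrable_mult[OF uL mL] L2_square_integrable[OF uL] mc uc
    by (simp add: \<psi>_def right_diff_distrib power2_eq_square)
  then have d: "((\<lambda>s. F \<gamma> a p (\<lambda>x. u x + s * \<psi> x)) has_real_derivative 0) (at 0)"
    using crit XI[OF \<psi>g \<psi>i] by (auto simp: critical_point_on_S_def has_differential_along_def)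
  have sg: "weak_gradient (\<lambda>x. u x + s * \<psi> x) (\<lambda>x. g x + s *\<^sub>R \<eta> x)" for s
    by (rule weak_gradient_combination[OF uL g interacting_L2[OF \<psi>i] \<psi>g])
  have si: "interacting (\<lambda>x. u x + s * \<psi> x)" for s by (rule interacting_combination[OF ui \<psi>i])
  have Feq: "F \<gamma> a p (\<lambda>x. u x + s * \<psi> x)
     = (1 / 2 * K (\<lambda>x. g x + s *\<^sub>R \<eta> x) - a / p * P (\<lambda>x. u x + s * \<psi> x)) + \<gamma> / 4 * interaction (\<lambda>x. u x + s * \<psi> x)" for s
    unfolding F_def grad_energy[OF sg] K_def P_def interaction_def by simp
  define Q where "Q s = 1 / 2 * K (\<lambda>x. g x + s *\<^sub>R \<eta> x) - a / p * P (\<lambda>x. u x + s * \<psi> x)" for s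
  have "Q s = F \<gamma> a p (\<lambda>x. u x + s * \<psi> x) - \<gamma> / 4 * interaction (\<lambda>x. u x + s * \<psi> x)" for s
    unfolding Feq Q_def by simp
  then have Qd: "(Q has_real_derivative (0 - \<gamma> / 4 * (2 * interaction_variation u \<psi>))) (at 0)"
    using DERIV_diff[OF d DERIV_cmult[OF interaction_has_derivative[OF ui \<psi>i], of "\<gamma> / 4"]] by presburger
  have Pi: "integrable lborel (\<lambda>x. \<bar>u x\<bar> powr p)" "integrable lborel (\<lambda>x. \<bar>m x\<bar> powr p)"
    "integrable lborel (\<lambda>x. \<bar>u x + s * \<psi> x\<bar> powr p)" for s
    using Sobolev_embedding[OF uL g, of p] Sobolev_embedding[OF mL m(2), of p]
      Sobolev_embedding[OF interacting_L2[OF si] sg, of p s] p by auto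
  have Ki: "integrable lborel (\<lambda>x. (norm (g x))\<^sup>2)" "integrable lborel (\<lambda>x. (norm (h x))\<^sup>2)"
    "integrable lborel (\<lambda>x. (norm (g x + s *\<^sub>R \<eta> x))\<^sup>2)" for s
    using L2_vector_integrable weak_gradient_L2 g m(2) sg by blast+
  have "0 - \<gamma> / 4 * (2 * interaction_variation u \<psi>) \<le> 1 / 2 * (K h - K g) - a / p * (P m - P u)"
  proof (rule derivative_le_secant_bound[OF Qd])
    fix s :: real assume s: "0 < s" "s \<le> 1"
    have "K (\<lambda>x. g x + s *\<^sub>R \<eta> x) \<le> (LINT x|lborel. (1 - s) * (norm (g x))\<^sup>2 + s * (norm (h x))\<^sup>2)"
      unfolding K_def
    proof (intro integral_mono Ki Bochner_Integration.integrable_add integrable_mult_right)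
      fix x
      have "(1 - s) * (norm (g x))\<^sup>2 + s * (norm (h x))\<^sup>2 - (norm (g x + s *\<^sub>R \<eta> x))\<^sup>2 = s * (1 - s) * (norm (\<eta> x))\<^sup>2"
        unfolding \<eta>_def by (simp add: power2_norm_eq_inner inner_simps inner_commute algebra_simps)
      moreover have "0 \<le> s * (1 - s) * (norm (\<eta> x))\<^sup>2" using s by simp
      ultimately show "(norm (g x + s *\<^sub>R \<eta> x))\<^sup>2 \<le> (1 - s) * (norm (g x))\<^sup>2 + s * (norm (h x))\<^sup>2" by linarith
    qed
    also have "\<dots> = (1 - s) * K g + s * K h" unfolding K_def using Ki by simp
    finally have k: "K (\<lambda>x. g x + s *\<^sub>R \<eta> x) \<le> (1 - s) * K g + s * K h" .
    have "P (\<lambda>x. u x + s * \<psi> x) \<le> (LINT x|lborel. (1 - s) * \<bar>u x\<bar> powr p + s * \<bar>m x\<bar> powr p)"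
      unfolding P_def using powr_abs_convex[of p s] s p
      by (intro integral_mono Pi Bochner_Integration.integrable_add integrable_mult_right) (auto simp: \<psi>_def)
    also have "\<dots> = (1 - s) * P u + s * P m" unfolding P_def using Pi by simp
    finally have q: "P (\<lambda>x. u x + s * \<psi> x) \<le> (1 - s) * P u + s * P m" .
    have "a / p \<le> 0" using a p by (simp add: divide_nonpos_pos)
    then have "Q s \<le> 1 / 2 * ((1 - s) * K g + s * K h) - a / p * ((1 - s) * P u + s * P m)"
      unfolding Q_def by (intro diff_mono mult_left_mono mult_left_mono_neg k q) simp_all
    moreover have "Q 0 = 1 / 2 * K g - a / p * P u" by (simp add: Q_def)
    moreover have "1 / 2 * ((1 - s) * K g + s * K h) - a / p * ((1 - s) * P u + s * P m) - (1 / 2 * K g - a / p * P u)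
        = s * (1 / 2 * (K h - K g) - a / p * (P m - P u))"
      by (simp add: algebra_simps add_divide_distrib diff_divide_distrib)
    ultimately show "Q s - Q 0 \<le> s * (1 / 2 * (K h - K g) - a / p * (P m - P u))" by linarith
  qed
  moreover have "interaction_variation u \<psi> = interaction_variation u m - 2 * interaction u"
    unfolding \<psi>_def[abs_def] by (rule interaction_variation_diff[OF ui m(1)])
  then have "\<gamma> / 4 * (2 * interaction_variation u \<psi>) = \<gamma> / 2 * (interaction_variation u m - 2 * interaction u)"
    by simp
  moreover have "0 \<le> z + w" if "0 - y \<le> z" "y = w" for y z w :: real using that by linarith
  ultimately show ?thesis unfolding K_def P_def by blast
qed

section \<open>The rate of change of the interaction\<close>

text \<open>The derivative of \<open>ln |x - y|\<close> when the first coordinates are dilated at unit speed; on the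
  diagonal the quotient takes the library value \<open>0\<close>.\<close>

definition slope :: "plane \<times> plane \<Rightarrow> real" where
  "slope = (\<lambda>(x, y). (x $ 1 - y $ 1)\<^sup>2 / (norm (x - y))\<^sup>2)"

lemma slope_measurable: "slope \<in> borel_measurable (borel \<Otimes>\<^sub>M borel)"
  unfolding slope_def cart_eq_inner_axis by measurable

lemma slope_bounds: "0 \<le> slope q" "slope q \<le> 1"
proof -
  obtain x y where q: "q = (x, y)" by (cases q)
  have "(x $ 1 - y $ 1)\<^sup>2 \<le> (norm (x - y))\<^sup>2" by (simp add: norm_plane)
  then show "0 \<le> slope q" "slope q \<le> 1" by (auto simp: q slope_def divide_le_eq_1)
qed

lemma density_product_integrable:
  fixes f h :: "plane \<Rightarrow> real"
  assumes "integrable lborel f" "integrable lborel h"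
  shows "integrable (lborel \<Otimes>\<^sub>M lborel) (\<lambda>(x, y). f x * h y)"
proof (rule lborel_pair.Fubini_integrable)
  have [measurable]: "f \<in> borel_measurable borel" "h \<in> borel_measurable borel"
    using assms borel_measurable_integrable by force+
  show "(\<lambda>(x, y). f x * h y) \<in> borel_measurable (lborel \<Otimes>\<^sub>M lborel)" by measurable
  show "integrable lborel (\<lambda>x. LINT y|lborel. norm (case (x, y) of (x, y) \<Rightarrow> f x * h y))"
    using assms by (simp add: abs_mult)
  show "AE x in lborel. integrable lborel (\<lambda>y. case (x, y) of (x, y) \<Rightarrow> f x * h y)"
    using assms by simp
qed

text \<open>Otherwise, for some \<open>x\<close> with \<open>u(x) \<noteq> 0\<close>, the function \<open>u\<close> would vanish at almost every \<open>y\<close> with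
  \<open>y\<^sub>1 \<noteq> x\<^sub>1\<close>, and the remaining \<open>y\<close> form a null set.\<close>

lemma slope_integral_pos:
  assumes u: "interacting u" and nz: "(LINT x|lborel. (u x)\<^sup>2) > 0"
  shows "(LINT (x, y)|(lborel \<Otimes>\<^sub>M lborel). \<bar>u x\<bar>\<^sup>2 * \<bar>u y\<bar>\<^sup>2 * slope (x, y)) > 0"
proof (rule ccontr)
  let ?M = "(lborel \<Otimes>\<^sub>M lborel) :: (plane \<times> plane) measure"
  let ?f = "\<lambda>(x, y). \<bar>u x\<bar>\<^sup>2 * \<bar>u y\<bar>\<^sup>2 * slope (x, y)"
  assume "\<not> (LINT q|?M. ?f q) > 0"
  note um [measurable] = interacting_measurable[OF u]
  note [measurable] = slope_measurable
  have nn: "0 \<le> ?f q" for q using slope_bounds by (simp add: case_prod_unfold)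
  have i\<rho>: "integrable ?M (\<lambda>(x, y). \<bar>u x\<bar>\<^sup>2 * \<bar>u y\<bar>\<^sup>2)"
    using density_product_integrable[of "\<lambda>x. \<bar>u x\<bar>\<^sup>2" "\<lambda>x. \<bar>u x\<bar>\<^sup>2"] L2_square_integrable[OF interacting_L2[OF u]] by simp
  have i: "integrable ?M ?f"
    by (rule Bochner_Integration.integrable_bound[OF i\<rho>])
       (measurable, use slope_bounds in \<open>auto simp: case_prod_unfold abs_mult mult_left_le intro!: AE_I2\<close>)
  have "(LINT q|?M. ?f q) = 0"
  proof -
    have "0 \<le> (LINT q|?M. ?f q)" using nn by (intro integral_nonneg_AE AE_I2)
    with \<open>\<not> (LINT q|?M. ?f q) > 0\<close> show ?thesis by linarith
  qed
  then have "AE q in ?M. ?f q = 0"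
    using integral_nonneg_eq_0_iff_AE[OF i] nn by auto
  then have ae: "AE x in lborel. AE y in lborel. ?f (x, y) = 0"
    by (rule lborel_pair.AE_pair)
  have "\<not> (AE x in lborel. u x = 0)"
  proof
    assume "AE x in lborel. u x = 0"
    then have "(LINT x|lborel. (u x)\<^sup>2) = (LINT x|(lborel :: plane measure). 0)"
      by (intro integral_cong_AE) (auto elim: eventually_mono)
    with nz show False by simp
  qed
  then have "\<exists>x. u x \<noteq> 0 \<and> (AE y in lborel. ?f (x, y) = 0)"
    using ae by (metis (mono_tags, lifting) eventually_mono)
  then obtain x where x: "u x \<noteq> 0" "AE y in lborel. ?f (x, y) = 0" by blast
  have "negligible {y :: plane. y $ 1 = x $ 1}"
    using negligible_standard_hyperplane[of "axis 1 1 :: plane" "x $ 1"]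
    by (simp add: cart_eq_inner_axis[symmetric] axis_in_Basis_iff)
  then have "AE y :: plane in lebesgue. y $ 1 \<noteq> x $ 1"
    unfolding negligible_iff_null_sets by (auto simp: AE_iff_null_sets elim: AE_I')
  then have "AE y :: plane in lborel. y $ 1 \<noteq> x $ 1"
    by (simp add: AE_completion_iff)
  with x(2) have "AE y in lborel. u y = 0"
  proof eventually_elim
    case (elim y)
    then have "slope (x, y) \<noteq> 0" by (auto simp: slope_def)
    with elim x(1) show ?case by auto
  qed
  with \<open>\<not> (AE x in lborel. u x = 0)\<close> show False by blast
qed

section \<open>First-order expansions along vanishing stretchings\<close>

text \<open>The expansion \<open>f\<^sub>n = a + d t\<^sub>n + o(t\<^sub>n)\<close>. It behaves like a derivative with respect to \<open>t\<close>, but the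
  second parameter of the stretching may vary with \<open>n\<close>.\<close>

definition has_rate :: "(nat \<Rightarrow> real) \<Rightarrow> (nat \<Rightarrow> real) \<Rightarrow> real \<Rightarrow> real \<Rightarrow> bool" where
  "has_rate t f a d \<longleftrightarrow> (\<lambda>n. (f n - a) / t n) \<longlonglongrightarrow> d"

lemma has_rate_const: "has_rate t (\<lambda>n. a) a 0"
  by (simp add: has_rate_def)

lemma has_rate_add: "has_rate t f a d \<Longrightarrow> has_rate t g b d' \<Longrightarrow> has_rate t (\<lambda>n. f n + g n) (a + b) (d + d')"
  unfolding has_rate_def using tendsto_add[of "\<lambda>n. (f n - a) / t n" d sequentially "\<lambda>n. (g n - b) / t n" d']
  by (simp add: add_divide_distrib[symmetric] algebra_simps)

lemma has_rate_cmult: "has_rate t f a d \<Longrightarrow> has_rate t (\<lambda>n. c * f n) (c * a) (c * d)"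
  unfolding has_rate_def using tendsto_mult_left[of "\<lambda>n. (f n - a) / t n" d sequentially c]
  by (simp add: right_diff_distrib)

lemma has_rate_cong: "has_rate t f a d \<Longrightarrow> a = a' \<Longrightarrow> d = d' \<Longrightarrow> has_rate t f a' d'"
  by simp

locale vanishing_step =
  fixes t :: "nat \<Rightarrow> real"
  assumes t_pos: "\<And>n. 0 < t n" and t_lim: "t \<longlonglongrightarrow> 0"
begin

lemma has_rate_linear: "(\<lambda>n. b n) \<longlonglongrightarrow> d \<Longrightarrow> has_rate t (\<lambda>n. a + t n * b n) a d"
  unfolding has_rate_def using t_pos by (simp add: less_imp_neq[symmetric])

lemma has_rate_tendsto:
  assumes "has_rate t f a d" shows "f \<longlonglongrightarrow> a"
proof -
  have "(\<lambda>n. a + t n * ((f n - a) / t n)) \<longlonglongrightarrow> a + 0 * d"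
    using assms unfolding has_rate_def by (intro tendsto_intros t_lim)
  moreover have "a + t n * ((f n - a) / t n) = f n" for n using t_pos[of n] by simp
  ultimately show ?thesis by simp
qed

lemma has_rate_mult:
  assumes "has_rate t f a d" "has_rate t g b d'"
  shows "has_rate t (\<lambda>n. f n * g n) (a * b) (a * d' + d * b)"
proof -
  have "(\<lambda>n. f n * ((g n - b) / t n) + (f n - a) / t n * b) \<longlonglongrightarrow> a * d' + d * b"
    using assms has_rate_tendsto[OF assms(1)] unfolding has_rate_def by (intro tendsto_intros)
  moreover have "f n * ((g n - b) / t n) + (f n - a) / t n * b = (f n * g n - a * b) / t n" for n
    by (simp add: add_divide_distrib[symmetric] algebra_simps)
  ultimately show ?thesis unfolding has_rate_def by simp
qed

text \<open>The difference quotient factors through the continuous extension of the slope of \<open>\<phi>\<close> at \<open>a\<close>.\<close>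

lemma has_rate_compose:
  assumes f: "has_rate t f a d" and \<phi>: "(\<phi> has_real_derivative D) (at a)"
  shows "has_rate t (\<lambda>n. \<phi> (f n)) (\<phi> a) (D * d)"
proof -
  obtain q where q: "\<And>z. \<phi> z - \<phi> a = q z * (z - a)" "isCont q a" "q a = D"
    using \<phi> unfolding CARAT_DERIV by blast
  have "(\<lambda>n. q (f n) * ((f n - a) / t n)) \<longlonglongrightarrow> q a * d"
    using f isCont_tendsto_compose[OF q(2) has_rate_tendsto[OF f]] unfolding has_rate_def by (intro tendsto_intros)
  then show ?thesis unfolding has_rate_def q(1) q(3)[symmetric] by simp
qed

text \<open>Dominated convergence for the difference quotients.\<close>

lemma has_rate_integral:
  fixes f :: "nat \<Rightarrow> 'a \<Rightarrow> real"
  assumes m: "\<And>n. f n \<in> borel_measurable M" "f' \<in> borel_measurable M"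
    and i: "integrable M f0" "integrable M B"
    and le: "\<And>n x. \<bar>f n x - f0 x\<bar> \<le> t n * B x"
    and lim: "\<And>x. has_rate t (\<lambda>n. f n x) (f0 x) (f' x)"
  shows "has_rate t (\<lambda>n. LINT x|M. f n x) (LINT x|M. f0 x) (LINT x|M. f' x)"
proof -
  note [measurable] = m borel_measurable_integrable[OF i(1)]
  have B0: "0 \<le> B x" for x
  proof -
    have "0 \<le> t 0 * B x" using le[of 0 x] by linarith
    then show ?thesis using t_pos[of 0] by (simp add: zero_le_mult_iff)
  qed
  have id: "integrable M (\<lambda>x. f n x - f0 x)" for n
    by (rule Bochner_Integration.integrable_bound[OF integrable_mult_right[OF i(2), of "t n"]])
       (measurable, use le in \<open>auto intro!: AE_I2 order_trans[OF _ abs_ge_self]\<close>)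
  have fi: "integrable M (f n)" for n
    using Bochner_Integration.integrable_add[OF id[of n] i(1)] by simp
  have "(\<lambda>n. LINT x|M. (f n x - f0 x) / t n) \<longlonglongrightarrow> (LINT x|M. f' x)"
  proof (rule integral_dominated_convergence[OF _ _ i(2)])
    show "AE x in M. (\<lambda>n. (f n x - f0 x) / t n) \<longlonglongrightarrow> f' x"
      using lim unfolding has_rate_def by simp
    show "AE x in M. norm ((f n x - f0 x) / t n) \<le> B x" for n
      using le[of n] t_pos[of n] by (intro AE_I2) (simp add: abs_divide pos_divide_le_eq mult.commute)
  qed measurable
  moreover have "(LINT x|M. (f n x - f0 x) / t n) = ((LINT x|M. f n x) - (LINT x|M. f0 x)) / t n" for n
    using fi i(1) by simp
  ultimately show ?thesis unfolding has_rate_def by (simp only:)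
qed

end

text \<open>The step \<open>t\<close> has to vanish faster than \<open>\<epsilon>\<^sup>2\<close>: the distance between \<open>u\<close> and its transport
  deteriorates like \<open>t/\<epsilon>\<close> as the truncation of the drift is removed.\<close>

locale vanishing_stretchings = vanishing_step t for t :: "nat \<Rightarrow> real" +
  fixes e :: "nat \<Rightarrow> real"
  assumes e_pos: "\<And>n. 0 < e n" and e_le: "\<And>n. e n \<le> 1" and t_le: "\<And>n. t n \<le> 1 / 4"
    and e_lim: "e \<longlonglongrightarrow> 0" and ratio_lim: "(\<lambda>n. t n / (e n)\<^sup>2) \<longlonglongrightarrow> 0"
begin

lemma stretching: "stretching (e n) (t n)"
  using e_pos[of n] e_le[of n] t_pos[of n] t_le[of n] by unfold_locales auto

lemma en: "0 \<le> e n" and tn: "0 \<le> t n" and tn0: "t n \<noteq> 0"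
  using e_pos[of n] t_pos[of n] by auto

lemma drift_denom_lim: "(\<lambda>n. drift_denom (e n) x) \<longlonglongrightarrow> 1"
proof -
  have "(\<lambda>n. drift_denom (e n) x) \<longlonglongrightarrow> 1 + 0 * ((x $ 1)\<^sup>2 + (x $ 2)\<^sup>2)"
    unfolding drift_denom_def by (intro tendsto_intros e_lim)
  then show ?thesis by simp
qed

lemma drift_lim: "(\<lambda>n. drift (e n) x) \<longlonglongrightarrow> x $ 1"
proof -
  have "(\<lambda>n. drift (e n) x) \<longlonglongrightarrow> x $ 1 / 1"
    unfolding drift_def by (intro tendsto_intros drift_denom_lim) simp
  then show ?thesis by simp
qed

lemma drift1_lim: "(\<lambda>n. drift1 (e n) x) \<longlonglongrightarrow> 1"
proof -
  have "(\<lambda>n. drift1 (e n) x) \<longlonglongrightarrow> (1 + 0 * ((x $ 2)\<^sup>2 - (x $ 1)\<^sup>2)) / 1\<^sup>2"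
    unfolding drift1_def by (intro tendsto_intros drift_denom_lim e_lim) simp
  then show ?thesis by simp
qed

lemma drift2_lim: "(\<lambda>n. drift2 (e n) x) \<longlonglongrightarrow> 0"
proof -
  have "(\<lambda>n. drift2 (e n) x) \<longlonglongrightarrow> - (2 * 0 * (x $ 1 * x $ 2)) / 1\<^sup>2"
    unfolding drift2_def by (intro tendsto_intros drift_denom_lim e_lim) simp
  then show ?thesis by simp
qed

abbreviation Jn :: "nat \<Rightarrow> plane \<Rightarrow> real" where "Jn n \<equiv> stretch_jacobian (e n) (t n)"
abbreviation \<Phi>n :: "nat \<Rightarrow> plane \<Rightarrow> plane" where "\<Phi>n n \<equiv> stretch (e n) (t n)"

lemma Jn_rate: "has_rate t (\<lambda>n. Jn n x) 1 1"
  unfolding stretch_jacobian_def by (rule has_rate_linear[OF drift1_lim])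

lemma Jn_measurable [measurable]: "Jn n \<in> borel_measurable borel"
  by (rule stretching.J_measurable[OF stretching])

lemma \<Phi>n_measurable [measurable]: "\<Phi>n n \<in> borel_measurable borel"
  by (rule stretching.\<Phi>_measurable[OF stretching])

lemma Jn_dist: "\<bar>Jn n x - 1\<bar> \<le> t n"
  using abs_drift1_le_1[OF en, of n x] t_pos[of n] mult_left_mono[of "\<bar>drift1 (e n) x\<bar>" 1 "t n"]
  by (simp add: stretch_jacobian_def abs_mult)

lemma Jn_bounds: "1 / 2 \<le> Jn n x" "Jn n x \<le> 2"
  using stretch_jacobian_bounds[OF en tn t_le] by auto

lemma weighted_integral_rate:
  assumes f: "integrable lborel f"
  shows "has_rate t (\<lambda>n. LINT x|lborel. Jn n x * f x) (LINT x|lborel. f x) (LINT x|lborel. f x)"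
proof (rule has_rate_integral)
  have [measurable]: "f \<in> borel_measurable borel" using borel_measurable_integrable[OF f] by simp
  show "(\<lambda>x. Jn n x * f x) \<in> borel_measurable lborel" for n by measurable
  show "f \<in> borel_measurable lborel" by measurable
  show "integrable lborel f" "integrable lborel (\<lambda>x. \<bar>f x\<bar>)" using f by auto
  show "\<bar>Jn n x * f x - f x\<bar> \<le> t n * \<bar>f x\<bar>" for n x
    using mult_right_mono[OF Jn_dist abs_ge_zero, of n x "f x"] by (simp add: abs_mult[symmetric] algebra_simps)
  show "has_rate t (\<lambda>n. Jn n x * f x) (f x) (f x)" for x
    using has_rate_mult[OF Jn_rate has_rate_const, of x "f x"] by simp
qed

text \<open>To first order only the scaling of the first coordinate is visible, since \<open>J\<close> has rate \<open>1\<close> and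
  \<open>\<partial>\<^sub>2\<xi>\<close> tends to \<open>0\<close>: the square \<open>(\<partial>\<^sub>1u)\<^sup>2\<close> is multiplied by \<open>1/J\<close> and \<open>(\<partial>\<^sub>2u)\<^sup>2\<close> by \<open>J\<close>.\<close>

lemma energy_rate:
  assumes g: "g \<in> L2"
  shows "has_rate t (\<lambda>n. LINT y|lborel. Jn n y * (norm (deformed_grad (e n) (t n) g y))\<^sup>2)
     (LINT y|lborel. (norm (g y))\<^sup>2) (LINT y|lborel. (g y $ 2)\<^sup>2 - (g y $ 1)\<^sup>2)"
proof (rule has_rate_integral)
  note gm = L2_measurable_borel[OF g]
  note [measurable] = gm borel_measurable_component[OF gm]
  show "(\<lambda>y. Jn n y * (norm (deformed_grad (e n) (t n) g y))\<^sup>2) \<in> borel_measurable lborel" for n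
  proof -
    note [measurable] = stretching.deformed_grad_measurable[OF stretching gm, of n]
    show ?thesis by measurable
  qed
  show "(\<lambda>y. (g y $ 2)\<^sup>2 - (g y $ 1)\<^sup>2) \<in> borel_measurable lborel" by measurable
  show "integrable lborel (\<lambda>y. (norm (g y))\<^sup>2)" "integrable lborel (\<lambda>y. 8 * (norm (g y))\<^sup>2)"
    using L2_vector_integrable[OF g] by auto
  (* The factor t n is isolated in the bracket, whose remaining part tends to 0. *)
  have expand: "Jn n y * (norm (deformed_grad (e n) (t n) g y))\<^sup>2
      = (g y $ 1)\<^sup>2 * inverse (Jn n y) + Jn n y * (g y $ 2 + t n * (- drift2 (e n) y * (g y $ 1) * inverse (Jn n y)))\<^sup>2" for n y
    using Jn_bounds(1)[of n y] unfolding norm_plane deformed_grad_components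
    by (simp add: power2_eq_square field_simps)
  have inv_rate: "has_rate t (\<lambda>n. inverse (Jn n y)) 1 (- 1)" for y
    using has_rate_compose[OF Jn_rate DERIV_inverse, of y] by simp
  show "has_rate t (\<lambda>n. Jn n y * (norm (deformed_grad (e n) (t n) g y))\<^sup>2) ((norm (g y))\<^sup>2) ((g y $ 2)\<^sup>2 - (g y $ 1)\<^sup>2)" for y
  proof -
    have "(\<lambda>n. - drift2 (e n) y * (g y $ 1) * inverse (Jn n y)) \<longlonglongrightarrow> - 0 * (g y $ 1) * 1"
      by (intro tendsto_intros drift2_lim has_rate_tendsto[OF inv_rate])
    then have r: "has_rate t (\<lambda>n. g y $ 2 + t n * (- drift2 (e n) y * (g y $ 1) * inverse (Jn n y))) (g y $ 2) 0"
      by (intro has_rate_linear) simp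
    show ?thesis unfolding expand power2_eq_square[of "g y $ 2 + _"] norm_plane[of "g y"]
      by (rule has_rate_cong[OF has_rate_add[OF has_rate_cmult[OF inv_rate] has_rate_mult[OF Jn_rate has_rate_mult[OF r r]]]])
         (simp_all add: power2_eq_square)
  qed
  show "\<bar>Jn n y * (norm (deformed_grad (e n) (t n) g y))\<^sup>2 - (norm (g y))\<^sup>2\<bar> \<le> t n * (8 * (norm (g y))\<^sup>2)" for n y
  proof -
    define z where "z = - drift2 (e n) y * (g y $ 1) * inverse (Jn n y)"
    define A B where "A = g y $ 1" and "B = g y $ 2"
    have i2: "inverse (Jn n y) \<le> 2" "0 \<le> inverse (Jn n y)"
      using Jn_bounds(1)[of n y] by (auto simp: inverse_eq_divide divide_le_eq)
    have "\<bar>z\<bar> = \<bar>drift2 (e n) y\<bar> * \<bar>A\<bar> * inverse (Jn n y)" using i2 by (simp add: z_def A_def abs_mult)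
    also have "\<dots> \<le> 1 * \<bar>A\<bar> * 2"
      using i2 abs_drift2_le_1[OF en, of n y] by (intro mult_mono) auto
    finally have z: "\<bar>z\<bar> \<le> 2 * \<bar>A\<bar>" by simp
    from power_mono[OF z, of 2] have z2: "z\<^sup>2 \<le> 4 * A\<^sup>2" by (simp add: power_mult_distrib)
    have zB: "2 * \<bar>B * z\<bar> \<le> 2 * (A\<^sup>2 + B\<^sup>2)"
    proof -
      have "2 * \<bar>B * z\<bar> \<le> 2 * (2 * \<bar>A\<bar> * \<bar>B\<bar>)"
        using mult_left_mono[OF z abs_ge_zero[of B]] by (simp add: abs_mult mult_ac)
      also have "2 * \<bar>A\<bar> * \<bar>B\<bar> \<le> A\<^sup>2 + B\<^sup>2" using sum_squares_bound[of "\<bar>A\<bar>" "\<bar>B\<bar>"] by simp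
      finally show ?thesis by simp
    qed
    have t1: "\<bar>A\<^sup>2 * inverse (Jn n y) - A\<^sup>2\<bar> \<le> t n * (2 * A\<^sup>2)"
    proof -
      have "A\<^sup>2 * inverse (Jn n y) - A\<^sup>2 = A\<^sup>2 * inverse (Jn n y) * (1 - Jn n y)"
        using Jn_bounds(1)[of n y] by (simp add: field_simps)
      then have "\<bar>A\<^sup>2 * inverse (Jn n y) - A\<^sup>2\<bar> = A\<^sup>2 * inverse (Jn n y) * \<bar>Jn n y - 1\<bar>"
        using i2 by (simp add: abs_mult abs_minus_commute)
      also have "\<dots> \<le> (A\<^sup>2 * 2) * t n" using i2 Jn_dist[of n y] by (intro mult_mono) auto
      finally show ?thesis by (simp add: mult_ac)
    qed
    have t2: "\<bar>(Jn n y - 1) * B\<^sup>2\<bar> \<le> t n * B\<^sup>2"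
      using mult_right_mono[OF Jn_dist, of "B\<^sup>2" n y] by (simp add: abs_mult)
    have t3: "\<bar>Jn n y * (2 * t n * (B * z))\<bar> \<le> t n * (4 * (A\<^sup>2 + B\<^sup>2))"
    proof -
      have "\<bar>Jn n y * (2 * t n * (B * z))\<bar> = Jn n y * (t n * (2 * \<bar>B * z\<bar>))"
        using Jn_bounds(1)[of n y] tn[of n] by (simp add: abs_mult)
      also have "\<dots> \<le> 2 * (t n * (2 * (A\<^sup>2 + B\<^sup>2)))"
        using Jn_bounds[of n y] tn[of n] zB by (intro mult_mono mult_left_mono) auto
      finally show ?thesis by (simp add: algebra_simps)
    qed
    have t4: "\<bar>Jn n y * ((t n)\<^sup>2 * z\<^sup>2)\<bar> \<le> t n * (2 * A\<^sup>2)"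
    proof -
      have "\<bar>Jn n y * ((t n)\<^sup>2 * z\<^sup>2)\<bar> = Jn n y * (t n * (t n * z\<^sup>2))"
        using Jn_bounds(1)[of n y] tn[of n] by (simp add: abs_mult power2_eq_square)
      also have "\<dots> \<le> 2 * (t n * (1 / 4 * (4 * A\<^sup>2)))"
        using Jn_bounds[of n y] tn[of n] z2 t_le[of n] by (intro mult_mono mult_left_mono) auto
      finally show ?thesis by simp
    qed
    have "Jn n y * (norm (deformed_grad (e n) (t n) g y))\<^sup>2 - (norm (g y))\<^sup>2
       = (A\<^sup>2 * inverse (Jn n y) - A\<^sup>2) + (Jn n y - 1) * B\<^sup>2 + Jn n y * (2 * t n * (B * z)) + Jn n y * ((t n)\<^sup>2 * z\<^sup>2)"
      unfolding expand z_def[symmetric] norm_plane[of "g y"] unfolding A_def[symmetric] B_def[symmetric]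
      by (simp add: power2_eq_square algebra_simps)
    also have "\<bar>\<dots>\<bar> \<le> t n * (2 * A\<^sup>2) + t n * B\<^sup>2 + t n * (4 * (A\<^sup>2 + B\<^sup>2)) + t n * (2 * A\<^sup>2)"
      using t1 t2 t3 t4 by linarith
    also have "\<dots> \<le> t n * (8 * (A\<^sup>2 + B\<^sup>2))"
      using mult_nonneg_nonneg[OF tn[of n] zero_le_power2[of B]] by (simp add: algebra_simps)
    finally show ?thesis by (simp add: norm_plane A_def B_def)
  qed
qed

text \<open>As \<open>|\<Phi>(x) - \<Phi>(y)|\<^sup>2 = |x - y|\<^sup>2 (1 + t b)\<close> with \<open>b\<close> tending to twice the slope, this is the
  derivative of the logarithm at \<open>1\<close>.\<close>

lemma log_stretch_rate:
  assumes "x \<noteq> y"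
  shows "has_rate t (\<lambda>n. ln (norm (\<Phi>n n x - \<Phi>n n y))) (ln (norm (x - y))) (slope (x, y))"
proof -
  define d where "d n = drift (e n) x - drift (e n) y" for n
  define r where "r = (norm (x - y))\<^sup>2"
  define b where "b n = (2 * (x $ 1 - y $ 1) * d n + t n * (d n)\<^sup>2) / r" for n
  have r: "r > 0" using assms by (simp add: r_def)
  have sq: "(norm (\<Phi>n n x - \<Phi>n n y))\<^sup>2 = r * (1 + t n * b n)" for n
  proof -
    have e1: "r * (1 + t n * b n) = r + t n * (2 * (x $ 1 - y $ 1) * d n + t n * (d n)\<^sup>2)"
    proof -
      have "r * (1 + \<tau> * (q / r)) = r + \<tau> * q" for \<tau> q using r by (simp add: field_simps)
      then show ?thesis unfolding b_def .
    qed
    have e2: "r = (x $ 1 - y $ 1)\<^sup>2 + (x $ 2 - y $ 2)\<^sup>2" by (simp add: r_def norm_plane)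
    show ?thesis
      unfolding e1 norm_plane vector_minus_component stretch_components d_def
      by (simp add: e2 power2_eq_square algebra_simps)
  qed
  have pos: "norm (\<Phi>n n x - \<Phi>n n y) > 0" for n
    using stretch_bij[OF en tn t_le, of n] assms by (auto simp: bij_is_inj inj_eq)
  have bp: "1 + t n * b n > 0" for n
    using sq[of n] pos[of n] r by (metis zero_less_mult_pos zero_less_power)
  have ln_eq: "ln (norm (\<Phi>n n x - \<Phi>n n y)) = ln (norm (x - y)) + 1 / 2 * ln (1 + t n * b n)" for n
  proof -
    have "2 * ln (norm (\<Phi>n n x - \<Phi>n n y)) = ln ((norm (\<Phi>n n x - \<Phi>n n y))\<^sup>2)"
      using pos[of n] by (simp add: ln_realpow)
    also have "\<dots> = ln r + ln (1 + t n * b n)" unfolding sq using r bp[of n] by (rule ln_mult_pos)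
    also have "ln r = 2 * ln (norm (x - y))" using assms by (simp add: r_def ln_realpow)
    finally show ?thesis by simp
  qed
  have "d \<longlonglongrightarrow> x $ 1 - y $ 1" unfolding d_def by (intro tendsto_intros drift_lim)
  then have "b \<longlonglongrightarrow> (2 * (x $ 1 - y $ 1) * (x $ 1 - y $ 1) + 0 * (x $ 1 - y $ 1)\<^sup>2) / r"
    unfolding b_def using r by (intro tendsto_intros t_lim) auto
  moreover have "(2 * D * D + 0 * D\<^sup>2) / r = 2 * (D\<^sup>2 / r)" for D by (simp add: power2_eq_square)
  ultimately have "b \<longlonglongrightarrow> 2 * slope (x, y)" by (simp only: slope_def prod.case r_def)
  then have "has_rate t (\<lambda>n. 1 + t n * b n) 1 (2 * slope (x, y))"
    by (rule has_rate_linear)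
  from has_rate_compose[OF this DERIV_ln_divide[of 1]]
  have "has_rate t (\<lambda>n. ln (1 + t n * b n)) 0 (2 * slope (x, y))" by simp
  from has_rate_add[OF has_rate_const[of t "ln (norm (x - y))"] has_rate_cmult[OF this, of "1 / 2"]]
  show ?thesis unfolding ln_eq by simp
qed

text \<open>The map \<open>\<Phi>\<close> changes distances by factors between \<open>1 - 2t\<close> and \<open>1 + 2t\<close>. The bound does not
  depend on \<open>x\<close>, \<open>y\<close>, which makes dominated convergence possible near the diagonal.\<close>

lemma log_stretch_dist: "\<bar>ln (norm (\<Phi>n n x - \<Phi>n n y)) - ln (norm (x - y))\<bar> \<le> 4 * t n"
proof (cases "x = y")
  case True
  then show ?thesis using tn by simp
next
  case False
  define q where "q = norm (\<Phi>n n x - \<Phi>n n y) / norm (x - y)"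
  have n0: "norm (x - y) > 0" using False by simp
  have q: "1 - 2 * t n \<le> q" "q \<le> 1 + 2 * t n"
    using stretch_diff_bounds[where e="e n" and t="t n" and x=x and y=y, OF en tn] n0 by (auto simp: q_def pos_le_divide_eq pos_divide_le_eq)
  have q0: "q > 0" "1 / 2 \<le> q" using q(1) t_le[of n] by auto
  have "norm (\<Phi>n n x - \<Phi>n n y) > 0" using q0(1) n0 by (simp add: q_def zero_less_divide_iff)
  then have "ln (norm (\<Phi>n n x - \<Phi>n n y)) - ln (norm (x - y)) = ln q"
    using n0 by (simp add: q_def ln_div)
  moreover have "ln q \<le> 4 * t n" using ln_le_minus_one[OF q0(1)] q(2) tn[of n] by simp
  moreover have "- (4 * t n) \<le> ln q"
  proof -
    have "- ln q = ln (inverse q)" using q0 by (simp add: ln_inverse)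
    also have "\<dots> \<le> inverse q - 1" using q0 by (intro ln_le_minus_one) simp
    also have "\<dots> = (1 - q) * inverse q" using q0 by (simp add: field_simps)
    also have "\<dots> \<le> (2 * t n) * 2"
    proof (rule mult_mono)
      show "inverse q \<le> 2" using q0 by (simp add: inverse_eq_divide divide_le_eq)
    qed (use q q0 tn[of n] in auto)
    finally show ?thesis by simp
  qed
  ultimately show ?thesis by (simp add: abs_le_iff)
qed

text \<open>The two Jacobians contribute twice the interaction, the kernel contributes the slope.\<close>

lemma interaction_rate:
  assumes u: "interacting u"
  shows "has_rate t (\<lambda>n. interaction (deformed (e n) (t n) u)) (interaction u)
     (2 * interaction u + (LINT (x, y)|(lborel \<Otimes>\<^sub>M lborel). \<bar>u x\<bar>\<^sup>2 * \<bar>u y\<bar>\<^sup>2 * slope (x, y)))"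
proof -
  note um [measurable] = interacting_measurable[OF u]
  let ?M = "(lborel \<Otimes>\<^sub>M lborel) :: (plane \<times> plane) measure"
  define \<rho> where "\<rho> = (\<lambda>(x, y). \<bar>u x\<bar>\<^sup>2 * \<bar>u y\<bar>\<^sup>2)"
  define L where "L = (\<lambda>(x :: plane, y). ln (norm (x - y)))"
  define Ln where "Ln n = (\<lambda>(x, y). Jn n x * Jn n y * ln (norm (\<Phi>n n x - \<Phi>n n y)))" for n
  have [measurable]: "\<rho> \<in> borel_measurable (borel \<Otimes>\<^sub>M borel)" "L \<in> borel_measurable (borel \<Otimes>\<^sub>M borel)"
    "Ln n \<in> borel_measurable (borel \<Otimes>\<^sub>M borel)" for n
    unfolding \<rho>_def L_def Ln_def by measurable
  note [measurable] = slope_measurable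
  have \<rho>0: "0 \<le> \<rho> q" for q by (auto simp: \<rho>_def case_prod_unfold)
  have i\<rho>L: "integrable ?M (\<lambda>q. \<rho> q * L q)"
    using interaction_integrable'[OF u] by (simp add: \<rho>_def L_def case_prod_unfold)
  have i\<rho>: "integrable ?M \<rho>"
    using density_product_integrable[of "\<lambda>x. \<bar>u x\<bar>\<^sup>2" "\<lambda>x. \<bar>u x\<bar>\<^sup>2"] L2_square_integrable[OF interacting_L2[OF u]]
    by (simp add: \<rho>_def)
  have rate: "has_rate t (\<lambda>n. LINT q|?M. \<rho> q * Ln n q) (LINT q|?M. \<rho> q * L q) (LINT q|?M. \<rho> q * (2 * L q + slope q))"
  proof (rule has_rate_integral)
    show "(\<lambda>q. \<rho> q * Ln n q) \<in> borel_measurable ?M" for n by measurable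
    show "(\<lambda>q. \<rho> q * (2 * L q + slope q)) \<in> borel_measurable ?M" by measurable
    show "integrable ?M (\<lambda>q. \<rho> q * L q)" by (rule i\<rho>L)
    have "\<bar>\<rho> q * L q\<bar> = \<rho> q * \<bar>L q\<bar>" for q using \<rho>0 by (simp add: abs_mult)
    then have "integrable ?M (\<lambda>q. 16 * \<rho> q + 3 * (\<rho> q * \<bar>L q\<bar>))"
      using i\<rho> integrable_abs[OF i\<rho>L] by simp
    then show "integrable ?M (\<lambda>q. \<rho> q * (16 + 3 * \<bar>L q\<bar>))" by (simp add: algebra_simps)
    fix q :: "plane \<times> plane" obtain x y where q: "q = (x, y)" by (cases q)
    show "has_rate t (\<lambda>n. \<rho> q * Ln n q) (\<rho> q * L q) (\<rho> q * (2 * L q + slope q))"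
    proof (rule has_rate_cmult)
      show "has_rate t (\<lambda>n. Ln n q) (L q) (2 * L q + slope q)"
      proof (cases "x = y")
        case True
        (* On the diagonal both logarithms are ln 0 = 0. *)
        then show ?thesis by (simp add: q Ln_def L_def slope_def has_rate_const)
      next
        case False
        show ?thesis
          unfolding q Ln_def L_def prod.case
          by (rule has_rate_cong[OF has_rate_mult[OF has_rate_mult[OF Jn_rate Jn_rate] log_stretch_rate[OF False]]]) simp_all
      qed
    qed
    fix n
    have J2: "\<bar>Jn n x * Jn n y - 1\<bar> \<le> 3 * t n"
    proof -
      have "Jn n x * Jn n y - 1 = (Jn n x - 1) * Jn n y + (Jn n y - 1)" by (simp add: algebra_simps)
      moreover have "\<bar>(Jn n x - 1) * Jn n y\<bar> \<le> t n * 2"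
        unfolding abs_mult using Jn_dist[of n x] Jn_bounds[of n y] tn[of n] by (intro mult_mono) auto
      ultimately show ?thesis using Jn_dist[of n y] abs_triangle_ineq[of "(Jn n x - 1) * Jn n y" "Jn n y - 1"] by linarith
    qed
    have J4: "\<bar>Jn n x * Jn n y\<bar> \<le> 2 * 2"
      unfolding abs_mult using Jn_bounds[of n x] Jn_bounds[of n y] by (intro mult_mono) auto
    have "Ln n q - L q = Jn n x * Jn n y * (ln (norm (\<Phi>n n x - \<Phi>n n y)) - ln (norm (x - y))) + (Jn n x * Jn n y - 1) * ln (norm (x - y))"
      by (simp add: q Ln_def L_def algebra_simps)
    moreover have "\<bar>Jn n x * Jn n y * (ln (norm (\<Phi>n n x - \<Phi>n n y)) - ln (norm (x - y)))\<bar> \<le> 2 * 2 * (4 * t n)"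
      unfolding abs_mult[of "Jn n x * Jn n y"] using J4 log_stretch_dist[of n x y] by (intro mult_mono) auto
    moreover have "\<bar>(Jn n x * Jn n y - 1) * ln (norm (x - y))\<bar> \<le> 3 * t n * \<bar>L q\<bar>"
      unfolding abs_mult[of "Jn n x * Jn n y - 1"] using J2 by (auto simp: q L_def intro!: mult_right_mono)
    ultimately have "\<bar>Ln n q - L q\<bar> \<le> t n * (16 + 3 * \<bar>L q\<bar>)"
      by (simp add: algebra_simps)
    from mult_left_mono[OF this \<rho>0[of q]]
    have "\<rho> q * \<bar>Ln n q - L q\<bar> \<le> t n * (\<rho> q * (16 + 3 * \<bar>L q\<bar>))"
      by (simp only: mult.left_commute)
    then show "\<bar>\<rho> q * Ln n q - \<rho> q * L q\<bar> \<le> t n * (\<rho> q * (16 + 3 * \<bar>L q\<bar>))"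
      using \<rho>0[of q] by (simp only: right_diff_distrib[symmetric] abs_mult abs_of_nonneg)
  qed
  have islope: "integrable ?M (\<lambda>q. \<rho> q * slope q)"
  proof (rule Bochner_Integration.integrable_bound[OF i\<rho>])
    show "(\<lambda>q. \<rho> q * slope q) \<in> borel_measurable ?M" by measurable
    show "AE q in ?M. norm (\<rho> q * slope q) \<le> norm (\<rho> q)"
      using slope_bounds \<rho>0 by (intro AE_I2) (simp add: abs_mult mult_left_le)
  qed
  have "(LINT q|?M. \<rho> q * (2 * L q + slope q)) = (LINT q|?M. 2 * (\<rho> q * L q) + \<rho> q * slope q)"
    by (simp add: algebra_simps)
  also have "\<dots> = 2 * (LINT q|?M. \<rho> q * L q) + (LINT q|?M. \<rho> q * slope q)"
    using i\<rho>L islope by simp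
  finally have lim: "(LINT q|?M. \<rho> q * (2 * L q + slope q)) = 2 * (LINT q|?M. \<rho> q * L q) + (LINT q|?M. \<rho> q * slope q)" .
  have a: "interaction (deformed (e n) (t n) u) = (LINT q|?M. \<rho> q * Ln n q)" for n
    unfolding stretching.interaction_deformed[OF stretching um] by (simp add: \<rho>_def Ln_def case_prod_unfold mult_ac)
  have b: "interaction u = (LINT q|?M. \<rho> q * L q)"
    by (simp add: interaction_def \<rho>_def L_def case_prod_unfold)
  show ?thesis using rate unfolding a b lim by (simp add: \<rho>_def case_prod_unfold)
qed

text \<open>This is where the two scales are tied together: the errors of the expansions are of
  order \<open>t\<^sup>2 / \<epsilon>\<^sup>2\<close>, which is small compared with \<open>t\<close>.\<close>

lemma has_rate_negligible:
  assumes "\<And>n. \<bar>f n\<bar> \<le> C * ((t n)\<^sup>2 / (e n)\<^sup>2)" shows "has_rate t f 0 0"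
  unfolding has_rate_def
proof (rule Lim_null_comparison)
  show "\<forall>\<^sub>F n in sequentially. norm ((f n - 0) / t n) \<le> C * (t n / (e n)\<^sup>2)"
  proof (rule always_eventually, rule allI)
    fix n
    have eq: "C * (t n / (e n)\<^sup>2) * t n = C * ((t n)\<^sup>2 / (e n)\<^sup>2)"
      by (simp only: power2_eq_square[of "t n"] times_divide_eq_left times_divide_eq_right mult.assoc)
    have "norm ((f n - 0) / t n) = \<bar>f n\<bar> / t n" using t_pos[of n] by simp
    also have "\<dots> \<le> C * (t n / (e n)\<^sup>2)"
      by (subst pos_divide_le_eq[OF t_pos], subst eq, rule assms)
    finally show "norm ((f n - 0) / t n) \<le> C * (t n / (e n)\<^sup>2)" .
  qed
  show "(\<lambda>n. C * (t n / (e n)\<^sup>2)) \<longlonglongrightarrow> 0"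
    using tendsto_mult_right_zero[OF ratio_lim] .
qed

end

section \<open>Nonexistence\<close>

lemma weak_gradient_scale:
  assumes "u \<in> L2" "weak_gradient u g"
  shows "weak_gradient (\<lambda>x. s * u x) (\<lambda>x. s *\<^sub>R g x)"
proof -
  have "weak_gradient (\<lambda>x. 0) (\<lambda>x. 0)" by (simp add: weak_gradient_def L2_def)
  from weak_gradient_combination[OF L2_zero this assms, of s] show ?thesis by simp
qed

lemma interaction_variation_scale:
  "interaction_variation u (\<lambda>x. s * m x) = s * interaction_variation u m"
proof -
  have "interaction_variation u (\<lambda>x. s * m x) = (LINT q|(lborel \<Otimes>\<^sub>M lborel). s * (\<lambda>(x, y).
     (u x * m x * (u y * u y) + u x * u x * (u y * m y)) * ln (norm (x - y))) q)"
    unfolding interaction_variation_def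
    by (rule Bochner_Integration.integral_cong) (auto simp: algebra_simps)
  also have "\<dots> = s * interaction_variation u m"
    unfolding interaction_variation_def by (rule integral_mult_right_zero)
  finally show ?thesis .
qed

lemma vanishing_stretchings_cubic:
  "vanishing_stretchings (\<lambda>n. inverse (real (Suc n)) ^ 3 / 4) (\<lambda>n. inverse (real (Suc n)))"
proof -
  have e: "(\<lambda>n. inverse (real (Suc n))) \<longlonglongrightarrow> 0" by (rule LIMSEQ_inverse_real_of_nat)
  have l1: "(\<lambda>n. inverse (real (Suc n)) ^ 3 / 4) \<longlonglongrightarrow> 0 ^ 3 / 4" by (intro tendsto_intros e) simp
  have l2: "(\<lambda>n. inverse (real (Suc n)) / 4) \<longlonglongrightarrow> 0 / 4" by (intro tendsto_intros e) simp
  have r: "inverse (real (Suc n)) ^ 3 / 4 / (inverse (real (Suc n)))\<^sup>2 = inverse (real (Suc n)) / 4" for n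
    by (simp add: power2_eq_square power3_eq_cube)
  have b: "inverse (real (Suc n)) \<le> 1" "inverse (real (Suc n)) ^ 3 \<le> 1" for n
    by (auto simp: inverse_le_1_iff intro!: power_le_one)
  show ?thesis
  proof
    show "(\<lambda>n. inverse (real (Suc n)) ^ 3 / 4 / (inverse (real (Suc n)))\<^sup>2) \<longlonglongrightarrow> 0"
      unfolding r using l2 by simp
    show "(\<lambda>n. inverse (real (Suc n)) ^ 3 / 4) \<longlonglongrightarrow> 0" using l1 by simp
    show "inverse (real (Suc n)) ^ 3 / 4 \<le> 1 / 4" for n using b(2)[of n] by simp
  qed (use b(1) e in auto)
qed

theorem theorem1p4:
  fixes c \<gamma> a p :: real
  assumes "c > 0" and "\<gamma> < 0" and "a \<le> 0" and "p > 2"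
  shows "\<not> (\<exists>u. critical_point_on_S (F \<gamma> a p) c u)"
proof
  assume "\<exists>u. critical_point_on_S (F \<gamma> a p) c u"
  then obtain u where crit: "critical_point_on_S (F \<gamma> a p) c u" by blast
  then have uX: "u \<in> X" and uc: "(LINT x|lborel. (u x)\<^sup>2) = c"
    by (auto simp: critical_point_on_S_def S_def)
  obtain g where g: "weak_gradient u g" and ui: "interacting u"
    using X_interacting[OF uX] by blast
  note uL = interacting_L2[OF ui] and um = interacting_measurable[OF ui] and gL = weak_gradient_L2[OF g]
  (* With t of order e^3 the errors of order t^2 / e^2 are small compared with t. *)
  define e t :: "nat \<Rightarrow> real" where "e n = inverse (real (Suc n))" and "t n = inverse (real (Suc n)) ^ 3 / 4" for n
  interpret vanishing_stretchings t e
    using vanishing_stretchings_cubic by (simp add: e_def[abs_def] t_def[abs_def])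
  define V where "V n = deformed (e n) (t n) u" for n
  define G where "G n x = deformed_grad (e n) (t n) g (inv (\<Phi>n n) x)" for n x
  define A where "A = (LINT y|lborel. (g y $ 1)\<^sup>2)"
  define B where "B = (LINT y|lborel. (g y $ 2)\<^sup>2)"
  define K where "K = (LINT y|lborel. (norm (g y))\<^sup>2)"
  define P where "P = (LINT x|lborel. \<bar>u x\<bar> powr p)"
  define N where "N = interaction u"
  define M where "M = (LINT (x, y)|(lborel \<Otimes>\<^sub>M lborel). \<bar>u x\<bar>\<^sup>2 * \<bar>u y\<bar>\<^sup>2 * slope (x, y))"
  define Kn where "Kn n = (LINT x|lborel. (norm (G n x))\<^sup>2)" for n
  define Pn where "Pn n = (LINT x|lborel. \<bar>V n x\<bar> powr p)" for n
  define In where "In n = interaction_variation u (V n)" for n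
  (* The factor 1 / m n makes the competitor minus u orthogonal to u. *)
  define m where "m n = (LINT x|lborel. u x * V n x) / c" for n
  define \<mu> where "\<mu> n = inverse (m n)" for n
  have gi: "integrable lborel (\<lambda>y. (g y $ i)\<^sup>2)" for i by (rule L2_square_integrable[OF L2_component[OF gL]])
  have KAB: "K = A + B" unfolding K_def A_def B_def norm_plane using gi by simp
  have A0: "A \<ge> 0" and K0: "K \<ge> 0" and P0: "P \<ge> 0" by (simp_all add: A_def K_def P_def)
  have M0: "M > 0" unfolding M_def using slope_integral_pos[OF ui] uc assms(1) by simp
  have Vi: "interacting (V n)" and Vc: "interaction_const (V n) \<le> 4 * interaction_const u" for n
    unfolding V_def using stretching.deformed_interacting[OF stretching ui] by auto
  have Vg: "weak_gradient (V n) (G n)" for n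
    unfolding V_def G_def[abs_def] by (rule stretching.deformed_weak_gradient(1)[OF stretching uL g])
  define W where "W n = (LINT x|lborel. log_weight x * (V n x - u x)\<^sup>2)" for n
  have W: "W n \<le> 8 * K * ((t n)\<^sup>2 / (e n)\<^sup>2)" for n
    unfolding W_def V_def K_def
    using deformed_diff_bound[OF uL g e_pos e_le tn t_le, of n n] by (simp add: mult_ac)
  have vi: "interacting (\<lambda>x. V n x - u x)" for n
    using interacting_combination[OF Vi ui, of n "-1"] by simp
  have W1: "(LINT x|lborel. (V n x - u x)\<^sup>2) \<le> W n" for n
    unfolding W_def
  proof (rule integral_mono[OF L2_square_integrable[OF interacting_L2[OF vi]] interacting_weighted[OF vi]])
    show "(V n x - u x)\<^sup>2 \<le> log_weight x * (V n x - u x)\<^sup>2" for x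
      using mult_right_mono[OF log_weight_ge_1[of x], of "(V n x - u x)\<^sup>2"] by simp
  qed

  have m_rate: "has_rate t m 1 (1 / 2)"
  proof -
    (* The product is expressed by squares, and the square of V - u is negligible. *)
    have ex: "(LINT x|lborel. u x * V n x) = 1 / 2 * (c + (LINT x|lborel. Jn n x * (u x)\<^sup>2)) + (- 1 / 2) * (LINT x|lborel. (V n x - u x)\<^sup>2)" for n
    proof -
      have V2: "(LINT x|lborel. (V n x)\<^sup>2) = (LINT x|lborel. Jn n x * (u x)\<^sup>2)"
        unfolding V_def by (rule stretching.deformed_integral(1)[OF stretching um]) measurable
      have "(LINT x|lborel. (V n x - u x)\<^sup>2) = (LINT x|lborel. (V n x)\<^sup>2 + (u x)\<^sup>2 - 2 * (u x * V n x))"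
        by (rule Bochner_Integration.integral_cong) (auto simp: power2_eq_square algebra_simps)
      also have "\<dots> = (LINT x|lborel. (V n x)\<^sup>2) + c - 2 * (LINT x|lborel. u x * V n x)"
        using L2_square_integrable[OF uL] L2_square_integrable[OF interacting_L2[OF Vi]]
          L2_integrable_mult[OF uL interacting_L2[OF Vi]] uc by simp
      finally show ?thesis using V2 by (simp add: field_simps)
    qed
    have r1: "has_rate t (\<lambda>n. LINT x|lborel. Jn n x * (u x)\<^sup>2) c c"
      using weighted_integral_rate[OF L2_square_integrable[OF uL]] uc by simp
    have r2: "has_rate t (\<lambda>n. LINT x|lborel. (V n x - u x)\<^sup>2) 0 0"
    proof (rule has_rate_negligible)
      fix n
      have "0 \<le> (LINT x|lborel. (V n x - u x)\<^sup>2)" by simp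
      then show "\<bar>LINT x|lborel. (V n x - u x)\<^sup>2\<bar> \<le> 8 * K * ((t n)\<^sup>2 / (e n)\<^sup>2)"
        using W1[of n] W[of n] by linarith
    qed
    have r: "has_rate t (\<lambda>n. inverse c * (LINT x|lborel. u x * V n x)) (inverse c * c) (inverse c * (c / 2))"
      unfolding ex
      by (intro has_rate_cmult has_rate_cong[OF has_rate_add[OF has_rate_cmult[OF has_rate_add[OF has_rate_const r1]] has_rate_cmult[OF r2]]])
         simp_all
    show ?thesis
      unfolding m_def[abs_def] divide_inverse_commute[of _ c]
      by (rule has_rate_cong[OF r]) (use assms(1) in simp_all)
  qed
  have \<mu>_rate: "has_rate t \<mu> 1 (- 1 / 2)"
    using has_rate_compose[OF m_rate DERIV_inverse] unfolding \<mu>_def by simp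
  have \<mu>p_rate: "has_rate t (\<lambda>n. \<mu> n powr p) 1 (- p / 2)"
  proof -
    have "((\<lambda>x. x powr p) has_real_derivative p) (at 1)"
      using has_real_derivative_powr[of 1 p] by simp
    from has_rate_compose[OF \<mu>_rate this] show ?thesis by simp
  qed
  have K_rate: "has_rate t Kn K (B - A)"
  proof -
    have "Kn = (\<lambda>n. LINT y|lborel. Jn n y * (norm (deformed_grad (e n) (t n) g y))\<^sup>2)"
      unfolding Kn_def G_def by (rule ext, rule stretching.deformed_weak_gradient(2)[OF stretching uL g])
    moreover have "(LINT y|lborel. (g y $ 2)\<^sup>2 - (g y $ 1)\<^sup>2) = B - A"
      unfolding A_def B_def using gi by simp
    ultimately show ?thesis using energy_rate[OF gL] unfolding K_def by simp
  qed
  have P_rate: "has_rate t Pn P P"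
  proof -
    have i: "integrable lborel (\<lambda>x. \<bar>u x\<bar> powr p)" using Sobolev_embedding[OF uL g, of p] assms(4) by simp
    have "Pn = (\<lambda>n. LINT x|lborel. Jn n x * \<bar>u x\<bar> powr p)"
      unfolding Pn_def V_def by (rule ext, rule stretching.deformed_integral(1)[OF stretching um]) measurable
    then show ?thesis using weighted_integral_rate[OF i] unfolding P_def by simp
  qed
  have I_rate: "has_rate t In (2 * N) (N + M / 2)"
  proof -
    have r1: "has_rate t (\<lambda>n. interaction (V n)) N (2 * N + M)"
      unfolding V_def N_def M_def by (rule interaction_rate[OF ui])
    have r2: "has_rate t (\<lambda>n. In n - (3 / 2 * N + 1 / 2 * interaction (V n))) 0 0"
    proof (rule has_rate_negligible)
      fix n
      let ?C = "interaction_const u"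
      have "\<bar>In n - (3 / 2 * N + 1 / 2 * interaction (V n))\<bar> \<le> 2 * (?C + interaction_const (V n)) * W n"
        unfolding In_def N_def W_def by (rule interaction_variation_expansion[OF ui Vi])
      also have "\<dots> \<le> 10 * ?C * (8 * K * ((t n)\<^sup>2 / (e n)\<^sup>2))"
      proof (rule mult_mono[OF _ W])
        show "2 * (?C + interaction_const (V n)) \<le> 10 * ?C" using Vc[of n] by simp
        show "0 \<le> 10 * ?C" using interaction_const_nonneg by simp
        have "0 \<le> (LINT x|lborel. (V n x - u x)\<^sup>2)" by simp
        then show "0 \<le> W n" using W1[of n] by linarith
      qed
      finally show "\<bar>In n - (3 / 2 * N + 1 / 2 * interaction (V n))\<bar> \<le> 10 * ?C * (8 * K) * ((t n)\<^sup>2 / (e n)\<^sup>2)"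
        by (simp only: mult.assoc)
    qed
    have "has_rate t (\<lambda>n. (In n - (3 / 2 * N + 1 / 2 * interaction (V n))) + (3 / 2 * N + 1 / 2 * interaction (V n))) (2 * N) (N + M / 2)"
      by (rule has_rate_cong[OF has_rate_add[OF r2 has_rate_add[OF has_rate_const has_rate_cmult[OF r1]]]]) simp_all
    then show ?thesis by simp
  qed

  (* R n - R0 is the quantity that convexity makes nonnegative; d is its first-order coefficient. *)
  define R where "R n = 1 / 2 * (\<mu> n * \<mu> n * Kn n) + (- a / p) * (\<mu> n powr p * Pn n) + \<gamma> / 2 * (\<mu> n * In n)" for n
  define R0 where "R0 = 1 / 2 * K + (- a / p) * P + \<gamma> / 2 * (2 * N)"
  define d where "d = - A - a / p * (1 - p / 2) * P + \<gamma> / 4 * M"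
  have R_rate: "has_rate t R R0 d"
    unfolding R_def[abs_def] R0_def d_def
    by (rule has_rate_cong[OF has_rate_add[OF has_rate_add[OF
          has_rate_cmult[OF has_rate_mult[OF has_rate_mult[OF \<mu>_rate \<mu>_rate] K_rate]]
          has_rate_cmult[OF has_rate_mult[OF \<mu>p_rate P_rate]]]
          has_rate_cmult[OF has_rate_mult[OF \<mu>_rate I_rate]]]])
       (use assms(4) in \<open>simp_all add: KAB field_simps\<close>)
  have "\<forall>\<^sub>F n in sequentially. m n > 0"
    using has_rate_tendsto[OF m_rate] by (rule order_tendstoD) simp
  then have "\<forall>\<^sub>F n in sequentially. 0 \<le> (R n - R0) / t n"
  proof eventually_elim
    case (elim n)
    then have \<mu>0: "\<mu> n > 0" by (simp add: \<mu>_def)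
    have norm1: "(LINT x|lborel. u x * (\<mu> n * V n x)) = c"
    proof -
      have "(LINT x|lborel. u x * (\<mu> n * V n x)) = (LINT x|lborel. \<mu> n * (u x * V n x))"
        by (simp add: mult.left_commute)
      also have "\<dots> = \<mu> n * (m n * c)" using assms(1) by (simp add: m_def)
      also have "\<dots> = c" using elim by (simp add: \<mu>_def)
      finally show ?thesis .
    qed
    have k: "(LINT x|lborel. (norm (\<mu> n *\<^sub>R G n x))\<^sup>2) = \<mu> n * \<mu> n * Kn n"
      by (simp add: Kn_def power_mult_distrib) (simp add: power2_eq_square)
    have q: "(LINT x|lborel. \<bar>\<mu> n * V n x\<bar> powr p) = \<mu> n powr p * Pn n"
      using \<mu>0 by (simp add: Pn_def abs_mult powr_mult)
    have "0 \<le> 1 / 2 * (\<mu> n * \<mu> n * Kn n - K) - a / p * (\<mu> n powr p * Pn n - P) + \<gamma> / 2 * (\<mu> n * In n - 2 * N)"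
      using critical_point_convexity[OF crit assms(3,4) g ui interacting_scale[OF Vi, of "\<mu> n" n]
          weak_gradient_scale[OF interacting_L2[OF Vi] Vg, of "\<mu> n" n] norm1]
      unfolding k q interaction_variation_scale K_def P_def In_def N_def .
    also have "\<dots> = R n - R0" by (simp add: R_def R0_def algebra_simps)
    finally show ?case using tn[of n] by simp
  qed
  then have "0 \<le> d"
    using R_rate unfolding has_rate_def by (intro tendsto_lowerbound) auto
  moreover have "- a / p * (1 - p / 2) * P \<le> 0"
    using assms P0 by (intro mult_nonpos_nonneg mult_nonneg_nonpos divide_nonneg_pos) auto
  moreover have "\<gamma> / 4 * M < 0" using M0 assms(2) by (simp add: mult_neg_pos)
  ultimately show False using A0 unfolding d_def by simp
qed

end
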